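(* Let $Z=\{Z_t,\ t\ge0\}$ be a real strictly stable process with index $\alpha\in(0,2]$ such that $|Z|$ is not a subordinator. For every $p>\max(1,\alpha)$, there exists $\mathcal K_{\alpha,p}\in(0,+\infty)$ such that $$\lim_{\varepsilon\downarrow0}\varepsilon^{\frac{p\alpha}{p-\alpha}}\log\mathbb P\left[\|Z\|_p\le\varepsilon\right]=-\mathcal K_{\alpha,p}.$$
   Context: A real strictly stable process with index $\alpha\in(0,2]$ is a real Lévy process $Z$ (with $Z_0=0$) such that for every $k>0$, $\{Z_{kt},\,t\ge0\}$ and $\{k^{1/\alpha}Z_t,\,t\ge0\}$ have the same law; the trivial case where $Z$ is a pure drift (including $Z\equiv 0$) is excluded. So for $\alpha=2$, $Z=aW$ with $a\ne0$ and $W$ a standard linear Brownian motion; for $\alpha<2$, $Z$ has a nonzero Lévy measure of the form $c_+z^{-\alpha-1}\mathbf 1_{\{z>0\}}dz+c_-|z|^{-\alpha-1}\mathbf 1_{\{z<0\}}dz$. A càdlàg (continuous if $\alpha=2$) version is used. The strong $p$-variation on $[0,1]$ of a function $f$ is $$\|f\|_p=\left(\sup_{t_0<\dots<t_k\in[0,1]}\sum_{j=1}^k|f(t_j)-f(t_{j-1})|^p\right)^{1/p},$$ the supremum being over all $k$ and all such finite sequences. "$|Z|$ is a subordinator" means that $Z$ or $-Z$ is a subordinator (a Lévy process with a.s. nondecreasing paths). The constant $\mathcal K_{\alpha,p}$ may depend on the law of $Z$. *)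

theory Defs
  imports "HOL-Probability.Probability"
begin

text \<open>Processes are functions \<open>Z t \<omega>\<close> with a real time argument; only times \<open>t \<ge> 0\<close> are meaningful.\<close>

definition cadlag :: "(real \<Rightarrow> real) \<Rightarrow> bool" where
  "cadlag f \<longleftrightarrow>
     (\<forall>t\<ge>0. (f \<longlongrightarrow> f t) (at_right t)) \<and>
     (\<forall>t>0. \<exists>l. (f \<longlongrightarrow> l) (at_left t))"

text \<open>
  The version with every path (not just almost every path) cadlag is taken, so that events
  depending on uncountably many times, such as bounds on the strong variation, are measurable
  without completing the probability space.
\<close>

definition levy_process :: "'a measure \<Rightarrow> (real \<Rightarrow> 'a \<Rightarrow> real) \<Rightarrow> bool" where
  "levy_process M Z \<longleftrightarrow>
     prob_space M \<and>
     (\<forall>t\<ge>0. Z t \<in> borel_measurable M) \<and>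
     (AE \<omega> in M. Z 0 \<omega> = 0) \<and>
     (\<forall>n (t :: nat \<Rightarrow> real). 0 \<le> t 0 \<and> strict_mono_on {..n} t \<longrightarrow>
        prob_space.indep_vars M (\<lambda>_. borel) (\<lambda>i \<omega>. Z (t (Suc i)) \<omega> - Z (t i) \<omega>) {..<n}) \<and>
     (\<forall>s\<ge>0. \<forall>h\<ge>0.
        distr M borel (\<lambda>\<omega>. Z (s + h) \<omega> - Z s \<omega>) = distr M borel (\<lambda>\<omega>. Z h \<omega> - Z 0 \<omega>)) \<and>
     (\<forall>\<omega>\<in>space M. cadlag (\<lambda>t. Z t \<omega>))"

definition subordinator :: "'a measure \<Rightarrow> (real \<Rightarrow> 'a \<Rightarrow> real) \<Rightarrow> bool" where
  "subordinator M Z \<longleftrightarrow>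
     levy_process M Z \<and> (AE \<omega> in M. mono_on {0..} (\<lambda>t. Z t \<omega>))"

definition process_law :: "'a measure \<Rightarrow> (real \<Rightarrow> 'a \<Rightarrow> real) \<Rightarrow> (real \<Rightarrow> real) measure" where
  "process_law M Z = distr M (\<Pi>\<^sub>M t\<in>{0..}. borel) (\<lambda>\<omega>. \<lambda>t\<in>{0..}. Z t \<omega>)"

definition pure_drift :: "'a measure \<Rightarrow> (real \<Rightarrow> 'a \<Rightarrow> real) \<Rightarrow> bool" where
  "pure_drift M Z \<longleftrightarrow> (\<exists>c. AE \<omega> in M. \<forall>t\<ge>0. Z t \<omega> = c * t)"

definition strictly_stable :: "'a measure \<Rightarrow> real \<Rightarrow> (real \<Rightarrow> 'a \<Rightarrow> real) \<Rightarrow> bool" where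
  "strictly_stable M \<alpha> Z \<longleftrightarrow>
     0 < \<alpha> \<and> \<alpha> \<le> 2 \<and>
     levy_process M Z \<and>
     (\<forall>k>0. process_law M (\<lambda>t. Z (k * t)) = process_law M (\<lambda>t \<omega>. k powr (1 / \<alpha>) * Z t \<omega>)) \<and>
     \<not> pure_drift M Z \<and>
     (\<alpha> = 2 \<longrightarrow> (\<forall>\<omega>\<in>space M. continuous_on {0..} (\<lambda>t. Z t \<omega>)))"

definition variation_sum :: "real \<Rightarrow> (real \<Rightarrow> real) \<Rightarrow> ennreal" where
  "variation_sum p f =
     (SUP (k, t) \<in> {(k :: nat, t :: nat \<Rightarrow> real). strict_mono_on {..k} t \<and> t ` {..k} \<subseteq> {0..1}}.
        ennreal (\<Sum>j = 1..k. \<bar>f (t j) - f (t (j - 1))\<bar> powr p))"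

text \<open>The real power \<open>1 / p\<close> is extended to \<open>[0, \<infinity>]\<close> by \<open>\<infinity> \<mapsto> \<infinity>\<close>.\<close>

definition strong_variation :: "real \<Rightarrow> (real \<Rightarrow> real) \<Rightarrow> ennreal" where
  "strong_variation p f =
     (if variation_sum p f = \<infinity> then \<infinity>
      else ennreal (enn2real (variation_sum p f) powr (1 / p)))"

end

theory Submission
  imports Defs "HOL-Real_Asymp.Real_Asymp"
begin

text \<open>
  Let \<open>V\<^sub>n\<close> be the \<open>p\<close>-th power of the strong \<open>p\<close>-variation on \<open>[0, n]\<close>. It is superadditive under
  concatenation of time intervals, so independence and stationarity of the increments give
  \<open>E exp (- l V\<^sub>n) \<le> (E exp (- l V\<^sub>1))^n\<close>, while self-similarity says that \<open>V\<^sub>n\<close> has the law of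
  \<open>n^(p/\<alpha>) V\<^sub>1\<close>. By Fekete's argument \<open>- log E exp (- l V\<^sub>1)\<close> is asymptotic to \<open>C l^(\<alpha>/p)\<close>, and an
  exponential Tauberian theorem of de Bruijn type turns this into the small deviation estimate.

  It remains to see that \<open>0 < C < \<infinity>\<close>. Positivity holds because \<open>V\<^sub>1\<close> is not almost surely zero. For
  finiteness one needs \<open>P (V\<^sub>n \<le> c n) \<ge> q^n\<close> for some \<open>q > 0\<close>: since neither \<open>Z\<close> nor \<open>- Z\<close> is a
  subordinator, each unit block can be asked, with probability bounded below, to have bounded
  variation and to move back towards the origin. This presupposes \<open>V\<^sub>1 < \<infinity>\<close> almost surely, which
  follows from counting increments: if \<open>N\<^sub>h\<close> is the largest number of disjoint increments exceeding
  \<open>h\<close> on \<open>[0, 1]\<close>, then \<open>E N\<^sub>h \<le> const h^(-\<alpha>)\<close> by self-similarity and a first-passage argument, and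
  \<open>V\<^sub>1\<close> is dominated by a sum of \<open>2^(-rp/\<alpha>) N\<^sub>h\<close> over \<open>h = 2^(-r/\<alpha>)\<close>, which converges as \<open>p > \<alpha>\<close>.
\<close>

section \<open>Generalised variation\<close>

text \<open>The variation is only superadditive: an increment that straddles two blocks counts for
  the whole but for neither block. Upper estimates therefore pay for each junction, with one extra
  large increment per block in the counting argument and with a bounded position in the steering
  argument. Blocks of bounded variation alone could drift away and leave an increment of order n,
  whose p-th power for p > 1 beats every linear bound. The Laplace transform is used rather than P
  (V <= x) because it turns superadditivity into submultiplicativity without having to share x among
  the blocks. Functionals are taken over rational times: they are then measurable for the product
  sigma-algebra, where process laws live, and right continuity restores the real times at the end.
  The set of rational times is preserved by rational shifts and dilations only, whence block lengths
  and scaling factors that are integers or powers of 2.\<close>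

text \<open>
  Increments are measured by an arbitrary weight \<open>\<phi>\<close>: the power \<open>\<bar>d\<bar>^p\<close> gives the variation, the
  indicator of \<open>\<bar>d\<bar> > h\<close> counts disjoint large increments. Time sets are arbitrary, so that
  countable ones can be used for measurability.
\<close>


fun vsum :: "(real \<Rightarrow> real) \<Rightarrow> (real \<Rightarrow> real) \<Rightarrow> real list \<Rightarrow> real" where
  "vsum \<phi> f (x # y # zs) = \<phi> (f y - f x) + vsum \<phi> f (y # zs)"
| "vsum \<phi> f [x] = 0"
| "vsum \<phi> f [] = 0"

text \<open>Lists are only weakly sorted, so that the image of a list under a monotone map that
  merges times is still admissible; a repeated time contributes \<open>\<phi> 0\<close>, which
  vanishes for the weights used here.\<close>

definition gvar :: "(real \<Rightarrow> real) \<Rightarrow> real set \<Rightarrow> (real \<Rightarrow> real) \<Rightarrow> ennreal" where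
  "gvar \<phi> A f = (SUP ts\<in>{ts. sorted ts \<and> set ts \<subseteq> A}. ennreal (vsum \<phi> f ts))"

lemma vsum_nonneg: "(\<And>d. 0 \<le> \<phi> d) \<Longrightarrow> 0 \<le> vsum \<phi> f ts"
  by (induction \<phi> f ts rule: vsum.induct) auto

lemma vsum_Cons:
  "vsum \<phi> f (x # ys) = (if ys = [] then 0 else \<phi> (f (hd ys) - f x)) + vsum \<phi> f ys"
  by (cases ys) auto

lemma vsum_append:
  "vsum \<phi> f (xs @ ys) =
     vsum \<phi> f xs + (if xs = [] \<or> ys = [] then 0 else \<phi> (f (hd ys) - f (last xs))) + vsum \<phi> f ys"
  by (induction xs) (auto simp: vsum_Cons)

lemma vsum_comp: "vsum \<phi> (\<lambda>t. f (g t)) ts = vsum \<phi> f (map g ts)"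
  by (induction ts) (auto simp: vsum_Cons hd_map)

lemma vsum_shift: "vsum \<phi> (\<lambda>t. f t - c) ts = vsum \<phi> f ts"
  by (induction ts) (auto simp: vsum_Cons)

lemma vsum_cmult: "vsum \<phi> (\<lambda>t. c * f t) ts = vsum (\<lambda>d. \<phi> (c * d)) f ts"
  by (induction ts) (auto simp: vsum_Cons algebra_simps)

lemma vsum_cong: "(\<And>t. t \<in> set ts \<Longrightarrow> f t = g t) \<Longrightarrow> vsum \<phi> f ts = vsum \<phi> g ts"
  by (induction ts) (auto simp: vsum_Cons)


lemma vsum_map_upt:
  "vsum \<phi> f (map t [0..<Suc k]) = (\<Sum>j = 1..k. \<phi> (f (t j) - f (t (j - 1))))"
proof (induction k)
  case (Suc k)
  have "map t [0..<Suc (Suc k)] = map t [0..<Suc k] @ [t (Suc k)]" by simp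
  then have "vsum \<phi> f (map t [0..<Suc (Suc k)]) =
      vsum \<phi> f (map t [0..<Suc k]) + \<phi> (f (t (Suc k)) - f (t k))"
    by (simp only: vsum_append) simp
  then show ?case using Suc by simp
qed simp

section \<open>Monotonicity, changes of time and scale, splitting of the time set\<close>

lemma gvar_upper: "sorted ts \<Longrightarrow> set ts \<subseteq> A \<Longrightarrow> ennreal (vsum \<phi> f ts) \<le> gvar \<phi> A f"
  unfolding gvar_def by (rule SUP_upper) simp

lemma gvar_least:
  "(\<And>ts. sorted ts \<Longrightarrow> set ts \<subseteq> A \<Longrightarrow> ennreal (vsum \<phi> f ts) \<le> c) \<Longrightarrow> gvar \<phi> A f \<le> c"
  unfolding gvar_def by (rule SUP_least) simp

lemma gvar_mono: "A \<subseteq> B \<Longrightarrow> gvar \<phi> A f \<le> gvar \<phi> B f"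
  by (rule gvar_least) (auto intro: gvar_upper)

lemma gvar_cong: "(\<And>t. t \<in> A \<Longrightarrow> f t = g t) \<Longrightarrow> gvar \<phi> A f = gvar \<phi> A g"
  unfolding gvar_def by (rule SUP_cong) (auto intro!: arg_cong[where f = ennreal] vsum_cong)

lemma gvar_shift: "gvar \<phi> A (\<lambda>t. f t - c) = gvar \<phi> A f"
  by (simp add: gvar_def vsum_shift)

lemma gvar_cmult: "gvar \<phi> A (\<lambda>t. c * f t) = gvar (\<lambda>d. \<phi> (c * d)) A f"
  by (simp add: gvar_def vsum_cmult)

lemma gvar_comp_le:
  assumes "mono g" shows "gvar \<phi> A (\<lambda>t. f (g t)) \<le> gvar \<phi> (g ` A) f"
proof (rule gvar_least)
  fix ts assume "sorted ts" "set ts \<subseteq> A"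
  then have "sorted (map g ts)" "set (map g ts) \<subseteq> g ` A"
    using assms by (auto simp: sorted_map mono_def intro: sorted_wrt_mono_rel[rotated])
  then show "ennreal (vsum \<phi> (\<lambda>t. f (g t)) ts) \<le> gvar \<phi> (g ` A) f"
    unfolding vsum_comp by (rule gvar_upper)
qed

lemma gvar_comp:
  assumes "mono g" "mono h" "\<And>t. h (g t) = t" "\<And>t. g (h t) = t"
  shows "gvar \<phi> A (\<lambda>t. f (g t)) = gvar \<phi> (g ` A) f"
proof (rule antisym[OF gvar_comp_le[OF assms(1)]])
  have "gvar \<phi> (g ` A) f = gvar \<phi> (g ` A) (\<lambda>t. (\<lambda>u. f (g u)) (h t))"
    by (simp add: assms)
  also have "\<dots> \<le> gvar \<phi> (h ` g ` A) (\<lambda>u. f (g u))"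
    by (rule gvar_comp_le[OF assms(2)])
  also have "h ` g ` A = A" by (simp add: image_image assms)
  finally show "gvar \<phi> (g ` A) f \<le> gvar \<phi> A (\<lambda>t. f (g t))" .
qed

lemma gvar_translate: "gvar \<phi> A (\<lambda>t. f (s + t)) = gvar \<phi> ((+) s ` A) f"
  by (rule gvar_comp[where h = "\<lambda>t. t - s"]) (auto simp: mono_def)

lemma gvar_dilate: "0 < k \<Longrightarrow> gvar \<phi> A (\<lambda>t. f (k * t)) = gvar \<phi> ((*) k ` A) f"
  by (rule gvar_comp[where h = "\<lambda>t. t / k"]) (auto simp: mono_def divide_right_mono)

text \<open>Time lists from the two sides are concatenated; the increment across the junction is
  dropped, as it has nonnegative weight. A common endpoint is allowed.\<close>

lemma gvar_superadd:
  assumes \<phi>: "\<And>d. 0 \<le> \<phi> d" and AB: "\<And>a b. a \<in> A \<Longrightarrow> b \<in> B \<Longrightarrow> a \<le> b"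
  shows "gvar \<phi> A f + gvar \<phi> B f \<le> gvar \<phi> (A \<union> B) f"
proof -
  have "ennreal (vsum \<phi> f ts) + ennreal (vsum \<phi> f us) \<le> gvar \<phi> (A \<union> B) f"
    if "sorted ts" "set ts \<subseteq> A" "sorted us" "set us \<subseteq> B" for ts us
  proof -
    have "ennreal (vsum \<phi> f ts) + ennreal (vsum \<phi> f us) = ennreal (vsum \<phi> f ts + vsum \<phi> f us)"
      by (simp add: vsum_nonneg \<phi>)
    also have "\<dots> \<le> ennreal (vsum \<phi> f (ts @ us))"
      using \<phi> by (intro ennreal_leI) (simp add: vsum_append)
    also have "\<dots> \<le> gvar \<phi> (A \<union> B) f"
      using that by (intro gvar_upper) (auto simp: sorted_append intro!: AB)
    finally show ?thesis .
  qed
  then have *: "gvar \<phi> A f + ennreal (vsum \<phi> f us) \<le> gvar \<phi> (A \<union> B) f"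
    if "sorted us" "set us \<subseteq> B" for us
    unfolding gvar_def[of \<phi> A] using that
    by (subst ennreal_SUP_add_left[symmetric]) (auto intro!: SUP_least exI[of _ "[]"])
  then show ?thesis
    unfolding gvar_def[of \<phi> B]
    by (subst ennreal_SUP_add_right) (auto intro!: SUP_least exI[of _ "[]"])
qed

text \<open>Converse of superadditivity: a sorted list passes from \<open>A\<close> to
  \<open>B\<close> at most once, and this one increment costs at most \<open>D\<close>.\<close>

lemma gvar_Un_le:
  assumes \<phi>: "\<And>d. 0 \<le> \<phi> d" and AB: "\<And>a b. a \<in> A \<Longrightarrow> b \<in> B \<Longrightarrow> a \<le> b"
    and D: "\<And>a b. a \<in> A \<Longrightarrow> b \<in> B \<Longrightarrow> \<phi> (f b - f a) \<le> D" "0 \<le> D"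
  shows "gvar \<phi> (A \<union> B) f \<le> gvar \<phi> A f + gvar \<phi> B f + ennreal D"
proof (rule gvar_least)
  fix ts assume ts: "sorted ts" "set ts \<subseteq> A \<union> B"
  define us vs where "us = takeWhile (\<lambda>x. x \<in> A) ts" and "vs = dropWhile (\<lambda>x. x \<in> A) ts"
  have split: "ts = us @ vs" by (simp add: us_def vs_def)
  have us: "set us \<subseteq> A" unfolding us_def by (auto dest: set_takeWhileD)
  have s: "sorted us" "sorted vs" using ts(1) unfolding split by (auto simp: sorted_append)
  have vs: "set vs \<subseteq> B"
  proof (cases vs)
    case (Cons v ws)
    have "v \<notin> A" using Cons unfolding vs_def by (metis dropWhile_eq_Cons_conv)
    then have v: "v \<in> B" using ts(2) Cons split by auto
    \<comment> \<open>A later time in \<open>A\<close> would lie below \<open>v\<close> by the order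
      of the two sets and above it by sortedness, hence equal \<open>v\<close>, which is not in
      \<open>A\<close>.\<close>
    have "y \<in> B" if "y \<in> set ws" for y
    proof (rule ccontr)
      assume "y \<notin> B"
      then have "y \<in> A" using that ts(2) Cons split by auto
      then have "y \<le> v" using AB v by auto
      moreover have "v \<le> y" using s(2) Cons that by auto
      ultimately show False using \<open>v \<notin> A\<close> \<open>y \<in> A\<close> by auto
    qed
    then show ?thesis using v Cons by auto
  qed simp
  have "vsum \<phi> f ts \<le> vsum \<phi> f us + vsum \<phi> f vs + D"
  proof -
    have "(if us = [] \<or> vs = [] then 0 else \<phi> (f (hd vs) - f (last us))) \<le> D"
      using D us vs by (auto intro!: D(1) simp: subset_iff)
    then show ?thesis unfolding split vsum_append by linarith
  qed
  then have "ennreal (vsum \<phi> f ts) \<le> ennreal (vsum \<phi> f us + vsum \<phi> f vs + D)"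
    by (rule ennreal_leI)
  also have "\<dots> = ennreal (vsum \<phi> f us) + ennreal (vsum \<phi> f vs) + ennreal D"
    using D(2) by (simp add: vsum_nonneg \<phi>)
  also have "\<dots> \<le> gvar \<phi> A f + gvar \<phi> B f + ennreal D"
    by (intro add_mono gvar_upper s us vs order_refl)
  finally show "ennreal (vsum \<phi> f ts) \<le> gvar \<phi> A f + gvar \<phi> B f + ennreal D" .
qed

lemma gvar_ge_increment:
  assumes "a \<in> A" "b \<in> A" "a \<le> b"
  shows "ennreal (\<phi> (f b - f a)) \<le> gvar \<phi> A f"
  using gvar_upper[of "[a, b]" A \<phi> f] assms by simp

text \<open>A countable set of times has only countably many finite lists, so this is a countable
  supremum of functions of finitely many coordinates.\<close>

lemma measurable_gvar [measurable]:
  assumes "countable A" "A \<subseteq> I" and [measurable]: "\<phi> \<in> borel_measurable borel"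
  shows "gvar \<phi> A \<in> borel_measurable (\<Pi>\<^sub>M t\<in>I. borel)"
proof -
  have "countable {ts. sorted ts \<and> set ts \<subseteq> A}"
    by (rule countable_subset[OF _ countable_lists[OF assms(1)]]) auto
  moreover have "(\<lambda>f. vsum \<phi> f ts) \<in> borel_measurable (\<Pi>\<^sub>M t\<in>I. borel)" if "set ts \<subseteq> I" for ts
    using that
  proof (induction ts)
    case (Cons x ts)
    show ?case
    proof (cases ts)
      case ts: (Cons y zs)
      have I: "x \<in> I" "y \<in> I" using Cons.prems ts by auto
      have "(\<lambda>f. vsum \<phi> f (y # zs)) \<in> borel_measurable (\<Pi>\<^sub>M t\<in>I. borel)"
        using Cons.IH Cons.prems unfolding ts by simp
      moreover have "(\<lambda>f. \<phi> (f y - f x)) \<in> borel_measurable (\<Pi>\<^sub>M t\<in>I. borel)"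
        by (intro measurable_compose[OF _ assms(3)] borel_measurable_diff
              measurable_component_singleton I)
      ultimately show ?thesis unfolding ts vsum.simps by (intro borel_measurable_add)
    qed simp
  qed simp
  ultimately show ?thesis
    unfolding gvar_def[abs_def] using assms(2)
    by (intro borel_measurable_SUP measurable_compose[OF _ measurable_ennreal]) auto
qed

lemma variation_sum_eq_gvar: "variation_sum p f = gvar (\<lambda>d. \<bar>d\<bar> powr p) {0..1} f"
proof (rule antisym)
  show "variation_sum p f \<le> gvar (\<lambda>d. \<bar>d\<bar> powr p) {0..1} f"
    unfolding variation_sum_def
  proof (rule SUP_least, clarify)
    fix k and t :: "nat \<Rightarrow> real" assume t: "strict_mono_on {..k} t" "t ` {..k} \<subseteq> {0..1}"
    have "sorted (map t [0..<Suc k])"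
      using t(1) by (auto simp: sorted_iff_nth_mono strict_mono_on_leD simp del: upt_Suc)
    moreover have "set (map t [0..<Suc k]) \<subseteq> {0..1}"
      using t(2) by (simp add: atMost_upto[symmetric] lessThan_Suc_atMost atLeast0LessThan del: upt_Suc)
    ultimately show "ennreal (\<Sum>j = 1..k. \<bar>f (t j) - f (t (j - 1))\<bar> powr p)
        \<le> gvar (\<lambda>d. \<bar>d\<bar> powr p) {0..1} f"
      using gvar_upper[of "map t [0..<Suc k]" "{0..1}" "\<lambda>d. \<bar>d\<bar> powr p" f]
      unfolding vsum_map_upt by simp
  qed
next
  show "gvar (\<lambda>d. \<bar>d\<bar> powr p) {0..1} f \<le> variation_sum p f"
  proof (rule gvar_least)
    fix ts :: "real list" assume ts: "sorted ts" "set ts \<subseteq> {0..1}"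
    \<comment> \<open>Repeated times contribute \<open>\<bar>0\<bar> powr p = 0\<close> and can be
      deleted, since \<open>variation_sum\<close> admits strictly increasing times only.\<close>
    have dup: "vsum (\<lambda>d. \<bar>d\<bar> powr p) f ts = vsum (\<lambda>d. \<bar>d\<bar> powr p) f (remdups_adj ts)"
      by (induction ts rule: remdups_adj.induct) (auto simp: vsum_Cons)
    define us where "us = remdups_adj ts"
    have us: "sorted_wrt (<) us" "set us \<subseteq> {0..1}"
      using ts unfolding us_def by (induction ts rule: remdups_adj.induct) auto
    show "ennreal (vsum (\<lambda>d. \<bar>d\<bar> powr p) f ts) \<le> variation_sum p f"
    proof (cases "us = []")
      case True
      then show ?thesis using dup by (simp add: us_def)
    next
      case False
      define k where "k = length us - 1"
      have "map ((!) us) [0..<Suc k] = us"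
        using False by (simp add: k_def map_nth del: upt_Suc)
      then have eq: "vsum (\<lambda>d. \<bar>d\<bar> powr p) f ts = (\<Sum>j = 1..k. \<bar>f (us ! j) - f (us ! (j - 1))\<bar> powr p)"
        using vsum_map_upt[of "\<lambda>d. \<bar>d\<bar> powr p" f "(!) us" k] dup us_def by simp
      have k: "k < length us" using False by (simp add: k_def)
      then have "strict_mono_on {..k} ((!) us)" "(!) us ` {..k} \<subseteq> {0..1}"
        using us by (auto simp: strict_mono_on_def sorted_wrt_iff_nth_less subset_iff)
      then show ?thesis
        unfolding eq variation_sum_def by (intro SUP_upper2[of "(k, (!) us)"]) auto
    qed
  qed
qed

text \<open>Every partition is a limit of rational ones whose times approach from the right, where
  the path is continuous; continuity of \<phi> carries the limit over to the sums.\<close>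

lemma gvar_rational:
  assumes \<phi>: "continuous_on UNIV \<phi>" and f: "\<And>t. 0 \<le> t \<Longrightarrow> (f \<longlongrightarrow> f t) (at_right t)"
  shows "gvar \<phi> {0..1} f = gvar \<phi> (\<rat> \<inter> {0..1}) f"
proof (rule antisym[OF gvar_least gvar_mono])
  fix ts :: "real list" assume ts: "sorted ts" "set ts \<subseteq> {0..1}"
  \<comment> \<open>The least multiple of 1/(n+1) strictly above t, capped at 1. Strictness makes
    the approach right-sided even at rational t; the cap keeps times in the interval and makes 1 its
    own approximation.\<close>
  define q where "q n t = min 1 ((of_int \<lfloor>real (Suc n) * t\<rfloor> + 1) / real (Suc n))" for n t
  have q_mono: "mono (q n)" for n
    unfolding q_def mono_def
    by (intro allI impI min.mono divide_right_mono) (auto intro!: floor_mono)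
  have q_gt: "(of_int \<lfloor>real (Suc n) * t\<rfloor> + 1) / real (Suc n) > t" for n t
    by (simp add: field_simps) (use floor_correct[of "t + t * real n"] in \<open>simp add: algebra_simps\<close>)
  have q_le: "(of_int \<lfloor>real (Suc n) * t\<rfloor> + 1) / real (Suc n) \<le> t + 1 / real (Suc n)" for n t
  proof -
    have "of_int \<lfloor>real (Suc n) * t\<rfloor> + 1 \<le> real (Suc n) * t + 1" by simp
    then have "(of_int \<lfloor>real (Suc n) * t\<rfloor> + 1) / real (Suc n) \<le> (real (Suc n) * t + 1) / real (Suc n)"
      by (rule divide_right_mono) simp
    also have "\<dots> = t + 1 / real (Suc n)" by (simp add: add_divide_distrib)
    finally show ?thesis .
  qed
  have lim: "(\<lambda>n. f (q n t)) \<longlonglongrightarrow> f t" if "0 \<le> t" "t \<le> 1" for t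
  proof (cases "t = 1")
    case True
    have "q n t = 1" for n using q_gt[of t n] unfolding q_def True by simp
    then show ?thesis using True by simp
  next
    case False
    with that have "t < 1" by simp
    have gt: "q n t > t" for n using q_gt[of t n] \<open>t < 1\<close> by (simp add: q_def)
    have "(\<lambda>n. q n t) \<longlonglongrightarrow> t"
    proof (rule tendsto_sandwich[of "\<lambda>_. t" _ _ "\<lambda>n. t + 1 / real (Suc n)"])
      show "(\<lambda>n. t + 1 / real (Suc n)) \<longlonglongrightarrow> t"
        using LIMSEQ_inverse_real_of_nat_add[of t] by (simp add: inverse_eq_divide)
      show "\<forall>\<^sub>F n in sequentially. q n t \<le> t + 1 / real (Suc n)"
        using q_le unfolding q_def by (intro always_eventually allI min.coboundedI2)
    qed (use gt in \<open>auto intro!: always_eventually less_imp_le\<close>)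
    then have "filterlim (\<lambda>n. q n t) (at_right t) sequentially"
      using gt by (auto simp: filterlim_at intro!: always_eventually dest: less_imp_neq[symmetric])
    then show ?thesis using f[OF that(1)] by (rule filterlim_compose[rotated])
  qed
  have "(\<lambda>n. vsum \<phi> f (map (q n) ts)) \<longlonglongrightarrow> vsum \<phi> f ts"
    using ts(2)
  proof (induction ts)
    case (Cons x xs)
    then have IH: "(\<lambda>n. vsum \<phi> f (map (q n) xs)) \<longlonglongrightarrow> vsum \<phi> f xs" by simp
    show ?case
    proof (cases xs)
      case Nil then show ?thesis by simp
    next
      case (Cons y zs)
      have "(\<lambda>n. f (q n y) - f (q n x)) \<longlonglongrightarrow> f y - f x"
        using Cons.prems Cons by (intro tendsto_diff lim) auto
      then have "(\<lambda>n. \<phi> (f (q n y) - f (q n x))) \<longlonglongrightarrow> \<phi> (f y - f x)"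
        using \<phi> by (auto intro: isCont_tendsto_compose simp: continuous_on_eq_continuous_at)
      from tendsto_add[OF this IH] show ?thesis unfolding Cons by simp
    qed
  qed simp
  moreover have "ennreal (vsum \<phi> f (map (q n) ts)) \<le> gvar \<phi> (\<rat> \<inter> {0..1}) f" for n
  proof (rule gvar_upper)
    show "sorted (map (q n) ts)"
      using ts(1) q_mono[of n] by (auto simp: sorted_map mono_def intro: sorted_wrt_mono_rel[rotated])
    have "0 \<le> (of_int \<lfloor>real (Suc n) * t\<rfloor> + 1) / real (Suc n)" if "0 \<le> t" for t
      using q_gt[of t n] that by linarith
    then show "set (map (q n) ts) \<subseteq> \<rat> \<inter> {0..1}"
      using ts(2) by (auto simp: q_def min_def subset_iff)
  qed
  ultimately show "ennreal (vsum \<phi> f ts) \<le> gvar \<phi> (\<rat> \<inter> {0..1}) f"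
    by (intro LIMSEQ_le_const2[where X = "\<lambda>n. ennreal (vsum \<phi> f (map (q n) ts))"])
       (auto intro: tendsto_ennrealI)
qed simp

section \<open>Past and future of a Levy process\<close>

lemma Int_stable_vimage:
  assumes "Int_stable \<G>" shows "Int_stable {f -` A \<inter> \<Omega> |A. A \<in> \<G>}"
proof (rule Int_stableI)
  fix a b assume "a \<in> {f -` A \<inter> \<Omega> |A. A \<in> \<G>}" "b \<in> {f -` A \<inter> \<Omega> |A. A \<in> \<G>}"
  then obtain A B where "a = f -` A \<inter> \<Omega>" "b = f -` B \<inter> \<Omega>" "A \<in> \<G>" "B \<in> \<G>" by auto
  then have "a \<inter> b = f -` (A \<inter> B) \<inter> \<Omega>" "A \<inter> B \<in> \<G>"
    using assms by (auto dest: Int_stableD)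
  then show "a \<inter> b \<in> {f -` A \<inter> \<Omega> |A. A \<in> \<G>}" by blast
qed

text \<open>Cylinder sets generate the product sigma-algebra, are closed under intersection and
  involve finitely many coordinates each, so independence on them extends to everything.\<close>

lemma (in prob_space) indep_var_PiM_finite:
  fixes X :: "'a \<Rightarrow> 'i \<Rightarrow> 'c" and Y :: "'a \<Rightarrow> 'i \<Rightarrow> 'c"
  assumes X: "X \<in> measurable M (PiM I S)" and Y: "Y \<in> measurable M (PiM J T)"
    and ind: "\<And>K L. finite K \<Longrightarrow> K \<subseteq> I \<Longrightarrow> finite L \<Longrightarrow> L \<subseteq> J \<Longrightarrow>
      indep_var (PiM K S) (\<lambda>\<omega>. restrict (X \<omega>) K) (PiM L T) (\<lambda>\<omega>. restrict (Y \<omega>) L)"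
  shows "indep_var (PiM I S) X (PiM J T) Y"
proof -
  define \<A> where "\<A> = {X -` A \<inter> space M |A. A \<in> prod_algebra I S}"
  define \<B> where "\<B> = {Y -` B \<inter> space M |B. B \<in> prod_algebra J T}"
  have XI: "X \<in> space M \<rightarrow> (\<Pi>\<^sub>E i\<in>I. space (S i))"
    using measurable_space[OF X] by (auto simp: space_PiM)
  have YJ: "Y \<in> space M \<rightarrow> (\<Pi>\<^sub>E i\<in>J. space (T i))"
    using measurable_space[OF Y] by (auto simp: space_PiM)
  have ev: "\<A> \<subseteq> events" "\<B> \<subseteq> events"
    using measurable_sets[OF X] measurable_sets[OF Y] unfolding \<A>_def \<B>_def sets_PiM by auto
  have "indep_set \<A> \<B>"
  proof (rule indep_setI[OF ev])
    fix a b assume "a \<in> \<A>" "b \<in> \<B>"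
    then obtain A B where a: "a = X -` A \<inter> space M" "A \<in> prod_algebra I S"
      and b: "b = Y -` B \<inter> space M" "B \<in> prod_algebra J T"
      by (auto simp: \<A>_def \<B>_def)
    obtain K E where K: "A = prod_emb I S K (\<Pi>\<^sub>E j\<in>K. E j)" "finite K" "K \<noteq> {} \<or> I = {}" "K \<subseteq> I"
        "\<And>i. i \<in> K \<Longrightarrow> E i \<in> sets (S i)"
      using a(2) by (rule prod_algebraE) blast
    obtain L F where L: "B = prod_emb J T L (\<Pi>\<^sub>E j\<in>L. F j)" "finite L" "L \<noteq> {} \<or> J = {}" "L \<subseteq> J"
        "\<And>i. i \<in> L \<Longrightarrow> F i \<in> sets (T i)"
      using b(2) by (rule prod_algebraE) blast
    let ?X = "\<lambda>\<omega>. restrict (X \<omega>) K" and ?Y = "\<lambda>\<omega>. restrict (Y \<omega>) L"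
    have a': "a = ?X -` (\<Pi>\<^sub>E j\<in>K. E j) \<inter> space M"
      using XI K(4) unfolding a(1) K(1) prod_emb_def by (auto simp: PiE_iff)
    have b': "b = ?Y -` (\<Pi>\<^sub>E j\<in>L. F j) \<inter> space M"
      using YJ L(4) unfolding b(1) L(1) prod_emb_def by (auto simp: PiE_iff)
    have "prob ((\<lambda>\<omega>. (?X \<omega>, ?Y \<omega>)) -` ((\<Pi>\<^sub>E j\<in>K. E j) \<times> (\<Pi>\<^sub>E j\<in>L. F j)) \<inter> space M) = prob a * prob b"
      unfolding a' b' using K L by (intro indep_varD[OF ind] sets_PiM_I_finite) auto
    moreover have "(\<lambda>\<omega>. (?X \<omega>, ?Y \<omega>)) -` ((\<Pi>\<^sub>E j\<in>K. E j) \<times> (\<Pi>\<^sub>E j\<in>L. F j)) \<inter> space M = a \<inter> b"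
      unfolding a' b' by auto
    ultimately show "prob (a \<inter> b) = prob a * prob b" by simp
  qed
  moreover have "Int_stable \<A>" "Int_stable \<B>"
    unfolding \<A>_def \<B>_def by (intro Int_stable_vimage Int_stable_prod_algebra)+
  ultimately have ind': "indep_set (sigma_sets (space M) \<A>) (sigma_sets (space M) \<B>)"
    by (rule indep_set_sigma_sets)
  have A: "{X -` A \<inter> space M |A. A \<in> sets (PiM I S)} = sigma_sets (space M) \<A>"
    unfolding \<A>_def sets_PiM by (rule sigma_sets_vimage_commute[OF XI])
  have B: "{Y -` A \<inter> space M |A. A \<in> sets (PiM J T)} = sigma_sets (space M) \<B>"
    unfolding \<B>_def sets_PiM by (rule sigma_sets_vimage_commute[OF YJ])
  have "\<A> \<subseteq> Pow (space M)" "\<B> \<subseteq> Pow (space M)" by (auto simp: \<A>_def \<B>_def)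
  then show ?thesis
    unfolding indep_var_eq A B using X Y ind' by (simp add: sigma_sets_sigma_sets_eq)
qed

text \<open>Puts a finite set of times into the form of the increasing sequence for which
  \<open>levy_process\<close> states independence of increments.\<close>

lemma finite_strict_enumeration:
  fixes E :: "real set"
  assumes "finite E" "0 \<in> E" "E \<subseteq> {0..}"
  shows "\<exists>(t :: nat \<Rightarrow> real) n. strict_mono_on {..n} t \<and> t ` {..n} = E \<and> t 0 = 0"
proof -
  define ts where "ts = sorted_list_of_set E"
  have ts: "sorted_wrt (<) ts" "set ts = E" using assms by (auto simp: ts_def)
  have ne: "ts \<noteq> []" using ts assms by auto
  define n where "n = length ts - 1"
  have n: "i \<le> n \<longleftrightarrow> i < length ts" for i using ne by (cases ts) (auto simp: n_def)
  have sm: "strict_mono_on {..n} ((!) ts)"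
    using ts(1) by (auto simp: strict_mono_on_def sorted_wrt_iff_nth_less n)
  have im: "(!) ts ` {..n} = E"
    using ts(2) n by (auto simp: set_conv_nth)
  have "ts ! 0 = 0"
  proof -
    obtain i where i: "i \<le> n" "ts ! i = 0" using im assms(2) by auto
    have "0 \<le> ts ! 0" using im assms(3) by (auto simp: subset_iff)
    then show ?thesis using strict_mono_onD[OF sm, of 0 i] i by (cases "i = 0") auto
  qed
  with sm im show ?thesis by blast
qed

abbreviation paths :: "(real \<Rightarrow> real) measure" where
  "paths \<equiv> \<Pi>\<^sub>M t\<in>{0..}. borel"

section \<open>The Markov property at a fixed time\<close>

locale levy = prob_space M for M :: "'a measure" +
  fixes Z :: "real \<Rightarrow> 'a \<Rightarrow> real"
  assumes levy: "levy_process M Z"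
begin

text \<open>The path stopped at time s, kept on the index set \<open>{0..}\<close> so that it lives
  in \<open>paths\<close> like the future. Subtracting \<open>Z 0\<close>, which is 0 only almost
  surely, makes it a function of increments alone.\<close>

definition past :: "real \<Rightarrow> 'a \<Rightarrow> real \<Rightarrow> real" where
  "past s \<omega> = (\<lambda>u\<in>{0..}. Z (min u s) \<omega> - Z 0 \<omega>)"

definition future :: "real \<Rightarrow> 'a \<Rightarrow> real \<Rightarrow> real" where
  "future s \<omega> = (\<lambda>u\<in>{0..}. Z (s + u) \<omega> - Z s \<omega>)"

lemma Z_measurable: "0 \<le> t \<Longrightarrow> Z t \<in> borel_measurable M"
  using levy by (auto simp: levy_process_def)

lemma Z_0: "AE \<omega> in M. Z 0 \<omega> = 0"
  using levy by (auto simp: levy_process_def)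

lemma indep_increments:
  "0 \<le> t 0 \<Longrightarrow> strict_mono_on {..n} t \<Longrightarrow>
    indep_vars (\<lambda>_. borel) (\<lambda>i \<omega>. Z (t (Suc i)) \<omega> - Z (t i) \<omega>) {..<n}"
  using levy by (auto simp: levy_process_def)

lemma distr_increment:
  "0 \<le> s \<Longrightarrow> 0 \<le> h \<Longrightarrow>
    distr M borel (\<lambda>\<omega>. Z (s + h) \<omega> - Z s \<omega>) = distr M borel (\<lambda>\<omega>. Z h \<omega> - Z 0 \<omega>)"
  using levy by (auto simp: levy_process_def)

lemma Z_right: "\<omega> \<in> space M \<Longrightarrow> 0 \<le> t \<Longrightarrow> ((\<lambda>t. Z t \<omega>) \<longlongrightarrow> Z t \<omega>) (at_right t)"
  using levy by (auto simp: levy_process_def cadlag_def)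

lemma measurable_past: "0 \<le> s \<Longrightarrow> past s \<in> measurable M paths"
  unfolding past_def[abs_def] by (intro measurable_restrict borel_measurable_diff Z_measurable) auto

lemma measurable_future: "0 \<le> s \<Longrightarrow> future s \<in> measurable M paths"
  unfolding future_def[abs_def] by (intro measurable_restrict borel_measurable_diff Z_measurable) auto

lemma telescope:
  "m \<le> k \<Longrightarrow> (\<Sum>i\<in>{m..<k}. Z (t (Suc i)) \<omega> - Z (t i) \<omega>) = Z (t k) \<omega> - Z (t m) \<omega>"
  by (rule sum_Suc_diff'[of m k "\<lambda>i. Z (t i) \<omega>"])

text \<open>Finitely many values of past and future are sums over two disjoint groups of consecutive
  increments of one common time grid.\<close>

lemma indep_past_future:
  assumes s: "0 \<le> s"
  shows "indep_var paths (past s) paths (future s)"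
proof (rule indep_var_PiM_finite[OF measurable_past[OF s] measurable_future[OF s]])
  fix K L :: "real set" assume K: "finite K" "K \<subseteq> {0..}" and L: "finite L" "L \<subseteq> {0..}"
  define E where "E = {0, s} \<union> (\<lambda>u. min u s) ` K \<union> (+) s ` L"
  have E: "finite E" "0 \<in> E" "E \<subseteq> {0..}"
    using K L s by (auto simp: E_def)
  obtain t :: "nat \<Rightarrow> real" and n where t: "strict_mono_on {..n} t" "t ` {..n} = E" "t 0 = 0"
    using finite_strict_enumeration[OF E] by blast
  have "\<exists>k. \<forall>e\<in>E. k e \<le> n \<and> t (k e) = e"
    using t(2) by (intro bchoice) auto
  then obtain k where k: "\<And>e. e \<in> E \<Longrightarrow> k e \<le> n" "\<And>e. e \<in> E \<Longrightarrow> t (k e) = e" by blast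
  have k_mono: "k d \<le> k e" if "d \<in> E" "e \<in> E" "d \<le> e" for d e
    using that k strict_mono_onD[OF t(1), of "k e" "k d"] by (force simp: not_le[symmetric])
  have sE: "s \<in> E" by (simp add: E_def)
  define X where "X i \<omega> = Z (t (Suc i)) \<omega> - Z (t i) \<omega>" for i \<omega>
  have "indep_vars (\<lambda>_. borel) X {..<n}"
    unfolding X_def using indep_increments[of t n] t by simp
  then have ind: "indep_var (PiM {..<k s} (\<lambda>_. borel)) (\<lambda>\<omega>. restrict (\<lambda>i. X i \<omega>) {..<k s})
      (PiM {k s..<n} (\<lambda>_. borel)) (\<lambda>\<omega>. restrict (\<lambda>i. X i \<omega>) {k s..<n})"
    using k(1)[OF sE] by (intro indep_var_restrict) auto
  define F where "F x = (\<lambda>u\<in>K. \<Sum>i\<in>{0..<k (min u s)}. x i)" for x :: "nat \<Rightarrow> real"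
  define G where "G x = (\<lambda>u\<in>L. \<Sum>i\<in>{k s..<k (s + u)}. x i)" for x :: "nat \<Rightarrow> real"
  have kK: "k (min u s) \<le> k s" "t (k (min u s)) = min u s" if "u \<in> K" for u
    using that K k_mono[OF _ sE] k(2)[of "min u s"] by (auto simp: E_def)
  have kL: "k s \<le> k (s + u)" "k (s + u) \<le> n" "t (k (s + u)) = s + u" if "u \<in> L" for u
    using that L k_mono[OF sE, of "s + u"] k[of "s + u"] by (auto simp: E_def)
  have "k 0 = 0"
    using strict_mono_onD[OF t(1), of 0 "k 0"] k[OF E(2)] t(3) by force
  have "F \<in> measurable (PiM {..<k s} (\<lambda>_. borel)) (PiM K (\<lambda>_. borel))"
    unfolding F_def[abs_def] using kK
    by (intro measurable_restrict borel_measurable_sum measurable_component_singleton) force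
  moreover have "G \<in> measurable (PiM {k s..<n} (\<lambda>_. borel)) (PiM L (\<lambda>_. borel))"
    unfolding G_def[abs_def] using kL
    by (intro measurable_restrict borel_measurable_sum measurable_component_singleton) force
  ultimately have "indep_var (PiM K (\<lambda>_. borel)) (F \<circ> (\<lambda>\<omega>. restrict (\<lambda>i. X i \<omega>) {..<k s}))
      (PiM L (\<lambda>_. borel)) (G \<circ> (\<lambda>\<omega>. restrict (\<lambda>i. X i \<omega>) {k s..<n}))"
    by (rule indep_var_compose[OF ind])
  also have "F \<circ> (\<lambda>\<omega>. restrict (\<lambda>i. X i \<omega>) {..<k s}) = (\<lambda>\<omega>. restrict (past s \<omega>) K)"
  proof
    fix \<omega>
    have "(\<Sum>i\<in>{0..<k (min u s)}. restrict (\<lambda>i. X i \<omega>) {..<k s} i) = past s \<omega> u" if "u \<in> K" for u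
    proof -
      have "(\<Sum>i\<in>{0..<k (min u s)}. restrict (\<lambda>i. X i \<omega>) {..<k s} i) = (\<Sum>i\<in>{0..<k (min u s)}. X i \<omega>)"
        using kK(1)[OF that] by (intro sum.cong) auto
      also have "\<dots> = past s \<omega> u"
        unfolding X_def using that K by (subst telescope) (auto simp: kK t past_def)
      finally show ?thesis .
    qed
    then show "(F \<circ> (\<lambda>\<omega>. restrict (\<lambda>i. X i \<omega>) {..<k s})) \<omega> = restrict (past s \<omega>) K"
      by (auto simp: F_def)
  qed
  also have "G \<circ> (\<lambda>\<omega>. restrict (\<lambda>i. X i \<omega>) {k s..<n}) = (\<lambda>\<omega>. restrict (future s \<omega>) L)"
  proof
    fix \<omega>
    have "(\<Sum>i\<in>{k s..<k (s + u)}. restrict (\<lambda>i. X i \<omega>) {k s..<n} i) = future s \<omega> u" if "u \<in> L" for u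
    proof -
      have "(\<Sum>i\<in>{k s..<k (s + u)}. restrict (\<lambda>i. X i \<omega>) {k s..<n} i) = (\<Sum>i\<in>{k s..<k (s + u)}. X i \<omega>)"
        using kL(2)[OF that] by (intro sum.cong) auto
      also have "\<dots> = future s \<omega> u"
        unfolding X_def using that L kL(1) by (subst telescope) (auto simp: kL k(2)[OF sE] future_def)
      finally show ?thesis .
    qed
    then show "(G \<circ> (\<lambda>\<omega>. restrict (\<lambda>i. X i \<omega>) {k s..<n})) \<omega> = restrict (future s \<omega>) L"
      by (auto simp: G_def)
  qed
  finally show "indep_var (PiM K (\<lambda>_. borel)) (\<lambda>\<omega>. restrict (past s \<omega>) K)
      (PiM L (\<lambda>_. borel)) (\<lambda>\<omega>. restrict (future s \<omega>) L)" .
qed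

text \<open>The increments over a shifted grid have the same joint law: by independence it is the
  product of the marginals, and these are stationary.\<close>

lemma distr_future_finite:
  assumes s: "0 \<le> s" and K: "finite K" "K \<subseteq> {0..}"
  shows "distr M (PiM K (\<lambda>_. borel)) (\<lambda>\<omega>. restrict (future s \<omega>) K) =
    distr M (PiM K (\<lambda>_. borel)) (\<lambda>\<omega>. restrict (future 0 \<omega>) K)"
proof -
  \<comment> \<open>The time 1 ensures at least one increment even if \<open>K\<close> is empty,
    because the description of independence by product laws is for nonempty families.\<close>
  define E where "E = {0, 1} \<union> K"
  have E: "finite E" "0 \<in> E" "E \<subseteq> {0..}"
    using K by (auto simp: E_def)
  obtain t :: "nat \<Rightarrow> real" and n where t: "strict_mono_on {..n} t" "t ` {..n} = E" "t 0 = 0"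
    using finite_strict_enumeration[OF E] by blast
  have n: "{..<n} \<noteq> {}"
  proof (cases n)
    case 0
    then have "E = {0}" using t by auto
    then show ?thesis by (auto simp: E_def)
  qed auto
  have "\<exists>k. \<forall>e\<in>E. k e \<le> n \<and> t (k e) = e"
    using t(2) by (intro bchoice) auto
  then obtain k where k: "\<And>e. e \<in> E \<Longrightarrow> k e \<le> n" "\<And>e. e \<in> E \<Longrightarrow> t (k e) = e" by blast
  have t_nonneg: "0 \<le> t i" if "i \<le> n" for i using t(2) E(3) that by auto
  define X where "X r i \<omega> = Z (r + t (Suc i)) \<omega> - Z (r + t i) \<omega>" for r i \<omega>
  define F where "F x = (\<lambda>u\<in>K. \<Sum>i\<in>{0..<k u}. x i)" for x :: "nat \<Rightarrow> real"
  have KE: "u \<in> E" if "u \<in> K" for u using that by (simp add: E_def)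
  have F: "F \<in> measurable (PiM {..<n} (\<lambda>_. borel)) (PiM K (\<lambda>_. borel))"
    unfolding F_def[abs_def] using k(1)[OF KE]
    by (intro measurable_restrict borel_measurable_sum measurable_component_singleton) force
  have rv: "X r i \<in> borel_measurable M" if "0 \<le> r" "i < n" for r i
    unfolding X_def using that t_nonneg[of i] t_nonneg[of "Suc i"]
    by (intro borel_measurable_diff Z_measurable) auto
  have vec: "distr M (PiM {..<n} (\<lambda>_. borel)) (\<lambda>\<omega>. \<lambda>i\<in>{..<n}. X r i \<omega>) =
      (\<Pi>\<^sub>M i\<in>{..<n}. distr M borel (X 0 i))" if r: "0 \<le> r" for r
  proof -
    have "strict_mono_on {..n} (\<lambda>i. r + t i)"
      using t(1) by (auto simp: strict_mono_on_def)
    then have "indep_vars (\<lambda>_. borel) (X r) {..<n}"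
      unfolding X_def using indep_increments[of "\<lambda>i. r + t i" n] r t(3) by simp
    then have "distr M (PiM {..<n} (\<lambda>_. borel)) (\<lambda>\<omega>. \<lambda>i\<in>{..<n}. X r i \<omega>) =
        (\<Pi>\<^sub>M i\<in>{..<n}. distr M borel (X r i))"
      using rv r n by (subst (asm) indep_vars_iff_distr_eq_PiM') auto
    also have "\<dots> = (\<Pi>\<^sub>M i\<in>{..<n}. distr M borel (X 0 i))"
    proof (intro PiM_cong refl)
      fix i assume i: "i \<in> {..<n}"
      have le: "t i < t (Suc i)" using i strict_mono_onD[OF t(1), of i "Suc i"] by auto
      have "distr M borel (X q i) = distr M borel (\<lambda>\<omega>. Z (t (Suc i) - t i) \<omega> - Z 0 \<omega>)"
        if "0 \<le> q" for q
        unfolding X_def using distr_increment[of "q + t i" "t (Suc i) - t i"] that le t_nonneg[of i] i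
        by (simp add: algebra_simps)
      from this[OF r] this[of 0] show "distr M borel (X r i) = distr M borel (X 0 i)" by simp
    qed
    finally show ?thesis .
  qed
  have eq: "(\<lambda>\<omega>. restrict (future r \<omega>) K) = F \<circ> (\<lambda>\<omega>. \<lambda>i\<in>{..<n}. X r i \<omega>)" for r
  proof
    fix \<omega>
    have "(\<Sum>i\<in>{0..<k u}. (\<lambda>i\<in>{..<n}. X r i \<omega>) i) = future r \<omega> u" if "u \<in> K" for u
    proof -
      have "(\<Sum>i\<in>{0..<k u}. (\<lambda>i\<in>{..<n}. X r i \<omega>) i) = (\<Sum>i\<in>{0..<k u}. X r i \<omega>)"
        using k(1)[OF KE[OF that]] by (intro sum.cong) auto
      also have "\<dots> = future r \<omega> u"
        unfolding X_def using that K telescope[of 0 "k u" "\<lambda>i. r + t i" \<omega>] k(2)[OF KE[OF that]] t(3)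
        by (auto simp: future_def)
      finally show ?thesis .
    qed
    then show "restrict (future r \<omega>) K = (F \<circ> (\<lambda>\<omega>. \<lambda>i\<in>{..<n}. X r i \<omega>)) \<omega>"
      by (auto simp: F_def)
  qed
  have "distr M (PiM K (\<lambda>_. borel)) (\<lambda>\<omega>. restrict (future r \<omega>) K) =
      distr (\<Pi>\<^sub>M i\<in>{..<n}. distr M borel (X 0 i)) (PiM K (\<lambda>_. borel)) F" if "0 \<le> r" for r
    unfolding eq vec[OF that, symmetric] using F rv that
    by (intro distr_distr[symmetric] measurable_restrict) auto
  from this[OF s] this[of 0] show ?thesis by simp
qed

text \<open>A finite measure on \<open>paths\<close> is determined by its finite-dimensional
  marginals.\<close>

lemma distr_future:
  assumes s: "0 \<le> s"
  shows "distr M paths (future s) = distr M paths (future 0)"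
proof (rule measure_eqI_PiM_infinite)
  fix A :: "real \<Rightarrow> real set" and K :: "real set"
  assume K: "finite K" "K \<subseteq> {0..}" and A: "\<And>i. i \<in> K \<Longrightarrow> A i \<in> sets borel"
  let ?P = "Pi\<^sub>E K A"
  have [measurable]: "?P \<in> sets (PiM K (\<lambda>_. borel))" using K A by (intro sets_PiM_I_finite) auto
  have "emeasure (distr M paths (future r)) (prod_emb {0..} (\<lambda>_. borel) K ?P) =
      emeasure (distr M (PiM K (\<lambda>_. borel)) (\<lambda>\<omega>. restrict (future r \<omega>) K)) ?P" if r: "0 \<le> r" for r
  proof -
    have "(\<lambda>\<omega>. restrict (future r \<omega>) K) \<in> measurable M (PiM K (\<lambda>_. borel))"
      by (rule measurable_compose[OF measurable_future[OF r] measurable_restrict_subset[OF K(2)]])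
    moreover have "prod_emb {0..} (\<lambda>_. borel) K ?P \<in> sets paths"
      using K A by (intro sets_PiM_I) auto
    ultimately show ?thesis
      by (subst (1 2) emeasure_distr)
         (auto simp: measurable_future[OF r] prod_emb_def future_def intro!: arg_cong[where f = "emeasure M"])
  qed
  from this[OF s] this[of 0] show "emeasure (distr M paths (future s)) (prod_emb {0..} (\<lambda>_. borel) K ?P) =
      emeasure (distr M paths (future 0)) (prod_emb {0..} (\<lambda>_. borel) K ?P)"
    using distr_future_finite[OF s K] by simp
next
  show "finite_measure (distr M paths (future s))"
    by (intro finite_measure_distr measurable_future s)
qed simp_all

lemma nn_integral_future:
  assumes "0 \<le> s" and [measurable]: "g \<in> borel_measurable paths"
  shows "(\<integral>\<^sup>+\<omega>. g (future s \<omega>) \<partial>M) = (\<integral>\<^sup>+\<omega>. g (future 0 \<omega>) \<partial>M)"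
proof -
  have "(\<integral>\<^sup>+\<omega>. g (future r \<omega>) \<partial>M) = (\<integral>\<^sup>+f. g f \<partial>distr M paths (future r))" if "0 \<le> r" for r
    using that by (intro nn_integral_distr[symmetric] measurable_future) auto
  from this[OF assms(1)] this[of 0] show ?thesis using distr_future[OF assms(1)] by simp
qed

lemma markov:
  assumes s: "0 \<le> s" and f: "f \<in> borel_measurable paths" and g: "g \<in> borel_measurable paths"
  shows "(\<integral>\<^sup>+\<omega>. f (past s \<omega>) * g (future s \<omega>) \<partial>M) =
    (\<integral>\<^sup>+\<omega>. f (past s \<omega>) \<partial>M) * (\<integral>\<^sup>+\<omega>. g (future 0 \<omega>) \<partial>M)"
proof -
  have "indep_var borel (f \<circ> past s) borel (g \<circ> future s)"
    by (rule indep_var_compose[OF indep_past_future[OF s] f g])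
  then have "indep_vars (\<lambda>_. borel) (case_bool (f \<circ> past s) (g \<circ> future s)) UNIV"
    unfolding indep_var_def by (rule back_subst[of "\<lambda>N. indep_vars N _ _"]) (auto split: bool.split)
  from indep_vars_nn_integral[OF _ this] show ?thesis
    using nn_integral_future[OF s g] by (simp add: UNIV_bool mult.commute comp_def)
qed

end

section \<open>Counting large increments\<close>

lemma gvar_eq_0: "(\<And>a b. a \<in> A \<Longrightarrow> b \<in> A \<Longrightarrow> \<phi> (f b - f a) = 0) \<Longrightarrow> gvar \<phi> A f = 0"
proof -
  assume *: "\<And>a b. a \<in> A \<Longrightarrow> b \<in> A \<Longrightarrow> \<phi> (f b - f a) = 0"
  have "set ts \<subseteq> A \<Longrightarrow> vsum \<phi> f ts = 0" for ts
    by (induction ts) (auto simp: vsum_Cons * subset_iff)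
  then have "gvar \<phi> A f \<le> 0" by (intro gvar_least) simp
  then show ?thesis by simp
qed

lemma gvar_scale:
  assumes "0 \<le> k" shows "gvar (\<lambda>d. k * \<phi> d) A f = ennreal k * gvar \<phi> A f"
proof -
  have "vsum (\<lambda>d. k * \<phi> d) f ts = k * vsum \<phi> f ts" for ts
    by (induction ts) (auto simp: vsum_Cons algebra_simps)
  then show ?thesis
    using assms by (simp add: gvar_def SUP_mult_left_ennreal ennreal_mult')
qed

text \<open>Reduction to finite time sets, on which one can induct over the number of points; they
  increase, so monotone convergence applies afterwards.\<close>

lemma gvar_SUP_finite:
  assumes A: "countable A" "A \<noteq> {}"
  shows "gvar \<phi> A f = (SUP n. gvar \<phi> (from_nat_into A ` {..<n}) f)"
proof (rule antisym[OF gvar_least SUP_least])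
  fix ts :: "real list" assume ts: "sorted ts" "set ts \<subseteq> A"
  have "\<exists>n. set ts \<subseteq> from_nat_into A ` {..<n}"
    using ts(2)
  proof (induction ts)
    case (Cons x ts)
    then obtain n where n: "set ts \<subseteq> from_nat_into A ` {..<n}" by auto
    obtain k where "x = from_nat_into A k"
      using from_nat_into_surj[OF A(1), of x] Cons.prems by auto
    moreover have "from_nat_into A ` {..<n} \<subseteq> from_nat_into A ` {..<max n (Suc k)}"
      by (intro image_mono) auto
    ultimately have "set (x # ts) \<subseteq> from_nat_into A ` {..<max n (Suc k)}"
      using n by auto
    then show ?case by (rule exI)
  qed simp
  then obtain n where "set ts \<subseteq> from_nat_into A ` {..<n}" by blast
  then have "ennreal (vsum \<phi> f ts) \<le> gvar \<phi> (from_nat_into A ` {..<n}) f"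
    using ts(1) by (intro gvar_upper)
  also have "\<dots> \<le> (SUP n. gvar \<phi> (from_nat_into A ` {..<n}) f)" by (rule SUP_upper) simp
  finally show "ennreal (vsum \<phi> f ts) \<le> (SUP n. gvar \<phi> (from_nat_into A ` {..<n}) f)" .
next
  show "gvar \<phi> (from_nat_into A ` {..<n}) f \<le> gvar \<phi> A f" for n
    using from_nat_into[OF A(2)] by (intro gvar_mono) auto
qed

lemma rat_Icc_translate:
  fixes s a b :: real
  assumes "s \<in> \<rat>" shows "(+) s ` (\<rat> \<inter> {a..b}) = \<rat> \<inter> {s + a..s + b}"
proof (rule set_eqI)
  fix x
  have "x \<in> (+) s ` (\<rat> \<inter> {a..b}) \<longleftrightarrow> x - s \<in> \<rat> \<inter> {a..b}"
    by (auto intro: image_eqI[of _ _ "x - s"])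
  also have "\<dots> \<longleftrightarrow> x \<in> \<rat> \<inter> {s + a..s + b}"
    using assms Rats_add[of "x - s" s] Rats_diff[of x s]
    by (auto simp: le_diff_eq diff_le_eq add.commute)
  finally show "x \<in> (+) s ` (\<rat> \<inter> {a..b}) \<longleftrightarrow> x \<in> \<rat> \<inter> {s + a..s + b}" .
qed

lemma rat_Icc_dilate:
  fixes k :: real
  assumes "k \<in> \<rat>" "0 < k" shows "(*) k ` (\<rat> \<inter> {0..1}) = \<rat> \<inter> {0..k}"
proof (rule set_eqI)
  fix x
  have "x \<in> (*) k ` (\<rat> \<inter> {0..1}) \<longleftrightarrow> x / k \<in> \<rat> \<inter> {0..1}"
    using assms by (auto intro: image_eqI[of _ _ "x / k"])
  also have "\<dots> \<longleftrightarrow> x \<in> \<rat> \<inter> {0..k}"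
    using assms Rats_mult[of "x / k" k] Rats_divide[of x k]
    by (auto simp: pos_divide_le_eq zero_le_divide_iff)
  finally show "x \<in> (*) k ` (\<rat> \<inter> {0..1}) \<longleftrightarrow> x \<in> \<rat> \<inter> {0..k}" .
qed

lemma rat_Icc_split:
  fixes s d :: real
  assumes "0 \<le> s" "0 \<le> d" shows "\<rat> \<inter> {0..s + d} = \<rat> \<inter> {0..s} \<union> \<rat> \<inter> {s..s + d}"
  using assms by auto

lemma countable_rat_Int: "countable (\<rat> \<inter> A :: real set)"
  by (rule countable_subset[OF Int_lower1 countable_rat])

definition exceed :: "real \<Rightarrow> real \<Rightarrow> real" where
  "exceed h d = (if \<bar>d\<bar> > h then 1 else 0)"

lemma exceed_nonneg: "0 \<le> exceed h d" by (simp add: exceed_def)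

lemma measurable_exceed [measurable]: "exceed h \<in> borel_measurable borel"
  unfolding exceed_def[abs_def] by measurable

lemma exceed_scale: "0 < c \<Longrightarrow> exceed h (c * d) = exceed (h / c) d"
  by (auto simp: exceed_def abs_mult field_simps)

context levy
begin

lemma gvar_future:
  assumes "A \<subseteq> {0..}"
  shows "gvar \<phi> A (future s \<omega>) = gvar \<phi> ((+) s ` A) (\<lambda>t. Z t \<omega>)"
proof -
  have "gvar \<phi> A (future s \<omega>) = gvar \<phi> A (\<lambda>t. Z (s + t) \<omega> - Z s \<omega>)"
    using assms by (intro gvar_cong) (auto simp: future_def)
  then show ?thesis by (simp only: gvar_shift gvar_translate[of \<phi> A "\<lambda>t. Z t \<omega>" s])
qed

lemma gvar_past:
  assumes "A \<subseteq> {0..s}"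
  shows "gvar \<phi> A (past s \<omega>) = gvar \<phi> A (\<lambda>t. Z t \<omega>)"
proof -
  have "gvar \<phi> A (past s \<omega>) = gvar \<phi> A (\<lambda>t. Z t \<omega> - Z 0 \<omega>)"
    using assms by (intro gvar_cong) (auto simp: past_def min_def subset_iff)
  then show ?thesis by (simp only: gvar_shift)
qed

lemma gvar_future_0:
  assumes "A \<subseteq> {0..}"
  shows "gvar \<phi> A (future 0 \<omega>) = gvar \<phi> A (\<lambda>t. Z t \<omega>)"
  using gvar_future[OF assms, of \<phi> 0] by simp

lemma measurable_gvar_Z:
  assumes "countable A" "A \<subseteq> {0..}" "\<phi> \<in> borel_measurable borel"
  shows "(\<lambda>\<omega>. gvar \<phi> A (\<lambda>t. Z t \<omega>)) \<in> borel_measurable M"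
  using measurable_compose[OF measurable_future[of 0] measurable_gvar[OF assms]]
  by (simp add: gvar_future_0 assms)

lemma nn_integral_gvar_translate:
  assumes "countable A" "A \<subseteq> {0..}" "\<phi> \<in> borel_measurable borel" "0 \<le> s"
    and g: "g \<in> borel_measurable borel"
  shows "(\<integral>\<^sup>+\<omega>. g (gvar \<phi> ((+) s ` A) (\<lambda>t. Z t \<omega>)) \<partial>M) =
    (\<integral>\<^sup>+\<omega>. g (gvar \<phi> A (\<lambda>t. Z t \<omega>)) \<partial>M)"
  using nn_integral_future[OF assms(4) measurable_compose[OF measurable_gvar[OF assms(1-3)] g]]
  by (simp add: gvar_future gvar_future_0 assms)

text \<open>The radius is 1/2 so that outside this event no two values on the interval differ by
  more than 1. The length is dyadic so that such intervals tile \<open>{0..2 ^ r}\<close>.\<close>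

definition exits :: "nat \<Rightarrow> 'a set" where
  "exits m = {\<omega>\<in>space M. \<exists>u\<in>\<rat> \<inter> {0..1 / 2 ^ m}. \<bar>Z u \<omega> - Z 0 \<omega>\<bar> > 1 / 2}"

lemma exits_sets: "exits m \<in> sets M"
proof -
  have "exits m = (\<Union>u\<in>\<rat> \<inter> {0..1 / 2 ^ m}. {\<omega>\<in>space M. \<bar>Z u \<omega> - Z 0 \<omega>\<bar> > 1 / 2})"
    by (auto simp: exits_def)
  also have "\<dots> \<in> sets M"
  proof (rule sets.countable_UN''[OF countable_rat_Int])
    fix u :: real assume "u \<in> \<rat> \<inter> {0..1 / 2 ^ m}"
    then have [measurable]: "Z u \<in> borel_measurable M" "Z 0 \<in> borel_measurable M"
      by (auto intro: Z_measurable)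
    show "{\<omega>\<in>space M. \<bar>Z u \<omega> - Z 0 \<omega>\<bar> > 1 / 2} \<in> sets M" by measurable
  qed
  finally show ?thesis .
qed

text \<open>The events decrease, and right continuity at 0 makes their intersection empty.\<close>

lemma exits_tendsto: "(\<lambda>m. prob (exits m)) \<longlonglongrightarrow> 0"
proof -
  have "decseq exits"
  proof (rule decseq_SucI)
    fix m
    have "(1::real) / 2 ^ Suc m \<le> 1 / 2 ^ m" by (simp add: field_simps)
    then show "exits (Suc m) \<subseteq> exits m"
      unfolding exits_def by (auto simp del: power_Suc intro: order_trans)
  qed
  moreover have "(\<Inter>m. exits m) = {}"
  proof -
    have False if \<omega>: "\<And>m. \<omega> \<in> exits m" for \<omega>
    proof -
      have sp: "\<omega> \<in> space M" using \<omega>[of 0] by (simp add: exits_def)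
      have "\<forall>\<^sub>F t in at_right 0. dist (Z t \<omega>) (Z 0 \<omega>) < 1 / 2"
        using Z_right[OF sp, of 0] by (intro tendstoD) auto
      then obtain b where b: "0 < b" "\<And>t. 0 < t \<Longrightarrow> t < b \<Longrightarrow> dist (Z t \<omega>) (Z 0 \<omega>) < 1 / 2"
        unfolding eventually_at_right_field by auto
      obtain m where m: "1 / 2 ^ m < b"
        using real_arch_pow_inv[OF b(1), of "1/2"] by (auto simp: power_one_over)
      obtain u where u: "0 \<le> u" "u \<le> 1 / 2 ^ m" "\<bar>Z u \<omega> - Z 0 \<omega>\<bar> > 1 / 2"
        using \<omega>[of m] by (auto simp: exits_def)
      show False using b(2)[of u] u m by (cases "u = 0") (auto simp: dist_real_def)
    qed
    then show ?thesis by blast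
  qed
  ultimately show ?thesis
    using finite_Lim_measure_decseq[of exits] exits_sets by auto
qed

lemma gvar_exceed_0:
  assumes "\<omega> \<in> space M - exits m" "A \<subseteq> \<rat> \<inter> {0..1 / 2 ^ m}"
  shows "gvar (exceed 1) A (\<lambda>t. Z t \<omega>) = 0"
proof (rule gvar_eq_0)
  fix a b assume "a \<in> A" "b \<in> A"
  then have "\<bar>Z a \<omega> - Z 0 \<omega>\<bar> \<le> 1 / 2" "\<bar>Z b \<omega> - Z 0 \<omega>\<bar> \<le> 1 / 2"
    using assms by (auto simp: exits_def not_less subset_iff)
  then have "\<bar>Z b \<omega> - Z a \<omega>\<bar> \<le> 1" by linarith
  then show "exceed 1 (Z b \<omega> - Z a \<omega>) = 0" by (simp add: exceed_def)
qed

text \<open>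
  Decompose according to the first time \<open>j\<close> of \<open>F\<close> at which an increment larger than 1 has
  been completed: it counts for at most one, and what happens after \<open>j\<close> is independent of it.
\<close>

lemma expected_exceed_finite:
  assumes m: "prob (exits m) \<le> 1 / 2"
  shows "finite F \<Longrightarrow> F \<subseteq> \<rat> \<inter> {0..1 / 2 ^ m} \<Longrightarrow>
    (\<integral>\<^sup>+\<omega>. gvar (exceed 1) F (\<lambda>t. Z t \<omega>) \<partial>M) \<le> 1"
\<comment> \<open>The bound 1 reproduces itself: given a first passage, the expected count is at
  most 1 + 1, and a passage requires an exit, which has probability at most 1/2.\<close>
proof (induction "card F" arbitrary: F rule: less_induct)
  case less
  note F = less.prems
  let ?N = "\<lambda>A f. gvar (exceed 1) A f"
  \<comment> \<open>Indicator that j is the first passage time. Only increments up to j enter, so it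
    can be evaluated on the past at j.\<close>
  define I where "I j f = (if ?N (F \<inter> {..<j}) f = 0 \<and> ?N (F \<inter> {..j}) f \<noteq> 0 then 1 else 0 :: ennreal)"
    for j f
  define G where "G j = (\<lambda>u. u - j) ` (F \<inter> {j..})" for j
  have F0: "F \<subseteq> {0..}" using F by auto
  have mN: "?N A \<in> borel_measurable paths" if "A \<subseteq> F" for A
    using that F0 F(1) by (intro measurable_gvar) (auto intro: countable_finite finite_subset)
  have mI: "I j \<in> borel_measurable paths" for j
  proof -
    have [measurable]: "?N (F \<inter> {..<j}) \<in> borel_measurable paths" "?N (F \<inter> {..j}) \<in> borel_measurable paths"
      by (auto intro: mN)
    show ?thesis unfolding I_def[abs_def] by measurable
  qed
  have I_past: "I j (past j \<omega>) = I j (\<lambda>t. Z t \<omega>)" for j \<omega>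
    unfolding I_def using F0 by (subst (1 2) gvar_past) auto
  have G: "finite (G j)" "G j \<subseteq> \<rat> \<inter> {0..1 / 2 ^ m}" "(+) j ` G j = F \<inter> {j..}" if "j \<in> F" for j
  proof -
    have j: "j \<in> \<rat>" "0 \<le> j" using F(2) that by auto
    have "u - j \<in> \<rat> \<inter> {0..1 / 2 ^ m}" if "u \<in> F \<inter> {j..}" for u
    proof -
      have "u \<in> \<rat>" "u \<le> 1 / 2 ^ m" "j \<le> u" using F(2) that by auto
      moreover from this have "u - j \<le> 1 / 2 ^ m" using j by linarith
      ultimately show ?thesis using j by simp
    qed
    then show "G j \<subseteq> \<rat> \<inter> {0..1 / 2 ^ m}" unfolding G_def by blast
    show "finite (G j)" using F(1) by (simp add: G_def)
    show "(+) j ` G j = F \<inter> {j..}" by (simp add: G_def image_image)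
  qed
  have bound: "?N F (\<lambda>t. Z t \<omega>) \<le> (\<Sum>j\<in>F. I j (past j \<omega>) * (1 + ?N (G j) (future j \<omega>)))" for \<omega>
  proof (cases "?N F (\<lambda>t. Z t \<omega>) = 0")
    case False
    let ?f = "\<lambda>t. Z t \<omega>"
    define J where "J = {j\<in>F. ?N (F \<inter> {..j}) ?f \<noteq> 0}"
    have "F \<noteq> {}" using False gvar_eq_0[of F "exceed 1" ?f] by auto
    then have "F \<inter> {..Max F} = F" using F(1) by auto
    then have "Max F \<in> J" using False F(1) \<open>F \<noteq> {}\<close> by (simp add: J_def)
    then have J: "finite J" "J \<noteq> {}" using F(1) by (auto simp: J_def)
    define j where "j = Min J"
    have j: "j \<in> J" "\<And>i. i \<in> J \<Longrightarrow> j \<le> i" using J by (auto simp: j_def)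
    then have jF: "j \<in> F" by (simp add: J_def)
    have before: "?N (F \<inter> {..<j}) ?f = 0"
    proof (cases "F \<inter> {..<j} = {}")
      case True
      then show ?thesis by (intro gvar_eq_0) auto
    next
      case False
      define i where "i = Max (F \<inter> {..<j})"
      have i: "i \<in> F \<inter> {..<j}" unfolding i_def using F(1) False by (intro Max_in) auto
      then have "i \<notin> J" using j(2)[of i] by auto
      then have "?N (F \<inter> {..i}) ?f = 0" using i by (auto simp: J_def)
      moreover have "F \<inter> {..<j} \<subseteq> F \<inter> {..i}"
        unfolding i_def using F(1) by (auto intro!: Max_ge)
      ultimately show ?thesis using gvar_mono[of "F \<inter> {..<j}" "F \<inter> {..i}" "exceed 1" ?f] by simp
    qed
    have Ij: "I j (past j \<omega>) = 1"
      using before j(1) unfolding I_past by (simp add: I_def J_def)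
    have "?N F ?f = ?N (F \<inter> {..<j} \<union> F \<inter> {j..}) ?f"
      by (rule arg_cong[where f = "\<lambda>A. ?N A ?f"]) auto
    also have "\<dots> \<le> ?N (F \<inter> {..<j}) ?f + ?N (F \<inter> {j..}) ?f + ennreal 1"
      by (rule gvar_Un_le) (auto simp: exceed_def)
    also have "\<dots> = 1 + ?N (F \<inter> {j..}) ?f" by (simp add: before add.commute)
    also have "\<dots> = I j (past j \<omega>) * (1 + ?N (G j) (future j \<omega>))"
    proof -
      have "G j \<subseteq> {0..}" using G(2)[OF jF] by auto
      then show ?thesis using Ij G(3)[OF jF] by (simp add: gvar_future)
    qed
    also have "\<dots> \<le> (\<Sum>j\<in>F. I j (past j \<omega>) * (1 + ?N (G j) (future j \<omega>)))"
      using F(1) jF by (intro member_le_sum) auto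
    finally show ?thesis .
  qed simp
  have step: "(\<integral>\<^sup>+\<omega>. I j (past j \<omega>) * (1 + ?N (G j) (future j \<omega>)) \<partial>M) \<le> 2 * (\<integral>\<^sup>+\<omega>. I j (\<lambda>t. Z t \<omega>) \<partial>M)"
    if j: "j \<in> F" for j
  \<comment> \<open>If j is the smallest time of \<open>F\<close>, no increment has been completed
    yet and \<open>I j\<close> vanishes. Otherwise the times from j on are fewer than those of
    \<open>F\<close>, so the induction hypothesis covers them after a shift to 0.\<close>
  proof (cases "F \<inter> {..<j} = {}")
    case True
    then have only: "a = j" if "a \<in> F \<inter> {..j}" for a using that by force
    have "?N (F \<inter> {..j}) f = 0" for f
    proof (rule gvar_eq_0)
      fix a b assume "a \<in> F \<inter> {..j}" "b \<in> F \<inter> {..j}"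
      then have "a = j" "b = j" using only by blast+
      then show "exceed 1 (f b - f a) = 0" by (simp add: exceed_def)
    qed
    then show ?thesis by (simp add: I_def)
  next
    case False
    have "card (G j) \<le> card (F \<inter> {j..})" unfolding G_def using F(1) by (intro card_image_le) auto
    also have "\<dots> < card F"
    proof (rule psubset_card_mono[OF F(1)])
      obtain x where "x \<in> F" "x < j" using False by auto
      then show "F \<inter> {j..} \<subset> F" by (auto simp: psubset_eq set_eq_iff not_le[symmetric])
    qed
    finally have "card (G j) < card F" .
    note IH = less.hyps[OF this G(1,2)[OF j]]
    have G0: "G j \<subseteq> {0..}" using G(2)[OF j] by auto
    have mG: "?N (G j) \<in> borel_measurable paths"
      using G(1)[OF j] G0 by (intro measurable_gvar) (auto intro: countable_finite)
    have mGZ: "(\<lambda>\<omega>. ?N (G j) (\<lambda>t. Z t \<omega>)) \<in> borel_measurable M"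
      using G(1)[OF j] G0 by (intro measurable_gvar_Z) (auto intro: countable_finite)
    have "(\<integral>\<^sup>+\<omega>. I j (past j \<omega>) * (1 + ?N (G j) (future j \<omega>)) \<partial>M) =
        (\<integral>\<^sup>+\<omega>. I j (past j \<omega>) \<partial>M) * (\<integral>\<^sup>+\<omega>. 1 + ?N (G j) (future 0 \<omega>) \<partial>M)"
      using j F0 mG by (intro markov mI) auto
    also have "(\<integral>\<^sup>+\<omega>. 1 + ?N (G j) (future 0 \<omega>) \<partial>M) = 1 + (\<integral>\<^sup>+\<omega>. ?N (G j) (\<lambda>t. Z t \<omega>) \<partial>M)"
      using mGZ by (simp add: gvar_future_0[OF G0] nn_integral_add emeasure_space_1)
    also have "(\<integral>\<^sup>+\<omega>. I j (past j \<omega>) \<partial>M) * (1 + (\<integral>\<^sup>+\<omega>. ?N (G j) (\<lambda>t. Z t \<omega>) \<partial>M)) \<le>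
        (\<integral>\<^sup>+\<omega>. I j (past j \<omega>) \<partial>M) * (1 + 1)"
      by (intro mult_left_mono add_left_mono IH) auto
    also have "\<dots> = 2 * (\<integral>\<^sup>+\<omega>. I j (\<lambda>t. Z t \<omega>) \<partial>M)"
      by (simp only: I_past one_add_one mult.commute)
    finally show ?thesis .
  qed
  \<comment> \<open>At most one j can be the first passage time, and without an exit there is
    none.\<close>
  have sumI: "(\<Sum>j\<in>F. I j (\<lambda>t. Z t \<omega>)) \<le> indicator (exits m) \<omega>" if "\<omega> \<in> space M" for \<omega>
  proof (cases "\<exists>j\<in>F. I j (\<lambda>t. Z t \<omega>) \<noteq> 0")
    case True
    let ?f = "\<lambda>t. Z t \<omega>"
    obtain j where j: "j \<in> F" "I j ?f \<noteq> 0" using True by blast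
    have uniq: "I i ?f = 0" if i: "i \<in> F" "i \<noteq> j" for i
    proof (rule ccontr)
      assume nz: "I i ?f \<noteq> 0"
      have "I x ?f = 0 \<or> I y ?f = 0" if "x < y" for x y
      proof -
        have "F \<inter> {..x} \<subseteq> F \<inter> {..<y}" using that by auto
        then show ?thesis using gvar_mono[of "F \<inter> {..x}" "F \<inter> {..<y}" "exceed 1" ?f] by (auto simp: I_def)
      qed
      then show False using nz j i by (metis linorder_neqE)
    qed
    have "(\<Sum>j\<in>F. I j ?f) = I j ?f + (\<Sum>i\<in>F - {j}. I i ?f)"
      using F(1) j(1) by (rule sum.remove)
    also have "\<dots> = I j ?f" using uniq by (simp add: sum.neutral)
    finally have "(\<Sum>j\<in>F. I j ?f) = 1" using j(2) by (auto simp: I_def split: if_splits)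
    moreover have "\<omega> \<in> exits m"
    proof (rule ccontr)
      assume "\<omega> \<notin> exits m"
      then have "?N (F \<inter> {..j}) ?f = 0" using that F by (intro gvar_exceed_0[of \<omega> m]) auto
      then show False using j(2) by (simp add: I_def)
    qed
    ultimately show ?thesis by simp
  qed simp
  have mIp: "(\<lambda>\<omega>. I j (past j \<omega>)) \<in> borel_measurable M" if "j \<in> F" for j
    using that F0 by (intro measurable_compose[OF measurable_past mI]) auto
  have mGf: "(\<lambda>\<omega>. ?N (G j) (future j \<omega>)) \<in> borel_measurable M" if "j \<in> F" for j
    using that F0 G(1,2)[OF that]
    by (intro measurable_compose[OF measurable_future measurable_gvar]) (auto intro: countable_finite)
  have "(\<integral>\<^sup>+\<omega>. ?N F (\<lambda>t. Z t \<omega>) \<partial>M) \<le> (\<integral>\<^sup>+\<omega>. (\<Sum>j\<in>F. I j (past j \<omega>) * (1 + ?N (G j) (future j \<omega>))) \<partial>M)"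
    by (intro nn_integral_mono bound)
  also have "\<dots> = (\<Sum>j\<in>F. \<integral>\<^sup>+\<omega>. I j (past j \<omega>) * (1 + ?N (G j) (future j \<omega>)) \<partial>M)"
    using mIp mGf by (intro nn_integral_sum) auto
  also have "\<dots> \<le> (\<Sum>j\<in>F. 2 * (\<integral>\<^sup>+\<omega>. I j (\<lambda>t. Z t \<omega>) \<partial>M))" by (intro sum_mono step)
  also have "\<dots> = 2 * (\<integral>\<^sup>+\<omega>. (\<Sum>j\<in>F. I j (\<lambda>t. Z t \<omega>)) \<partial>M)"
    using mIp unfolding I_past by (simp add: nn_integral_sum sum_distrib_left)
  also have "\<dots> \<le> 2 * (\<integral>\<^sup>+\<omega>. indicator (exits m) \<omega> \<partial>M)"
    by (intro mult_left_mono nn_integral_mono sumI) auto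
  also have "\<dots> = 2 * ennreal (prob (exits m))"
    using exits_sets by (simp add: emeasure_eq_measure)
  also have "\<dots> \<le> 2 * ennreal (1 / 2)" using m by (intro mult_left_mono ennreal_leI) auto
  also have "\<dots> = ennreal (2 * (1 / 2))" by (subst ennreal_mult') simp_all
  also have "\<dots> = 1" by simp
  finally show ?case .
qed

lemma expected_exceed_small:
  assumes m: "prob (exits m) \<le> 1 / 2"
  shows "(\<integral>\<^sup>+\<omega>. gvar (exceed 1) (\<rat> \<inter> {0..1 / 2 ^ m}) (\<lambda>t. Z t \<omega>) \<partial>M) \<le> 1"
proof -
  let ?A = "\<rat> \<inter> {0..1 / 2 ^ m} :: real set"
  let ?F = "\<lambda>n. from_nat_into ?A ` {..<n}"
  have A: "countable ?A" "?A \<noteq> {}" by (auto simp: countable_rat_Int intro: exI[of _ 0])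
  have F: "?F n \<subseteq> ?A" for n using from_nat_into[OF A(2)] by auto
  have "(\<integral>\<^sup>+\<omega>. gvar (exceed 1) ?A (\<lambda>t. Z t \<omega>) \<partial>M) =
      (SUP n. \<integral>\<^sup>+\<omega>. gvar (exceed 1) (?F n) (\<lambda>t. Z t \<omega>) \<partial>M)"
    unfolding gvar_SUP_finite[OF A]
  proof (rule nn_integral_monotone_convergence_SUP)
    show "incseq (\<lambda>n \<omega>. gvar (exceed 1) (?F n) (\<lambda>t. Z t \<omega>))"
      by (intro incseq_SucI le_funI gvar_mono) auto
    show "(\<lambda>\<omega>. gvar (exceed 1) (?F n) (\<lambda>t. Z t \<omega>)) \<in> borel_measurable M" for n
      using F[of n] by (intro measurable_gvar_Z) (auto intro: countable_finite)
  qed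
  also have "\<dots> \<le> 1" using F by (intro SUP_least expected_exceed_finite[OF m]) auto
  finally show ?thesis .
qed

text \<open>Each further block adds on average at most 1 from its own increments, and at most 1 for
  the increment that straddles its left end.\<close>

lemma expected_exceed_blocks:
  assumes m: "prob (exits m) \<le> 1 / 2"
  shows "(\<integral>\<^sup>+\<omega>. gvar (exceed 1) (\<rat> \<inter> {0..real n / 2 ^ m}) (\<lambda>t. Z t \<omega>) \<partial>M) \<le> ennreal (2 * real n)"
proof (induction n)
  case 0
  have "gvar (exceed 1) (\<rat> \<inter> {0..real 0 / 2 ^ m}) f = 0" for f
    by (rule gvar_eq_0) (auto simp: exceed_def)
  then show ?case by (simp del: of_nat_0)
next
  case (Suc n)
  let ?s = "real n / 2 ^ m" and ?A = "\<rat> \<inter> {0..1 / 2 ^ m} :: real set"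
  have s: "?s \<in> \<rat>" "0 \<le> ?s" by (auto intro!: Rats_divide Rats_power)
  have split: "\<rat> \<inter> {0..real (Suc n) / 2 ^ m} = \<rat> \<inter> {0..?s} \<union> (+) ?s ` ?A"
  proof -
    have "real (Suc n) / 2 ^ m = ?s + 1 / 2 ^ m" by (simp add: add_divide_distrib)
    moreover have "0 \<le> (1::real) / 2 ^ m" by simp
    ultimately show ?thesis
      unfolding rat_Icc_translate[OF s(1)] using s(2) rat_Icc_split[of ?s "1 / 2 ^ m"] by simp
  qed
  have mA: "countable ?A" "?A \<subseteq> {0..}" by (auto simp: countable_rat_Int)
  have m1: "(\<lambda>\<omega>. gvar (exceed 1) (\<rat> \<inter> {0..?s}) (\<lambda>t. Z t \<omega>)) \<in> borel_measurable M"
    by (intro measurable_gvar_Z countable_rat_Int) auto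
  have m2: "(\<lambda>\<omega>. gvar (exceed 1) ((+) ?s ` ?A) (\<lambda>t. Z t \<omega>)) \<in> borel_measurable M"
    using s(2) mA by (intro measurable_gvar_Z) auto
  have "(\<integral>\<^sup>+\<omega>. gvar (exceed 1) (\<rat> \<inter> {0..real (Suc n) / 2 ^ m}) (\<lambda>t. Z t \<omega>) \<partial>M) \<le>
     (\<integral>\<^sup>+\<omega>. gvar (exceed 1) (\<rat> \<inter> {0..?s}) (\<lambda>t. Z t \<omega>) + gvar (exceed 1) ((+) ?s ` ?A) (\<lambda>t. Z t \<omega>) + ennreal 1 \<partial>M)"
    unfolding split by (intro nn_integral_mono gvar_Un_le) (auto simp: exceed_def)
  also have "\<dots> = (\<integral>\<^sup>+\<omega>. gvar (exceed 1) (\<rat> \<inter> {0..?s}) (\<lambda>t. Z t \<omega>) \<partial>M)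
      + (\<integral>\<^sup>+\<omega>. gvar (exceed 1) ((+) ?s ` ?A) (\<lambda>t. Z t \<omega>) \<partial>M) + 1"
    using m1 m2 by (simp add: nn_integral_add emeasure_space_1)
  also have "(\<integral>\<^sup>+\<omega>. gvar (exceed 1) ((+) ?s ` ?A) (\<lambda>t. Z t \<omega>) \<partial>M) =
      (\<integral>\<^sup>+\<omega>. gvar (exceed 1) ?A (\<lambda>t. Z t \<omega>) \<partial>M)"
    by (rule nn_integral_gvar_translate[OF mA measurable_exceed s(2), of "\<lambda>x. x"]) simp
  also have "(\<integral>\<^sup>+\<omega>. gvar (exceed 1) (\<rat> \<inter> {0..?s}) (\<lambda>t. Z t \<omega>) \<partial>M)
      + (\<integral>\<^sup>+\<omega>. gvar (exceed 1) ?A (\<lambda>t. Z t \<omega>) \<partial>M) + 1 \<le> ennreal (2 * real n) + 1 + 1"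
    by (intro add_mono Suc.IH expected_exceed_small m order_refl)
  also have "\<dots> = ennreal (2 * real (Suc n))"
    by (simp add: ennreal_plus[symmetric] del: ennreal_plus flip: ennreal_1)
  finally show ?case .
qed

end

section \<open>Finiteness of the variation of a stable process\<close>

lemma gvar_increment_le:
  assumes "gvar (exceed H) A f = 0" "a \<in> A" "b \<in> A" "a \<le> b"
  shows "\<bar>f b - f a\<bar> \<le> H"
  using gvar_ge_increment[OF assms(2-4), of "exceed H" f] assms(1)
  by (auto simp: exceed_def split: if_splits)

text \<open>The space scale that matches the time scale 2^(-r): by self-similarity, counting
  increments above \<open>level \<alpha> r\<close> on [0, 1] amounts to counting increments above 1
  on [0, 2^r].\<close>

definition level :: "real \<Rightarrow> nat \<Rightarrow> real" where
  "level \<alpha> r = 2 powr (- (real r / \<alpha>))"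

text \<open>An increment between \<open>level \<alpha> (Suc r)\<close> and
  \<open>level \<alpha> r\<close> is paid for by the r-th term alone, one larger than 1 by the first
  term, with \<open>H\<close> as a crude bound on its size.\<close>

lemma powr_le_sum_exceed:
  fixes d :: real
  assumes \<alpha>: "0 < \<alpha>" and p: "0 < p" and H: "\<bar>d\<bar> \<le> H"
  shows "ennreal (\<bar>d\<bar> powr p) \<le> ennreal (H powr p) * ennreal (exceed 1 d)
    + (\<Sum>r. ennreal (level \<alpha> r powr p) * ennreal (exceed (level \<alpha> (Suc r)) d))"
    (is "_ \<le> ?A + (\<Sum>r. ?B r)")
proof -
  consider "1 < \<bar>d\<bar>" | "d = 0" | "0 < \<bar>d\<bar>" "\<bar>d\<bar> \<le> 1" by force
  then show ?thesis
  proof cases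
    case 1
    then have "ennreal (\<bar>d\<bar> powr p) \<le> ?A"
      using H p by (simp add: exceed_def ennreal_leI powr_mono2)
    then show ?thesis by (simp add: add_increasing2)
  next
    case 3
    have "(\<lambda>r. 2 powr (- (real (Suc r) / \<alpha>))) \<longlonglongrightarrow> 0" using \<alpha> by real_asymp
    then have "\<forall>\<^sub>F r in sequentially. level \<alpha> (Suc r) < \<bar>d\<bar>"
      using 3(1) unfolding level_def by (rule order_tendstoD)
    then have ex: "\<exists>r. level \<alpha> (Suc r) < \<bar>d\<bar>" by (auto dest: eventually_happens)
    define r where "r = (LEAST r. level \<alpha> (Suc r) < \<bar>d\<bar>)"
    have r: "level \<alpha> (Suc r) < \<bar>d\<bar>" unfolding r_def using ex by (rule LeastI_ex)
    have le: "\<bar>d\<bar> \<le> level \<alpha> r"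
    proof (cases r)
      case 0
      then show ?thesis using 3 by (simp add: level_def)
    next
      case (Suc q)
      then have "\<not> level \<alpha> (Suc q) < \<bar>d\<bar>" unfolding r_def by (intro not_less_Least) simp
      then show ?thesis using Suc by simp
    qed
    have "ennreal (\<bar>d\<bar> powr p) \<le> ?B r"
      using r le p by (simp add: exceed_def ennreal_leI powr_mono2)
    also have "\<dots> = (\<Sum>i\<in>{r}. ?B i)" by simp
    also have "\<dots> \<le> (\<Sum>r. ?B r)" by (rule sum_le_suminf) auto
    finally show ?thesis by (simp add: add_increasing)
  qed (use p in simp)
qed

text \<open>The pointwise bound is summed along one partition; only then is each count replaced by
  its own supremum.\<close>

lemma gvar_powr_le_exceed:
  assumes \<alpha>: "0 < \<alpha>" and p: "0 < p"
    and H: "\<And>a b. a \<in> A \<Longrightarrow> b \<in> A \<Longrightarrow> a \<le> b \<Longrightarrow> \<bar>f b - f a\<bar> \<le> H"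
  shows "gvar (\<lambda>d. \<bar>d\<bar> powr p) A f \<le> ennreal (H powr p) * gvar (exceed 1) A f
    + (\<Sum>r. ennreal (level \<alpha> r powr p) * gvar (exceed (level \<alpha> (Suc r))) A f)"
proof (rule gvar_least)
  let ?c = "\<lambda>r. ennreal (level \<alpha> r powr p)"
  fix ts :: "real list" assume ts: "sorted ts" "set ts \<subseteq> A"
  have "ennreal (vsum (\<lambda>d. \<bar>d\<bar> powr p) f ts) \<le> ennreal (H powr p) * ennreal (vsum (exceed 1) f ts)
    + (\<Sum>r. ?c r * ennreal (vsum (exceed (level \<alpha> (Suc r))) f ts))"
    using ts
  proof (induction ts)
    case (Cons x ts)
    show ?case
    proof (cases ts)
      case Nil then show ?thesis by simp
    next
      case (Cons y zs)
      let ?d = "f y - f x"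
      have d: "\<bar>?d\<bar> \<le> H" using Cons Cons.prems by (intro H) auto
      have s: "ennreal (vsum \<phi> f (x # ts)) = ennreal (\<phi> ?d) + ennreal (vsum \<phi> f ts)"
        if "\<And>d. 0 \<le> \<phi> d" for \<phi>
        using that vsum_nonneg[of \<phi> f ts] by (simp add: Cons)
      have "ennreal (vsum (\<lambda>d. \<bar>d\<bar> powr p) f (x # ts)) =
          ennreal (\<bar>?d\<bar> powr p) + ennreal (vsum (\<lambda>d. \<bar>d\<bar> powr p) f ts)"
        by (rule s) simp
      also have "\<dots> \<le> (ennreal (H powr p) * ennreal (exceed 1 ?d)
            + (\<Sum>r. ?c r * ennreal (exceed (level \<alpha> (Suc r)) ?d))) +
          (ennreal (H powr p) * ennreal (vsum (exceed 1) f ts)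
            + (\<Sum>r. ?c r * ennreal (vsum (exceed (level \<alpha> (Suc r))) f ts)))"
        using Cons.prems by (intro add_mono powr_le_sum_exceed \<alpha> p d Cons.IH) auto
      also have "\<dots> = ennreal (H powr p) * (ennreal (exceed 1 ?d) + ennreal (vsum (exceed 1) f ts)) +
          (\<Sum>r. ?c r * (ennreal (exceed (level \<alpha> (Suc r)) ?d) + ennreal (vsum (exceed (level \<alpha> (Suc r))) f ts)))"
        by (simp add: distrib_left suminf_add[symmetric] add_ac)
      also have "\<dots> = ennreal (H powr p) * ennreal (vsum (exceed 1) f (x # ts)) +
          (\<Sum>r. ?c r * ennreal (vsum (exceed (level \<alpha> (Suc r))) f (x # ts)))"
        by (simp only: s[OF exceed_nonneg])
      finally show ?thesis .
    qed
  qed simp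
  also have "\<dots> \<le> ennreal (H powr p) * gvar (exceed 1) A f
    + (\<Sum>r. ?c r * gvar (exceed (level \<alpha> (Suc r))) A f)"
    using ts by (intro add_mono mult_left_mono suminf_le gvar_upper) auto
  finally show "ennreal (vsum (\<lambda>d. \<bar>d\<bar> powr p) f ts) \<le> \<dots>" .
qed

locale stable = levy +
  fixes \<alpha> p :: real
  assumes stable: "strictly_stable M \<alpha> Z"
    and p: "\<alpha> < p"
begin

lemma \<alpha>_pos: "0 < \<alpha>"
  using stable by (simp add: strictly_stable_def)

lemma p_pos: "0 < p"
  using p \<alpha>_pos by simp

lemma nn_integral_scaling:
  assumes g: "g \<in> borel_measurable paths" and k: "0 < k"
  shows "(\<integral>\<^sup>+\<omega>. g (\<lambda>t\<in>{0..}. Z (k * t) \<omega>) \<partial>M) =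
    (\<integral>\<^sup>+\<omega>. g (\<lambda>t\<in>{0..}. k powr (1 / \<alpha>) * Z t \<omega>) \<partial>M)"
proof -
  have eq: "process_law M (\<lambda>t. Z (k * t)) = process_law M (\<lambda>t \<omega>. k powr (1 / \<alpha>) * Z t \<omega>)"
    using stable k by (auto simp: strictly_stable_def)
  have m1: "(\<lambda>\<omega>. \<lambda>t\<in>{0..}. Z (k * t) \<omega>) \<in> measurable M paths"
    using k by (intro measurable_restrict Z_measurable) auto
  have m2: "(\<lambda>\<omega>. \<lambda>t\<in>{0..}. k powr (1 / \<alpha>) * Z t \<omega>) \<in> measurable M paths"
    by (intro measurable_restrict borel_measurable_times borel_measurable_const Z_measurable) auto
  have "(\<integral>\<^sup>+\<omega>. g (\<lambda>t\<in>{0..}. Z (k * t) \<omega>) \<partial>M) = (\<integral>\<^sup>+f. g f \<partial>process_law M (\<lambda>t. Z (k * t)))"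
    unfolding process_law_def by (intro nn_integral_distr[symmetric] m1) (simp add: g)
  also have "\<dots> = (\<integral>\<^sup>+\<omega>. g (\<lambda>t\<in>{0..}. k powr (1 / \<alpha>) * Z t \<omega>) \<partial>M)"
    by (subst eq, unfold process_law_def, intro nn_integral_distr m2) (simp add: g)
  finally show ?thesis .
qed

lemma nn_integral_gvar_scaling:
  assumes A: "countable A" "A \<subseteq> {0..}" "\<phi> \<in> borel_measurable borel"
    and g: "g \<in> borel_measurable borel" and k: "0 < k"
  shows "(\<integral>\<^sup>+\<omega>. g (gvar \<phi> ((*) k ` A) (\<lambda>t. Z t \<omega>)) \<partial>M) =
    (\<integral>\<^sup>+\<omega>. g (gvar (\<lambda>d. \<phi> (k powr (1 / \<alpha>) * d)) A (\<lambda>t. Z t \<omega>)) \<partial>M)"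
proof -
  have m: "(\<lambda>f. g (gvar \<phi> A f)) \<in> borel_measurable paths"
    by (rule measurable_compose[OF measurable_gvar[OF A] g])
  have "gvar \<phi> A (\<lambda>t\<in>{0..}. h t) = gvar \<phi> A h" for h
    using A(2) by (intro gvar_cong) auto
  moreover have "gvar \<phi> ((*) k ` A) (\<lambda>t. Z t \<omega>) = gvar \<phi> A (\<lambda>t. Z (k * t) \<omega>)" for \<omega>
    using gvar_dilate[OF k, of \<phi> A "\<lambda>t. Z t \<omega>"] by simp
  ultimately show ?thesis
    using nn_integral_scaling[OF m k] by (simp add: gvar_cmult)
qed

abbreviation unit_rats :: "real set" where "unit_rats \<equiv> \<rat> \<inter> {0..1}"

lemma unit_rats: "countable unit_rats" "unit_rats \<subseteq> {0..}"
  by (auto simp: countable_rat_Int)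

text \<open>After scaling, [0, 2^r] consists of \<open>2 ^ m * 2 ^ r\<close> blocks of length
  2^(-m), and each of them costs at most 2 on average.\<close>

lemma expected_exceed_level:
  "\<exists>C::real. \<forall>r. (\<integral>\<^sup>+\<omega>. gvar (exceed (level \<alpha> r)) unit_rats (\<lambda>t. Z t \<omega>) \<partial>M) \<le> ennreal (C * 2 ^ r)"
proof -
  have "\<forall>\<^sub>F m in sequentially. prob (exits m) < 1 / 2"
    using exits_tendsto by (rule order_tendstoD) simp
  then obtain m where m: "prob (exits m) \<le> 1 / 2"
    by (auto dest!: eventually_happens intro: less_imp_le)
  have "(\<integral>\<^sup>+\<omega>. gvar (exceed (level \<alpha> r)) unit_rats (\<lambda>t. Z t \<omega>) \<partial>M) \<le> ennreal (2 * 2 ^ m * 2 ^ r)" for r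
  proof -
    let ?c = "(2 ^ r) powr (1 / \<alpha>) :: real"
    have c: "?c = 1 / level \<alpha> r"
      by (simp add: level_def powr_minus powr_realpow[symmetric] powr_powr divide_inverse)
    have "(\<integral>\<^sup>+\<omega>. gvar (exceed (level \<alpha> r)) unit_rats (\<lambda>t. Z t \<omega>) \<partial>M) =
        (\<integral>\<^sup>+\<omega>. gvar (\<lambda>d. exceed 1 (?c * d)) unit_rats (\<lambda>t. Z t \<omega>) \<partial>M)"
      by (subst exceed_scale) (simp_all add: c level_def)
    also have "\<dots> = (\<integral>\<^sup>+\<omega>. gvar (exceed 1) ((*) (2 ^ r) ` unit_rats) (\<lambda>t. Z t \<omega>) \<partial>M)"
      using nn_integral_gvar_scaling[OF unit_rats measurable_exceed, of "\<lambda>x. x" "2 ^ r" 1] by simp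
    also have "(*) (2 ^ r) ` unit_rats = \<rat> \<inter> {0..real (2 ^ m * 2 ^ r) / 2 ^ m}"
      by (subst rat_Icc_dilate) auto
    also have "(\<integral>\<^sup>+\<omega>. gvar (exceed 1) \<dots> (\<lambda>t. Z t \<omega>) \<partial>M) \<le> ennreal (2 * real (2 ^ m * 2 ^ r))"
      by (rule expected_exceed_blocks[OF m])
    finally show ?thesis by (simp add: mult.assoc)
  qed
  then show ?thesis by blast
qed

text \<open>The counts say nothing about the size of increments above 1; this supplies the bound
  \<open>H\<close>. By scaling, some increment on [0, 1] exceeds 2^(j/\<alpha>) with the probability
  that some increment on [0, 2^(-j)] exceeds 1, which tends to 0.\<close>

lemma AE_bounded_increments:
  "AE \<omega> in M. \<exists>H. gvar (exceed H) unit_rats (\<lambda>t. Z t \<omega>) = 0"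
proof -
  define c where "c j = (1 / 2 ^ j) powr (1 / \<alpha>)" for j :: nat
  have c: "0 < c j" for j by (simp add: c_def)
  define E where "E j = {\<omega>\<in>space M. gvar (exceed (1 / c j)) unit_rats (\<lambda>t. Z t \<omega>) \<noteq> 0}" for j
  have E: "E j \<in> sets M" for j
    using measurable_gvar_Z[OF unit_rats measurable_exceed, of "1 / c j"] unfolding E_def by measurable
  have le: "prob (E j) \<le> prob (exits j)" for j
  proof -
    let ?g = "\<lambda>x::ennreal. if x = 0 then 0 else 1 :: ennreal"
    have g: "?g \<in> borel_measurable borel" by measurable
    have "emeasure M (E j) = (\<integral>\<^sup>+\<omega>. indicator (E j) \<omega> \<partial>M)" using E by simp
    also have "\<dots> = (\<integral>\<^sup>+\<omega>. ?g (gvar (\<lambda>d. exceed 1 (c j * d)) unit_rats (\<lambda>t. Z t \<omega>)) \<partial>M)"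
      by (intro nn_integral_cong) (simp add: E_def exceed_scale[OF c])
    also have "\<dots> = (\<integral>\<^sup>+\<omega>. ?g (gvar (exceed 1) ((*) (1 / 2 ^ j) ` unit_rats) (\<lambda>t. Z t \<omega>)) \<partial>M)"
      using nn_integral_gvar_scaling[OF unit_rats measurable_exceed g, of "1 / 2 ^ j" 1]
      by (simp add: c_def)
    also have "(*) (1 / 2 ^ j) ` unit_rats = \<rat> \<inter> {0..1 / 2 ^ j}"
      by (rule rat_Icc_dilate) (auto intro: Rats_divide Rats_power)
    also have "(\<integral>\<^sup>+\<omega>. ?g (gvar (exceed 1) (\<rat> \<inter> {0..1 / 2 ^ j}) (\<lambda>t. Z t \<omega>)) \<partial>M)
        \<le> (\<integral>\<^sup>+\<omega>. indicator (exits j) \<omega> \<partial>M)"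
      using gvar_exceed_0[of _ j "\<rat> \<inter> {0..1 / 2 ^ j}"]
      by (intro nn_integral_mono) (auto simp: indicator_def)
    also have "\<dots> = emeasure M (exits j)" using exits_sets by simp
    finally show ?thesis by (simp add: emeasure_eq_measure)
  qed
  have lim: "(\<lambda>j. prob (exits j)) \<longlonglongrightarrow> 0" by (rule exits_tendsto)
  have "prob (\<Inter>j. E j) \<le> prob (exits j)" for j
    using E by (intro order_trans[OF finite_measure_mono le[of j]]) auto
  then have "prob (\<Inter>j. E j) \<le> 0"
    by (intro LIMSEQ_le_const[OF lim]) auto
  then have "prob (\<Inter>j. E j) = 0" by (rule antisym) (rule measure_nonneg)
  then have "emeasure M (\<Inter>j. E j) = 0" by (simp add: emeasure_eq_measure)
  then have "AE \<omega> in M. \<omega> \<notin> (\<Inter>j. E j)"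
    using E by (intro AE_not_in null_setsI) auto
  then show ?thesis using AE_space by eventually_elim (auto simp: E_def)
qed

definition V :: "real set \<Rightarrow> 'a \<Rightarrow> ennreal" where
  "V A \<omega> = gvar (\<lambda>d. \<bar>d\<bar> powr p) A (\<lambda>t. Z t \<omega>)"

lemma measurable_powr_abs: "(\<lambda>d::real. \<bar>d\<bar> powr p) \<in> borel_measurable borel"
  by measurable

lemma measurable_V: "countable A \<Longrightarrow> A \<subseteq> {0..} \<Longrightarrow> V A \<in> borel_measurable M"
  unfolding V_def[abs_def] by (rule measurable_gvar_Z[OF _ _ measurable_powr_abs])

lemma AE_V_finite: "AE \<omega> in M. V unit_rats \<omega> < \<infinity>"
proof -
  obtain C :: real where C: "\<And>r. (\<integral>\<^sup>+\<omega>. gvar (exceed (level \<alpha> r)) unit_rats (\<lambda>t. Z t \<omega>) \<partial>M) \<le> ennreal (C * 2 ^ r)"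
    using expected_exceed_level by blast
  let ?N = "\<lambda>r \<omega>. gvar (exceed (level \<alpha> r)) unit_rats (\<lambda>t. Z t \<omega>)"
  have [measurable]: "?N r \<in> borel_measurable M" for r
    by (rule measurable_gvar_Z[OF unit_rats measurable_exceed])
  define S where "S \<omega> = (\<Sum>r. ennreal (level \<alpha> r powr p) * ?N (Suc r) \<omega>)" for \<omega>
  \<comment> \<open>Ratio of the dominating geometric series: the weight 2^(-r p/\<alpha>) meets a
    mean count of order 2^r.\<close>
  define x where "x = 2 powr (1 - p / \<alpha>)"
  have x: "0 < x" "x < 1"
  proof -
    have "1 - p / \<alpha> < 0" using p \<alpha>_pos by (simp add: field_simps)
    then show "0 < x" "x < 1" unfolding x_def by (simp_all add: powr_less_one)
  qed
  have C': "(\<integral>\<^sup>+\<omega>. ?N r \<omega> \<partial>M) \<le> ennreal (\<bar>C\<bar> * 2 ^ r)" for r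
    by (rule order_trans[OF C]) (auto intro!: ennreal_leI mult_right_mono)
  have "(\<integral>\<^sup>+\<omega>. S \<omega> \<partial>M) = (\<Sum>r. ennreal (level \<alpha> r powr p) * (\<integral>\<^sup>+\<omega>. ?N (Suc r) \<omega> \<partial>M))"
    unfolding S_def by (subst nn_integral_suminf) (auto simp: nn_integral_cmult)
  also have "\<dots> \<le> (\<Sum>r. ennreal (2 * \<bar>C\<bar> * x ^ r))"
  proof (intro suminf_le allI)
    fix r
    have "ennreal (level \<alpha> r powr p) * (\<integral>\<^sup>+\<omega>. ?N (Suc r) \<omega> \<partial>M)
        \<le> ennreal (level \<alpha> r powr p) * ennreal (\<bar>C\<bar> * 2 ^ Suc r)"
      by (intro mult_left_mono C') simp
    also have "\<dots> = ennreal (level \<alpha> r powr p * (\<bar>C\<bar> * 2 ^ Suc r))"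
      by (rule ennreal_mult'[symmetric]) simp
    also have "level \<alpha> r powr p * (\<bar>C\<bar> * 2 ^ Suc r) = 2 * \<bar>C\<bar> * x ^ r"
    proof -
      have "x ^ r = 2 powr (real r * (1 - p / \<alpha>))"
        by (simp add: x_def powr_power mult.commute)
      also have "\<dots> = 2 powr real r * 2 powr (- (real r / \<alpha> * p))"
        by (simp add: powr_add[symmetric] algebra_simps)
      also have "\<dots> = 2 ^ r * level \<alpha> r powr p"
        by (simp add: level_def powr_powr powr_realpow)
      finally show ?thesis by simp
    qed
    finally show "ennreal (level \<alpha> r powr p) * (\<integral>\<^sup>+\<omega>. ?N (Suc r) \<omega> \<partial>M) \<le> ennreal (2 * \<bar>C\<bar> * x ^ r)" .
  qed auto
  also have "\<dots> < \<infinity>"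
    using x by (subst suminf_ennreal2) (auto intro!: summable_mult summable_geometric)
  finally have "(\<integral>\<^sup>+\<omega>. S \<omega> \<partial>M) \<noteq> \<infinity>" by simp
  moreover have "S \<in> borel_measurable M" unfolding S_def[abs_def] by measurable
  ultimately have 1: "AE \<omega> in M. S \<omega> \<noteq> \<infinity>" by (intro nn_integral_noteq_infinite) auto
  have "(\<integral>\<^sup>+\<omega>. ?N 0 \<omega> \<partial>M) \<noteq> \<infinity>" using C'[of 0] by (auto simp: top_unique)
  then have 2: "AE \<omega> in M. ?N 0 \<omega> \<noteq> \<infinity>" by (intro nn_integral_noteq_infinite) auto
  show ?thesis using 1 2 AE_bounded_increments
  proof eventually_elim
    fix \<omega> assume S: "S \<omega> \<noteq> \<infinity>" and N: "?N 0 \<omega> \<noteq> \<infinity>"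
      and H: "\<exists>H. gvar (exceed H) unit_rats (\<lambda>t. Z t \<omega>) = 0"
    obtain H where H: "gvar (exceed H) unit_rats (\<lambda>t. Z t \<omega>) = 0" using H by blast
    have "V unit_rats \<omega> \<le> ennreal (H powr p) * gvar (exceed 1) unit_rats (\<lambda>t. Z t \<omega>) + S \<omega>"
      unfolding V_def S_def
      by (intro gvar_powr_le_exceed \<alpha>_pos p_pos gvar_increment_le[OF H])
    moreover have "level \<alpha> 0 = 1" by (simp add: level_def)
    ultimately show "V unit_rats \<omega> < \<infinity>"
      using S N by (auto simp: top_unique less_top[symmetric] ennreal_mult_eq_top_iff dest!: order_le_less_trans)
  qed
qed

end

section \<open>Lower bound by steering\<close>

lemma levy_process_uminus:
  assumes "levy_process M Z" shows "levy_process M (\<lambda>t \<omega>. - Z t \<omega>)"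
proof -
  interpret levy M Z using assms by (simp add: levy_def levy_axioms_def levy_process_def)
  have "indep_vars (\<lambda>_. borel) (\<lambda>i \<omega>. - Z (t (Suc i)) \<omega> - - Z (t i) \<omega>) {..<n}"
    if "0 \<le> t 0" "strict_mono_on {..n} t" for t :: "nat \<Rightarrow> real" and n
    using indep_vars_compose2[OF indep_increments[OF that], of "\<lambda>_. uminus" "\<lambda>_. borel"]
    by (simp add: minus_diff_commute)
  moreover have "distr M borel (\<lambda>\<omega>. - Z (s + h) \<omega> - - Z s \<omega>) = distr M borel (\<lambda>\<omega>. - Z h \<omega> - - Z 0 \<omega>)"
    if "0 \<le> s" "0 \<le> h" for s h
  proof -
    have neg: "distr M borel (\<lambda>\<omega>. - Z (r + h) \<omega> - - Z r \<omega>) =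
        distr (distr M borel (\<lambda>\<omega>. Z (r + h) \<omega> - Z r \<omega>)) borel uminus" if "0 \<le> r" for r
      using that \<open>0 \<le> h\<close>
      by (subst distr_distr) (auto intro!: distr_cong borel_measurable_diff Z_measurable simp: comp_def)
    show ?thesis using neg[OF that(1)] neg[of 0] distr_increment[OF that] by simp
  qed
  moreover have "cadlag (\<lambda>t. - Z t \<omega>)" if "\<omega> \<in> space M" for \<omega>
    using levy that unfolding levy_process_def cadlag_def by (metis tendsto_minus)
  moreover have "AE \<omega> in M. - Z 0 \<omega> = 0" using Z_0 by eventually_elim simp
  ultimately show ?thesis
    unfolding levy_process_def using prob_space_axioms Z_measurable by auto
qed

context levy
begin

text \<open>Stationarity transfers positivity to all increments between rational times, almost
  surely at once; right continuity extends monotonicity to real times.\<close>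

lemma AE_pos_imp_subordinator:
  assumes pos: "\<And>t. 0 < t \<Longrightarrow> AE \<omega> in M. 0 < Z t \<omega>"
  shows "subordinator M Z"
proof -
  have "AE \<omega> in M. \<forall>s\<in>\<rat> \<inter> {0..}. \<forall>h\<in>\<rat> \<inter> {0<..}. Z s \<omega> \<le> Z (s + h) \<omega>"
  proof (intro AE_ball_countable[THEN iffD2] countable_rat_Int ballI)
    fix s h :: real assume "s \<in> \<rat> \<inter> {0..}" "h \<in> \<rat> \<inter> {0<..}"
    then have s: "0 \<le> s" and h: "0 < h" by auto
    note m = borel_measurable_diff[OF Z_measurable Z_measurable]
    have "AE \<omega> in M. 0 < Z h \<omega> - Z 0 \<omega>"
      using pos[OF h] Z_0 by eventually_elim simp
    then have "AE x in distr M borel (\<lambda>\<omega>. Z h \<omega> - Z 0 \<omega>). 0 < x"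
      using h by (subst AE_distr_iff) (auto intro!: m)
    then have "AE x in distr M borel (\<lambda>\<omega>. Z (s + h) \<omega> - Z s \<omega>). 0 < x"
      by (subst distr_increment[OF s less_imp_le[OF h]])
    then have "AE \<omega> in M. 0 < Z (s + h) \<omega> - Z s \<omega>"
      using s h by (subst (asm) AE_distr_iff) (auto intro!: m)
    then show "AE \<omega> in M. Z s \<omega> \<le> Z (s + h) \<omega>" by eventually_elim simp
  qed
  then have "AE \<omega> in M. mono_on {0..} (\<lambda>t. Z t \<omega>)"
    using AE_space
  proof eventually_elim
    fix \<omega> assume r: "\<forall>s\<in>\<rat> \<inter> {0..}. \<forall>h\<in>\<rat> \<inter> {0<..}. Z s \<omega> \<le> Z (s + h) \<omega>" and \<omega>: "\<omega> \<in> space M"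
    show "mono_on {0..} (\<lambda>t. Z t \<omega>)"
    proof (rule mono_onI)
      fix s t :: real assume st: "s \<in> {0..}" "t \<in> {0..}" "s \<le> t"
      show "Z s \<omega> \<le> Z t \<omega>"
      proof (rule ccontr)
        assume "\<not> Z s \<omega> \<le> Z t \<omega>"
        \<comment> \<open>The path is above c just after s and below c just after t, so rational
          times u and v chosen there violate the order already known.\<close>
        then obtain c where c: "Z t \<omega> < c" "c < Z s \<omega>" using dense by (metis not_le)
        then have "s < t" using st by (cases "s = t") auto
        have "\<forall>\<^sub>F u in at_right s. c < Z u \<omega>"
          using Z_right[OF \<omega>, of s] st c by (intro order_tendstoD) auto
        then obtain b where b: "s < b" "\<And>u. s < u \<Longrightarrow> u < b \<Longrightarrow> c < Z u \<omega>"
          unfolding eventually_at_right_field by auto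
        have "\<forall>\<^sub>F u in at_right t. Z u \<omega> < c"
          using Z_right[OF \<omega>, of t] st c by (intro order_tendstoD) auto
        then obtain d where d: "t < d" "\<And>u. t < u \<Longrightarrow> u < d \<Longrightarrow> Z u \<omega> < c"
          unfolding eventually_at_right_field by auto
        obtain u where u: "u \<in> \<rat>" "s < u" "u < min b t"
          using Rats_dense_in_real[of s "min b t"] b \<open>s < t\<close> by auto
        obtain v where v: "v \<in> \<rat>" "t < v" "v < d"
          using Rats_dense_in_real[of t d] d by auto
        have "v - u \<in> \<rat>" "0 < v - u" "0 \<le> u" using u v st by auto
        then have "Z u \<omega> \<le> Z (u + (v - u)) \<omega>" using r u by blast
        then show False using b(2)[of u] d(2)[of v] u v by auto
      qed
    qed
  qed
  then show ?thesis using levy by (simp add: subordinator_def)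
qed

end

section \<open>Non-degeneracy from self-similarity, and the steering event\<close>

context stable
begin

text \<open>\<open>B\<close> is a cone and \<open>Z t\<close> has the law of t^(1/\<alpha>)
  \<open>Z 1\<close>. It is applied to the two open half-lines and to {0}.\<close>

lemma AE_scaling:
  assumes B: "B \<in> sets borel" "\<And>c x. 0 < c \<Longrightarrow> x \<in> B \<Longrightarrow> c * x \<in> B"
    and 1: "AE \<omega> in M. Z 1 \<omega> \<in> B" and t: "0 < t"
  shows "AE \<omega> in M. Z t \<omega> \<in> B"
proof -
  let ?g = "\<lambda>f::real \<Rightarrow> real. indicator (- B) (f 1) :: ennreal"
  have [measurable]: "- B \<in> sets borel" using B(1) by auto
  have [measurable]: "(\<lambda>f. f 1) \<in> borel_measurable paths"
    by (rule measurable_component_singleton) simp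
  have "(\<integral>\<^sup>+\<omega>. indicator (- B) (Z t \<omega>) \<partial>M) = (\<integral>\<^sup>+\<omega>. indicator (- B) (t powr (1 / \<alpha>) * Z 1 \<omega>) \<partial>M)"
    using nn_integral_scaling[of ?g t] t by simp
  also have "\<dots> = (\<integral>\<^sup>+\<omega>. 0 \<partial>M)"
  proof (rule nn_integral_cong_AE)
    show "AE \<omega> in M. indicator (- B) (t powr (1 / \<alpha>) * Z 1 \<omega>) = (0::ennreal)"
      using 1 by eventually_elim (use B(2) t in simp)
  qed
  finally have "(\<integral>\<^sup>+\<omega>. indicator (- B) (Z t \<omega>) \<partial>M) = 0" by simp
  moreover have "(\<lambda>\<omega>. indicator (- B) (Z t \<omega>) :: ennreal) \<in> borel_measurable M"
    using t by (intro measurable_compose[OF Z_measurable]) auto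
  ultimately have "AE \<omega> in M. indicator (- B) (Z t \<omega>) = (0::ennreal)"
    by (simp add: nn_integral_0_iff_AE)
  then show ?thesis by eventually_elim (auto split: split_indicator_asm)
qed

text \<open>Zero variation forces \<open>Z 1\<close> to be 0; scaling spreads this to every fixed
  time and right continuity to all times at once. The process would then be the pure drift with
  slope 0, which is excluded.\<close>

lemma V_pos: "\<not> (AE \<omega> in M. V unit_rats \<omega> = 0)"
proof
  assume "AE \<omega> in M. V unit_rats \<omega> = 0"
  then have 1: "AE \<omega> in M. Z 1 \<omega> \<in> {0}"
    using Z_0
  proof eventually_elim
    fix \<omega> assume "V unit_rats \<omega> = 0" "Z 0 \<omega> = 0"
    moreover have "ennreal (\<bar>Z 1 \<omega> - Z 0 \<omega>\<bar> powr p) \<le> V unit_rats \<omega>"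
      unfolding V_def by (rule gvar_ge_increment[of 0 unit_rats 1 "\<lambda>d. \<bar>d\<bar> powr p"]) auto
    ultimately show "Z 1 \<omega> \<in> {0}" by (simp add: ennreal_eq_0_iff)
  qed
  have "AE \<omega> in M. Z t \<omega> \<in> {0}" if "0 < t" for t
    by (rule AE_scaling[OF _ _ 1 that]) auto
  then have "AE \<omega> in M. \<forall>t\<in>\<rat> \<inter> {0<..}. Z t \<omega> = 0"
    by (subst AE_ball_countable[OF countable_rat_Int]) simp
  then have "AE \<omega> in M. \<forall>t\<ge>0. Z t \<omega> = 0 * t"
    using AE_space
  proof eventually_elim
    fix \<omega> assume r: "\<forall>t\<in>\<rat> \<inter> {0<..}. Z t \<omega> = 0" and \<omega>: "\<omega> \<in> space M"
    have "Z t \<omega> = 0" if t: "0 \<le> t" for t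
    proof (rule ccontr)
      assume "Z t \<omega> \<noteq> 0"
      then have "\<forall>\<^sub>F u in at_right t. Z u \<omega> \<noteq> 0"
        by (intro tendsto_imp_eventually_ne[OF Z_right[OF \<omega> t]])
      then obtain b where b: "t < b" "\<And>u. t < u \<Longrightarrow> u < b \<Longrightarrow> Z u \<omega> \<noteq> 0"
        unfolding eventually_at_right_field by auto
      obtain u where "u \<in> \<rat>" "t < u" "u < b" using Rats_dense_in_real[OF b(1)] by auto
      then show False using r b(2)[of u] t by auto
    qed
    then show "\<forall>t\<ge>0. Z t \<omega> = 0 * t" by simp
  qed
  then have "pure_drift M Z" unfolding pure_drift_def by blast
  then show False using stable by (simp add: strictly_stable_def)
qed

text \<open>\<sigma> = 1 or -1 prescribes the direction of the block. The inequality on the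
  displacement is weak because what the absence of subordinators excludes is an almost surely strict
  one in the other direction.\<close>

definition turn :: "real \<Rightarrow> real \<Rightarrow> (real \<Rightarrow> real) \<Rightarrow> bool" where
  "turn \<sigma> A f \<longleftrightarrow> gvar (\<lambda>d. \<bar>d\<bar> powr p) unit_rats f \<le> ennreal A \<and> 0 \<le> \<sigma> * (f 1 - f 0)"

lemma measurable_turn: "{f\<in>space paths. turn \<sigma> A f} \<in> sets paths"
proof -
  note [measurable] = measurable_gvar[OF unit_rats measurable_powr_abs]
  have [measurable]: "(\<lambda>f. f 0) \<in> borel_measurable paths" "(\<lambda>f. f 1) \<in> borel_measurable paths"
    by (auto intro!: measurable_component_singleton)
  show ?thesis unfolding turn_def by measurable
qed

lemma turn_future:
  assumes "0 \<le> s"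
  shows "turn \<sigma> A (future s \<omega>) \<longleftrightarrow>
    gvar (\<lambda>d. \<bar>d\<bar> powr p) ((+) s ` unit_rats) (\<lambda>t. Z t \<omega>) \<le> ennreal A \<and> 0 \<le> \<sigma> * (Z (s + 1) \<omega> - Z s \<omega>)"
  unfolding turn_def gvar_future[OF unit_rats(2)] by (simp add: future_def)

lemma turn_sets: "0 \<le> s \<Longrightarrow> {\<omega>\<in>space M. turn \<sigma> A (future s \<omega>)} \<in> sets M"
  using measurable_sets[OF measurable_future measurable_turn, of s \<sigma> A] measurable_space[OF measurable_future, of s]
  by (auto simp: vimage_def Int_def conj_commute cong: conj_cong)

lemma turn_mono: "A \<le> B \<Longrightarrow> turn \<sigma> A f \<Longrightarrow> turn \<sigma> B f"
  by (auto simp: turn_def intro: order_trans ennreal_leI)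

text \<open>The variation is almost surely finite, so if the event fails almost surely for every
  bound A = n, the sign of the displacement must be wrong almost surely.\<close>

lemma ex_turn_pos:
  assumes \<sigma>: "\<not> (AE \<omega> in M. \<sigma> * Z 1 \<omega> < 0)"
  shows "\<exists>A\<ge>0. 0 < prob {\<omega>\<in>space M. turn \<sigma> A (future 0 \<omega>)}"
proof (rule ccontr)
  assume "\<not> ?thesis"
  then have "prob {\<omega>\<in>space M. turn \<sigma> (real n) (future 0 \<omega>)} = 0" for n
    using measure_nonneg[of M "{\<omega>\<in>space M. turn \<sigma> (real n) (future 0 \<omega>)}"]
    by (metis of_nat_0_le_iff order_le_less)
  then have "AE \<omega> in M. \<not> turn \<sigma> (real n) (future 0 \<omega>)" for n
    using turn_sets[of 0 \<sigma> "real n"]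
    by (subst AE_iff_measurable[OF _ refl]) (auto simp: emeasure_eq_measure)
  then have "AE \<omega> in M. \<forall>n. \<not> turn \<sigma> (real n) (future 0 \<omega>)" by (simp add: AE_all_countable)
  then have "AE \<omega> in M. \<sigma> * Z 1 \<omega> < 0"
    using AE_V_finite Z_0
  proof eventually_elim
    fix \<omega> assume n: "\<forall>n. \<not> turn \<sigma> (real n) (future 0 \<omega>)" and fin: "V unit_rats \<omega> < \<infinity>" and 0: "Z 0 \<omega> = 0"
    obtain v where v: "V unit_rats \<omega> = ennreal v" "0 \<le> v" using fin by (cases "V unit_rats \<omega>") auto
    obtain n where "v \<le> real n" using real_arch_simple by blast
    then have "V unit_rats \<omega> \<le> ennreal (real n)" using v by (auto intro: ennreal_leI)
    then show "\<sigma> * Z 1 \<omega> < 0"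
      using n[rule_format, of n] 0 by (simp add: turn_future V_def not_le)
  qed
  with \<sigma> show False by contradiction
qed

text \<open>\<open>A powr (1 / p)\<close> is the largest displacement that a block with variation at
  most \<open>A\<close> permits. The same bound on the positions at integer times is what steering
  can preserve from one block to the next.\<close>

definition confined :: "real \<Rightarrow> nat \<Rightarrow> (real \<Rightarrow> real) \<Rightarrow> bool" where
  "confined A n f \<longleftrightarrow>
     (\<forall>i<n. gvar (\<lambda>d. \<bar>d\<bar> powr p) (\<rat> \<inter> {real i..real i + 1}) f \<le> ennreal A) \<and>
     (\<forall>i\<le>n. \<bar>f (real i) - f 0\<bar> \<le> A powr (1 / p))"

lemma increment_le_gvar:
  assumes "gvar (\<lambda>d. \<bar>d\<bar> powr p) B f \<le> ennreal A" "0 \<le> A" "a \<in> B" "b \<in> B" "a \<le> b"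
  shows "\<bar>f b - f a\<bar> \<le> A powr (1 / p)"
proof -
  have "ennreal (\<bar>f b - f a\<bar> powr p) \<le> ennreal A"
    using order_trans[OF gvar_ge_increment[OF assms(3-5), of "\<lambda>d. \<bar>d\<bar> powr p" f] assms(1)] .
  then have "\<bar>f b - f a\<bar> powr p \<le> A" using assms(2) by (simp add: ennreal_le_iff)
  then have "(\<bar>f b - f a\<bar> powr p) powr (1 / p) \<le> A powr (1 / p)"
    using p_pos by (intro powr_mono2) auto
  then show ?thesis using p_pos by (simp add: powr_powr)
qed

lemma rat_Icc_Suc: "\<rat> \<inter> {0..real (Suc n)} = \<rat> \<inter> {0..real n} \<union> \<rat> \<inter> {real n..real n + 1}"
  using rat_Icc_split[of "real n" 1] by (simp add: add.commute)

lemma translate_unit_rats: "(+) (real n) ` unit_rats = \<rat> \<inter> {real n..real n + 1}"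
  using rat_Icc_translate[of "real n" 0 1] by simp

text \<open>With b = \<open>A powr (1 / p)\<close>, every value is within b of the value at a
  preceding integer time, hence within 2 b of the start. Two values differ by at most 4 b, so each
  further block costs \<open>A\<close> and a junction of at most (4 b)^p.\<close>

lemma confined_gvar_le:
  assumes f: "confined A n f" and A: "0 \<le> A"
  shows "gvar (\<lambda>d. \<bar>d\<bar> powr p) (\<rat> \<inter> {0..real n}) f
    \<le> ennreal (real n * (A + (4 * A powr (1 / p)) powr p))"
proof -
  define b where "b = A powr (1 / p)"
  have near: "\<bar>f x - f 0\<bar> \<le> 2 * b" if i: "i < n" and x: "x \<in> \<rat> \<inter> {real i..real i + 1}" for i x
  proof -
    have "gvar (\<lambda>d. \<bar>d\<bar> powr p) (\<rat> \<inter> {real i..real i + 1}) f \<le> ennreal A"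
      using f i by (simp add: confined_def)
    then have "\<bar>f x - f (real i)\<bar> \<le> b"
      unfolding b_def using increment_le_gvar[OF _ A, of "\<rat> \<inter> {real i..real i + 1}" f "real i" x] x by auto
    moreover have "\<bar>f (real i) - f 0\<bar> \<le> b" using f i by (simp add: confined_def b_def)
    ultimately show ?thesis by linarith
  qed
  have near0: "\<bar>f x - f 0\<bar> \<le> 2 * b" if x: "x \<in> \<rat>" "0 \<le> x" "x \<le> real k" "k \<le> n" for x k
  \<comment> \<open>The right endpoint is treated apart: if k = n, none of the n blocks starts
    there.\<close>
  proof (cases "x = real k")
    case True
    then have "\<bar>f x - f 0\<bar> \<le> b" using f x by (simp add: confined_def b_def)
    moreover have "0 \<le> b" by (simp add: b_def)
    ultimately show ?thesis by linarith
  next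
    case False
    have "nat \<lfloor>x\<rfloor> < n" using False x by linarith
    moreover have "real (nat \<lfloor>x\<rfloor>) \<le> x" "x \<le> real (nat \<lfloor>x\<rfloor>) + 1" using x by linarith+
    ultimately show ?thesis using near[of "nat \<lfloor>x\<rfloor>" x] x by auto
  qed
  have "k \<le> n \<Longrightarrow> gvar (\<lambda>d. \<bar>d\<bar> powr p) (\<rat> \<inter> {0..real k}) f \<le> ennreal (real k * (A + (4 * b) powr p))" for k
  proof (induction k)
    case 0
    have "gvar (\<lambda>d. \<bar>d\<bar> powr p) (\<rat> \<inter> {0..real 0}) f = 0"
      by (rule gvar_eq_0) (use p_pos in auto)
    then show ?case by simp
  next
    case (Suc k)
    let ?G = "\<lambda>B. gvar (\<lambda>d. \<bar>d\<bar> powr p) B f"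
    have D: "\<bar>f y - f x\<bar> powr p \<le> (4 * b) powr p"
      if "x \<in> \<rat> \<inter> {0..real k}" "y \<in> \<rat> \<inter> {real k..real k + 1}" for x y
    proof -
      have "\<bar>f x - f 0\<bar> \<le> 2 * b" using near0[of x k] that Suc.prems by auto
      moreover have "\<bar>f y - f 0\<bar> \<le> 2 * b" using near[of k y] that Suc.prems by auto
      ultimately have "\<bar>f y - f x\<bar> \<le> 4 * b" by linarith
      then show ?thesis using p_pos by (intro powr_mono2) auto
    qed
    have "?G (\<rat> \<inter> {0..real (Suc k)}) \<le> ?G (\<rat> \<inter> {0..real k}) + ?G (\<rat> \<inter> {real k..real k + 1}) + ennreal ((4 * b) powr p)"
      unfolding rat_Icc_Suc by (rule gvar_Un_le) (auto intro!: D)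
    also have "\<dots> \<le> ennreal (real k * (A + (4 * b) powr p)) + ennreal A + ennreal ((4 * b) powr p)"
      using f Suc by (intro add_mono order_refl) (auto simp: confined_def)
    also have "\<dots> = ennreal (real (Suc k) * (A + (4 * b) powr p))"
      using A by (simp add: ennreal_plus[symmetric] algebra_simps del: ennreal_plus)
    finally show ?case .
  qed
  then show ?thesis by (simp add: b_def)
qed

lemma measurable_confined: "{f\<in>space paths. confined A n f} \<in> sets paths"
proof -
  have [measurable]: "gvar (\<lambda>d. \<bar>d\<bar> powr p) (\<rat> \<inter> {real i..real i + 1}) \<in> borel_measurable paths" for i
    by (intro measurable_gvar countable_rat_Int measurable_powr_abs) auto
  have [measurable]: "(\<lambda>f. f (real i)) \<in> borel_measurable paths" "(\<lambda>f. f 0) \<in> borel_measurable paths" for i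
    by (auto intro!: measurable_component_singleton)
  show ?thesis unfolding confined_def by measurable
qed

lemma confined_past: "confined A n (past (real n) \<omega>) \<longleftrightarrow> confined A n (\<lambda>t. Z t \<omega>)"
proof -
  have "gvar (\<lambda>d. \<bar>d\<bar> powr p) (\<rat> \<inter> {real i..real i + 1}) (past (real n) \<omega>) =
      gvar (\<lambda>d. \<bar>d\<bar> powr p) (\<rat> \<inter> {real i..real i + 1}) (\<lambda>t. Z t \<omega>)" if "i < n" for i
    using that by (intro gvar_past) auto
  moreover have "past (real n) \<omega> (real i) = Z (real i) \<omega> - Z 0 \<omega>" if "i \<le> n" for i
    using that by (simp add: past_def min_def)
  moreover have "past (real n) \<omega> 0 = 0" by (simp add: past_def)
  ultimately show ?thesis unfolding confined_def by auto
qed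

text \<open>Position and new increment have opposite signs and modulus at most
  \<open>A powr (1 / p)\<close>, so their sum has modulus at most that.\<close>

lemma confined_Suc:
  assumes c: "confined A n (\<lambda>t. Z t \<omega>)" and t: "turn \<sigma> A (future (real n) \<omega>)"
    and \<sigma>: "\<bar>\<sigma>\<bar> = 1" "\<sigma> * (Z (real n) \<omega> - Z 0 \<omega>) \<le> 0" and A: "0 \<le> A"
  shows "confined A (Suc n) (\<lambda>t. Z t \<omega>)"
proof -
  let ?b = "A powr (1 / p)"
  have t': "gvar (\<lambda>d. \<bar>d\<bar> powr p) (\<rat> \<inter> {real n..real n + 1}) (\<lambda>t. Z t \<omega>) \<le> ennreal A"
    "0 \<le> \<sigma> * (Z (real n + 1) \<omega> - Z (real n) \<omega>)"
    using t by (auto simp: turn_future translate_unit_rats)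
  have "\<bar>Z (real n + 1) \<omega> - Z (real n) \<omega>\<bar> \<le> ?b"
    using increment_le_gvar[OF t'(1) A, of "real n" "real n + 1"] by auto
  moreover have "\<bar>Z (real n) \<omega> - Z 0 \<omega>\<bar> \<le> ?b" using c by (simp add: confined_def)
  moreover have "\<sigma> = 1 \<or> \<sigma> = -1" using \<sigma>(1) by linarith
  ultimately have "\<bar>Z (real (Suc n)) \<omega> - Z 0 \<omega>\<bar> \<le> ?b"
    using \<sigma>(2) t'(2) by (auto simp: add.commute)
  then show ?thesis using c t'(1) unfolding confined_def by (auto simp: less_Suc_eq le_Suc_eq)
qed

lemma confined_sets: "{\<omega>\<in>space M. confined A n (\<lambda>t. Z t \<omega>)} \<in> sets M"
proof -
  have "{\<omega>\<in>space M. confined A n (\<lambda>t. Z t \<omega>)} =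
      past (real n) -` {f\<in>space paths. confined A n f} \<inter> space M"
    using measurable_space[OF measurable_past[of "real n"]] by (auto simp: confined_past)
  then show ?thesis
    using measurable_sets[OF measurable_past measurable_confined, of "real n" A n] by simp
qed

text \<open>Steering: each new block is asked to move back towards the starting point.\<close>

lemma prob_confined_ge:
  assumes A: "0 \<le> A" and q: "0 \<le> q"
    "q \<le> prob {\<omega>\<in>space M. turn 1 A (future 0 \<omega>)}" "q \<le> prob {\<omega>\<in>space M. turn (-1) A (future 0 \<omega>)}"
  shows "q ^ n \<le> prob {\<omega>\<in>space M. confined A n (\<lambda>t. Z t \<omega>)}"
proof (induction n)
  case 0
  have "{\<omega>\<in>space M. confined A 0 (\<lambda>t. Z t \<omega>)} = space M" by (auto simp: confined_def)
  then show ?case by (simp add: prob_space)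
next
  case (Suc n)
  let ?s = "real n"
  define T where "T \<sigma> f = (indicator {f\<in>space paths. turn \<sigma> A f} f :: ennreal)" for \<sigma> f
  \<comment> \<open>The side of the start on which the path sits at time n is decided by the past.
    On each of \<open>P\<close> and \<open>Q\<close> the turn to be requested is then a fixed event
    of the future, and the Markov property gives a factor of at least q.\<close>
  define P where "P = {f\<in>space paths. confined A n f \<and> f ?s - f 0 \<le> 0}"
  define Q where "Q = {f\<in>space paths. confined A n f \<and> \<not> f ?s - f 0 \<le> 0}"
  note [measurable] = measurable_confined[of A n] measurable_turn
  have [measurable]: "(\<lambda>f. f ?s) \<in> borel_measurable paths" "(\<lambda>f. f 0) \<in> borel_measurable paths"
    by (auto intro!: measurable_component_singleton)
  have PQ[measurable]: "P \<in> sets paths" "Q \<in> sets paths" unfolding P_def Q_def by measurable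
  have T[measurable]: "T \<sigma> \<in> borel_measurable paths" for \<sigma> unfolding T_def[abs_def] by measurable
  have T0: "ennreal q \<le> (\<integral>\<^sup>+\<omega>. T \<sigma> (future 0 \<omega>) \<partial>M)" if "\<sigma> = 1 \<or> \<sigma> = -1" for \<sigma>
  proof -
    have "(\<integral>\<^sup>+\<omega>. T \<sigma> (future 0 \<omega>) \<partial>M) = (\<integral>\<^sup>+\<omega>. indicator {\<omega>\<in>space M. turn \<sigma> A (future 0 \<omega>)} \<omega> \<partial>M)"
      using measurable_space[OF measurable_future[of 0]]
      by (intro nn_integral_cong) (auto simp: T_def split: split_indicator)
    also have "\<dots> = ennreal (prob {\<omega>\<in>space M. turn \<sigma> A (future 0 \<omega>)})"
      using turn_sets[of 0 \<sigma> A] by (simp add: emeasure_eq_measure)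
    finally show ?thesis using q that by (auto intro!: ennreal_leI)
  qed
  have past: "past ?s \<omega> \<in> space paths" "future ?s \<omega> \<in> space paths" if "\<omega> \<in> space M" for \<omega>
    using measurable_space[OF measurable_past[of ?s] that] measurable_space[OF measurable_future[of ?s] that]
    by auto
  have pv: "past ?s \<omega> ?s - past ?s \<omega> 0 = Z ?s \<omega> - Z 0 \<omega>" for \<omega> by (simp add: past_def)
  have mP[measurable]: "past ?s \<in> measurable M paths" "future ?s \<in> measurable M paths"
    by (simp_all add: measurable_past measurable_future)
  have "ennreal (q ^ Suc n) = ennreal (q ^ n) * ennreal q" using q(1) by (simp add: ennreal_mult' mult.commute)
  also have "\<dots> \<le> (\<integral>\<^sup>+\<omega>. indicator P (past ?s \<omega>) + indicator Q (past ?s \<omega>) \<partial>M) * ennreal q"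
  proof (intro mult_right_mono)
    have "ennreal (q ^ n) \<le> emeasure M {\<omega>\<in>space M. confined A n (\<lambda>t. Z t \<omega>)}"
      using Suc by (simp add: emeasure_eq_measure ennreal_leI)
    also have "\<dots> = (\<integral>\<^sup>+\<omega>. indicator {\<omega>\<in>space M. confined A n (\<lambda>t. Z t \<omega>)} \<omega> \<partial>M)"
      using confined_sets by simp
    also have "\<dots> \<le> (\<integral>\<^sup>+\<omega>. indicator P (past ?s \<omega>) + indicator Q (past ?s \<omega>) \<partial>M)"
      using past by (intro nn_integral_mono) (auto simp: P_def Q_def confined_past split: split_indicator)
    finally show "ennreal (q ^ n) \<le> (\<integral>\<^sup>+\<omega>. indicator P (past ?s \<omega>) + indicator Q (past ?s \<omega>) \<partial>M)" .
  qed simp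
  also have "\<dots> = (\<integral>\<^sup>+\<omega>. indicator P (past ?s \<omega>) \<partial>M) * ennreal q + (\<integral>\<^sup>+\<omega>. indicator Q (past ?s \<omega>) \<partial>M) * ennreal q"
    by (subst nn_integral_add) (auto simp: distrib_right)
  also have "\<dots> \<le> (\<integral>\<^sup>+\<omega>. indicator P (past ?s \<omega>) \<partial>M) * (\<integral>\<^sup>+\<omega>. T 1 (future 0 \<omega>) \<partial>M)
      + (\<integral>\<^sup>+\<omega>. indicator Q (past ?s \<omega>) \<partial>M) * (\<integral>\<^sup>+\<omega>. T (-1) (future 0 \<omega>) \<partial>M)"
    by (intro add_mono mult_left_mono T0) auto
  also have "\<dots> = (\<integral>\<^sup>+\<omega>. indicator P (past ?s \<omega>) * T 1 (future ?s \<omega>) \<partial>M)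
      + (\<integral>\<^sup>+\<omega>. indicator Q (past ?s \<omega>) * T (-1) (future ?s \<omega>) \<partial>M)"
    by (subst (1 2) markov) auto
  also have "\<dots> = (\<integral>\<^sup>+\<omega>. indicator P (past ?s \<omega>) * T 1 (future ?s \<omega>) + indicator Q (past ?s \<omega>) * T (-1) (future ?s \<omega>) \<partial>M)"
    by (subst nn_integral_add) auto
  also have "\<dots> \<le> (\<integral>\<^sup>+\<omega>. indicator {\<omega>\<in>space M. confined A (Suc n) (\<lambda>t. Z t \<omega>)} \<omega> \<partial>M)"
  proof (intro nn_integral_mono)
    fix \<omega> assume \<omega>: "\<omega> \<in> space M"
    have 1: "confined A (Suc n) (\<lambda>t. Z t \<omega>)" if "past ?s \<omega> \<in> P" "turn 1 A (future ?s \<omega>)"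
      using that pv[of \<omega>] by (intro confined_Suc[OF _ that(2) _ _ A]) (auto simp: P_def confined_past)
    have 2: "confined A (Suc n) (\<lambda>t. Z t \<omega>)" if "past ?s \<omega> \<in> Q" "turn (-1) A (future ?s \<omega>)"
      using that pv[of \<omega>] by (intro confined_Suc[OF _ that(2) _ _ A]) (auto simp: Q_def confined_past)
    have 3: "past ?s \<omega> \<in> P \<Longrightarrow> past ?s \<omega> \<notin> Q" by (auto simp: P_def Q_def)
    show "indicator P (past ?s \<omega>) * T 1 (future ?s \<omega>) + indicator Q (past ?s \<omega>) * T (-1) (future ?s \<omega>)
        \<le> indicator {\<omega>\<in>space M. confined A (Suc n) (\<lambda>t. Z t \<omega>)} \<omega>"
      using 1 2 3 \<omega> by (auto simp: T_def split: split_indicator)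
  qed
  also have "\<dots> = ennreal (prob {\<omega>\<in>space M. confined A (Suc n) (\<lambda>t. Z t \<omega>)})"
    using confined_sets by (simp add: emeasure_eq_measure)
  finally show ?case by (simp add: ennreal_le_iff)
qed

lemma prob_V_le:
  assumes nosub: "\<not> (subordinator M Z \<or> subordinator M (\<lambda>t \<omega>. - Z t \<omega>))"
  shows "\<exists>c q. 0 \<le> c \<and> 0 < q \<and> (\<forall>n. q ^ n \<le> prob {\<omega>\<in>space M. V (\<rat> \<inter> {0..real n}) \<omega> \<le> ennreal (real n * c)})"
proof -
  \<comment> \<open>If \<open>Z 1\<close> were almost surely negative, so would be every
    \<open>Z t\<close> with t > 0 by scaling, and \<open>- Z\<close> would be a
    subordinator.\<close>
  have pos: "\<not> (AE \<omega> in M. 1 * Z 1 \<omega> < 0)"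
  proof
    assume "AE \<omega> in M. 1 * Z 1 \<omega> < 0"
    then have 1: "AE \<omega> in M. Z 1 \<omega> \<in> {..<0}" by simp
    have 2: "AE \<omega> in M. Z t \<omega> \<in> {..<0}" if "0 < t" for t
      by (rule AE_scaling[OF _ _ 1 that]) (auto simp: mult_pos_neg)
    interpret neg: levy M "\<lambda>t \<omega>. - Z t \<omega>"
      by unfold_locales (rule levy_process_uminus[OF levy])
    have "subordinator M (\<lambda>t \<omega>. - Z t \<omega>)"
      using 2 by (intro neg.AE_pos_imp_subordinator) auto
    then show False using nosub by blast
  qed
  have neg: "\<not> (AE \<omega> in M. (-1) * Z 1 \<omega> < 0)"
  proof
    assume "AE \<omega> in M. (-1) * Z 1 \<omega> < 0"
    then have 1: "AE \<omega> in M. Z 1 \<omega> \<in> {0<..}" by simp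
    have "AE \<omega> in M. Z t \<omega> \<in> {0<..}" if "0 < t" for t
      by (rule AE_scaling[OF _ _ 1 that]) auto
    then have "subordinator M Z" by (intro AE_pos_imp_subordinator) auto
    then show False using nosub by blast
  qed
  obtain A where A: "0 \<le> A" "0 < prob {\<omega>\<in>space M. turn 1 A (future 0 \<omega>)}"
    using ex_turn_pos[OF pos] by blast
  obtain B where B: "0 \<le> B" "0 < prob {\<omega>\<in>space M. turn (-1) B (future 0 \<omega>)}"
    using ex_turn_pos[OF neg] by blast
  \<comment> \<open>One bound for both directions: enlarging it only enlarges the events.\<close>
  define C where "C = max A B"
  define q where "q = min (prob {\<omega>\<in>space M. turn 1 C (future 0 \<omega>)}) (prob {\<omega>\<in>space M. turn (-1) C (future 0 \<omega>)})"
  have "prob {\<omega>\<in>space M. turn 1 A (future 0 \<omega>)} \<le> prob {\<omega>\<in>space M. turn 1 C (future 0 \<omega>)}"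
    by (intro finite_measure_mono turn_sets) (auto simp: C_def intro: turn_mono[of A])
  moreover have "prob {\<omega>\<in>space M. turn (-1) B (future 0 \<omega>)} \<le> prob {\<omega>\<in>space M. turn (-1) C (future 0 \<omega>)}"
    by (intro finite_measure_mono turn_sets) (auto simp: C_def intro: turn_mono[of B])
  ultimately have q: "0 < q" using A B by (simp add: q_def)
  have C: "0 \<le> C" using A by (simp add: C_def)
  let ?c = "C + (4 * C powr (1 / p)) powr p"
  have "q ^ n \<le> prob {\<omega>\<in>space M. V (\<rat> \<inter> {0..real n}) \<omega> \<le> ennreal (real n * ?c)}" for n
  proof -
    have [measurable]: "V (\<rat> \<inter> {0..real n}) \<in> borel_measurable M"
      by (intro measurable_V countable_rat_Int) auto
    have "q ^ n \<le> prob {\<omega>\<in>space M. confined C n (\<lambda>t. Z t \<omega>)}"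
      using q by (intro prob_confined_ge C) (auto simp: q_def)
    also have "\<dots> \<le> prob {\<omega>\<in>space M. V (\<rat> \<inter> {0..real n}) \<omega> \<le> ennreal (real n * ?c)}"
    proof (rule finite_measure_mono)
      show "{\<omega>\<in>space M. confined C n (\<lambda>t. Z t \<omega>)} \<subseteq>
          {\<omega>\<in>space M. V (\<rat> \<inter> {0..real n}) \<omega> \<le> ennreal (real n * ?c)}"
        unfolding V_def using confined_gvar_le[OF _ C] by blast
    qed measurable
    finally show ?thesis .
  qed
  moreover have "0 \<le> ?c" using C by simp
  ultimately show ?thesis using q by blast
qed

end

section \<open>Superadditive limits and an exponential Tauberian theorem\<close>

text \<open>In the variable t = l^a the function \<open>g t = \<psi> (t powr (1 / a))\<close>
  satisfies n g(t) <= g(n t) and grows at most linearly. Then g(t)/t tends to its supremum over t >=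
  1, monotonicity bridging the gaps between multiples of a fixed time.\<close>

lemma superadditive_regular_limit:
  fixes \<psi> :: "real \<Rightarrow> real"
  assumes a: "0 < a"
    and mono: "\<And>x y. 0 \<le> x \<Longrightarrow> x \<le> y \<Longrightarrow> \<psi> x \<le> \<psi> y"
    and super: "\<And>n l. 0 \<le> l \<Longrightarrow> real n * \<psi> l \<le> \<psi> (real n powr (1 / a) * l)"
    and bound: "\<And>n. \<psi> (real n powr (1 / a)) \<le> c * real n"
    and pos: "0 < \<psi> 1"
  shows "\<exists>C>0. ((\<lambda>x. \<psi> x / x powr a) \<longlongrightarrow> C) at_top"
proof -
  define g where "g t = \<psi> (t powr (1 / a))" for t
  have g_mono: "g s \<le> g t" if "0 \<le> s" "s \<le> t" for s t
    unfolding g_def using that a by (intro mono powr_mono2) auto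
  have g_super: "real n * g t \<le> g (real n * t)" if "0 \<le> t" for n t
    unfolding g_def using super[of "t powr (1 / a)" n] that by (simp add: powr_mult)
  have g1: "g 1 = \<psi> 1" by (simp add: g_def)
  have "0 < c" using bound[of 1] pos by simp
  \<comment> \<open>The bound at integers is transferred by rounding up, which costs at most a
    factor 2, as t + 1 <= 2 t.\<close>
  have g_le: "g t \<le> 2 * c * t" if "1 \<le> t" for t
  proof -
    have "g t \<le> g (real (nat \<lceil>t\<rceil>))" using that by (intro g_mono) auto
    also have "\<dots> \<le> c * real (nat \<lceil>t\<rceil>)" unfolding g_def by (rule bound)
    also have "\<dots> \<le> c * (2 * t)"
      using \<open>0 < c\<close> that of_int_ceiling_le_add_one[of t]
      by (intro mult_left_mono) (simp_all add: of_nat_nat, linarith?)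
    finally show ?thesis by simp
  qed
  define C where "C = (SUP t\<in>{1..}. g t / t)"
  have bdd: "bdd_above ((\<lambda>t. g t / t) ` {1..})"
    using g_le by (intro bdd_aboveI2[of _ _ "2 * c"]) (auto simp: field_simps)
  have le_C: "g t / t \<le> C" if "1 \<le> t" for t
    unfolding C_def using that bdd by (intro cSUP_upper) auto
  have "0 < C" using le_C[of 1] pos by (simp add: g1)
  have "((\<lambda>t. g t / t) \<longlongrightarrow> C) at_top"
  proof (rule order_tendstoI)
    fix y assume "C < y"
    then show "\<forall>\<^sub>F t in at_top. g t / t < y"
      by (intro eventually_mono[OF eventually_ge_at_top[of 1]]) (use le_C in force)
  next
    fix y assume "y < C"
    then obtain t0 where t0: "1 \<le> t0" "y < g t0 / t0"
      unfolding C_def using bdd by (subst (asm) less_cSUP_iff) auto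
    have "0 \<le> g t0" using g_mono[of 1 t0] t0 pos g1 by simp
    have "((\<lambda>t. g t0 / t0 - g t0 / t) \<longlongrightarrow> g t0 / t0 - 0) at_top"
      by (intro tendsto_diff tendsto_const tendsto_divide_0[OF tendsto_const])
         (rule filterlim_at_top_imp_at_infinity[OF filterlim_ident])
    then have "\<forall>\<^sub>F t in at_top. y < g t0 / t0 - g t0 / t"
      using t0(2) by (auto dest: order_tendstoD)
    then show "\<forall>\<^sub>F t in at_top. y < g t / t"
      using eventually_ge_at_top[of t0]
    proof eventually_elim
      fix t assume t: "y < g t0 / t0 - g t0 / t" "t0 \<le> t"
      \<comment> \<open>The number of whole copies of \<open>t0\<close> in t. Less than one copy is
        lost, which lowers the ratio by at most \<open>g t0 / t\<close>.\<close>
      define n where "n = nat \<lfloor>t / t0\<rfloor>"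
      have n: "t / t0 - 1 \<le> real n" "real n \<le> t / t0"
        using t t0 floor_correct[of "t / t0"] unfolding n_def by (simp_all add: of_nat_nat)
      have "(t / t0 - 1) * g t0 \<le> real n * g t0"
        using n \<open>0 \<le> g t0\<close> by (intro mult_right_mono) auto
      also have "\<dots> \<le> g (real n * t0)" using t0 by (intro g_super) auto
      also have "\<dots> \<le> g t" using n t0 by (intro g_mono) (auto simp: field_simps)
      finally have "(t / t0 - 1) * g t0 \<le> g t" .
      then have "(t / t0 - 1) * g t0 / t \<le> g t / t"
        using t t0 by (intro divide_right_mono) auto
      also have "(t / t0 - 1) * g t0 / t = g t0 / t0 - g t0 / t"
        using t t0 by (simp add: field_simps)
      finally show "y < g t / t" using t by linarith
    qed
  qed
  moreover have "filterlim (\<lambda>x::real. x powr a) at_top at_top"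
    using a by real_asymp
  ultimately have "((\<lambda>x. g (x powr a) / x powr a) \<longlongrightarrow> C) at_top"
    by (rule filterlim_compose)
  then have "((\<lambda>x. \<psi> x / x powr a) \<longlongrightarrow> C) at_top"
    by (rule Lim_transform_eventually)
       (rule eventually_mono[OF eventually_gt_at_top[of 0]], use a in \<open>simp add: g_def powr_powr\<close>)
  then show ?thesis using \<open>0 < C\<close> by blast
qed

text \<open>As a function of \<theta>, the last expression vanishes at 0 with derivative a \<tau>,
  so a small \<theta> with the sign of \<tau> works. Up to a factor \<open>C\<close> it is the limit
  of the decay rate \<open>b\<close> in \<open>exponential_tauberian\<close>.\<close>

lemma tilt_exponent_pos:
  fixes a \<tau> :: real
  assumes "0 < a" "\<tau> \<noteq> 0"
  obtains \<theta> where "\<bar>\<theta>\<bar> < 1" "0 < \<theta> * \<tau>" "0 < a * \<theta> * (1 + \<tau>) + (1 - \<theta>) powr a - 1"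
proof -
  define h where "h \<theta> = a * \<theta> * (1 + \<tau>) + (1 - \<theta>) powr a - 1" for \<theta>
  have der: "DERIV h 0 :> a * \<tau>"
    unfolding h_def by (auto intro!: derivative_eq_intros simp: algebra_simps)
  have h0: "h 0 = 0" by (simp add: h_def)
  show ?thesis
  proof (cases "\<tau> > 0")
    case True
    then obtain d where d: "0 < d" "\<And>x. 0 < x \<Longrightarrow> x < d \<Longrightarrow> h 0 < h (0 + x)"
      using DERIV_pos_inc_right[OF der] assms by auto
    show ?thesis
      using d(2)[of "min (d/2) (1/2)"] d(1) True h0
      by (intro that[of "min (d/2) (1/2)"]) (auto simp: h_def min_def)
  next
    case False
    then have "\<tau> < 0" using assms by simp
    then obtain d where d: "0 < d" "\<And>x. 0 < x \<Longrightarrow> x < d \<Longrightarrow> h 0 < h (0 - x)"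
      using DERIV_neg_dec_left[OF der] assms by (auto simp: mult_pos_neg)
    show ?thesis
      using d(2)[of "min (d/2) (1/2)"] d(1) \<open>\<tau> < 0\<close> h0
      by (intro that[of "- min (d/2) (1/2)"]) (auto simp: h_def min_def mult_pos_neg mult_less_0_iff)
  qed
qed

text \<open>
  The value of \<open>l\<close> at which the Legendre transform of \<open>C l^a\<close> is attained is
  \<open>(C a / x)^(1/(1-a))\<close>; the lower bound comes from tilting the law of \<open>X\<close> at that point.
\<close>

lemma exponential_tauberian:
  fixes X :: "'a \<Rightarrow> real" and a C :: real
  assumes M: "prob_space M" and X[measurable]: "X \<in> borel_measurable M"
    and X0: "\<And>\<omega>. \<omega> \<in> space M \<Longrightarrow> 0 \<le> X \<omega>"
    and a: "0 < a" "a < 1" and C: "0 < C"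
    and lim: "((\<lambda>l. - ln (\<integral>\<omega>. exp (- l * X \<omega>) \<partial>M) / l powr a) \<longlongrightarrow> C) at_top"
  shows "((\<lambda>x. x powr (a / (1 - a)) * ln (measure M {\<omega>\<in>space M. X \<omega> \<le> x})) \<longlongrightarrow>
            - ((1 - a) * C * (C * a) powr (a / (1 - a)))) (at_right 0)"
proof -
  interpret prob_space M by fact
  define L where "L l = (\<integral>\<omega>. exp (- l * X \<omega>) \<partial>M)" for l
  define \<psi> where "\<psi> l = - ln (L l)" for l
  define \<beta> where "\<beta> = a / (1 - a)"
  define P where "P x = measure M {\<omega>\<in>space M. X \<omega> \<le> x}" for x
  define ll where "ll x = (C * a / x) powr (1 / (1 - a))" for x
  \<comment> \<open>For fixed x > 0 the minimum of l x - C l^a over l is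
    \<open>- K * x powr (- \<beta>)\<close>, attained at \<open>ll x\<close>.\<close>
  define K where "K = (1 - a) * C * (C * a) powr \<beta>"
  have \<beta>: "0 < \<beta>" using a by (simp add: \<beta>_def)
  have int: "integrable M (\<lambda>\<omega>. exp (- l * X \<omega>))" if "0 \<le> l" for l
    by (rule integrable_const_bound[of _ 1]) (use that X0 in auto)
  have intA: "integrable M (\<lambda>\<omega>. indicator A \<omega> * exp (- l * X \<omega>))"
    if "0 \<le> l" "A \<in> sets M" for l A
    by (rule integrable_const_bound[of _ 1])
       (use that X0 in \<open>auto simp: indicator_def intro!: AE_I2\<close>)
  have intI: "integrable M (indicator A :: 'a \<Rightarrow> real)" if "A \<in> sets M" for A
    by (rule integrable_const_bound[of _ 1]) (use that in auto)
  have Lpos: "0 < L l" if "0 \<le> l" for l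
  proof -
    have "0 \<le> L l" unfolding L_def by (rule integral_nonneg_AE) auto
    moreover have "L l \<noteq> 0"
      unfolding L_def using int[OF that] by (subst integral_nonneg_eq_0_iff_AE) auto
    ultimately show ?thesis by simp
  qed
  have L_exp: "L l = exp (- \<psi> l)" if "0 \<le> l" for l
    using Lpos[OF that] by (simp add: \<psi>_def)
  have limpsi: "((\<lambda>l. \<psi> l / l powr a) \<longlongrightarrow> C) at_top"
    using lim by (simp add: \<psi>_def L_def)
  have ll_pos: "0 < ll x" if "0 < x" for x using that C a by (simp add: ll_def)
  have ll_top: "filterlim ll at_top (at_right 0)"
    unfolding ll_def using C a by real_asymp
  have ll_a: "ll x powr a = (C * a) powr \<beta> * x powr (- \<beta>)" if "0 < x" for x
    using that C a by (simp add: ll_def powr_powr \<beta>_def powr_divide powr_minus_divide)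
  \<comment> \<open>First-order condition x = C a l^(a-1), multiplied by l; it makes both terms of l
    x - C l^a multiples of l^a.\<close>
  have ll_x: "ll x * x = C * a * ll x powr a" if "0 < x" for x
  proof -
    have "ll x powr (1 - a) = C * a / x" using that C a by (simp add: ll_def powr_powr)
    moreover have "ll x = ll x powr (1 - a) * ll x powr a"
      using ll_pos[OF that] by (simp add: powr_add[symmetric])
    ultimately show ?thesis using that by (metis (no_types, opaque_lifting) less_irrefl mult.assoc mult.commute nonzero_eq_divide_eq)
  qed
  have xb: "x powr \<beta> * ll x powr a = (C * a) powr \<beta>" if "0 < x" for x
    using that by (simp add: ll_a powr_minus field_simps)
  have limll: "((\<lambda>x. \<psi> (ll x) / ll x powr a) \<longlongrightarrow> C) (at_right 0)"
    by (rule filterlim_compose[OF limpsi ll_top])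
  have pos_ev: "\<forall>\<^sub>F x::real in at_right 0. 0 < x" by (simp add: eventually_at_right_less)
  \<comment> \<open>Exponential Chebyshev inequality; with l = \<open>ll x\<close> it gives the
    upper bound.\<close>
  have upper: "P x \<le> exp (l * x) * L l" if "0 \<le> l" for x l
  proof -
    have "P x = (\<integral>\<omega>. indicator {\<omega>\<in>space M. X \<omega> \<le> x} \<omega> \<partial>M)" by (simp add: P_def)
    also have "\<dots> \<le> (\<integral>\<omega>. exp (l * x) * exp (- l * X \<omega>) \<partial>M)"
    proof (rule integral_mono)
      show "integrable M (\<lambda>\<omega>. indicator {\<omega>\<in>space M. X \<omega> \<le> x} \<omega> :: real)"
        by (rule intI) auto
      show "integrable M (\<lambda>\<omega>. exp (l * x) * exp (- l * X \<omega>))"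
        using int[OF that] by (rule integrable_mult_right)
    qed (use that in \<open>auto simp: indicator_def exp_add[symmetric] mult_left_mono\<close>)
    also have "\<dots> = exp (l * x) * L l" by (simp add: L_def)
    finally show ?thesis .
  qed
  \<comment> \<open>The law tilted by exp (- \<open>ll y\<close> X) concentrates near y: the mass
    beyond (1 + \<tau>) y, above it for \<tau> > 0 and below it for \<tau> < 0, vanishes. A second
    tilt inserts exp (\<theta> l (X - (1 + \<tau>) y)), which is at least 1 on \<open>A y\<close>,
    and leaves the Laplace transform at (1 - \<theta>) l.\<close>
  have tail: "((\<lambda>y. (\<integral>\<omega>. indicator (A y) \<omega> * exp (- ll y * X \<omega>) \<partial>M) / L (ll y)) \<longlongrightarrow> 0) (at_right 0)"
    if "\<tau> \<noteq> 0" and A: "\<And>y. A y \<in> sets M" and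
      Ay: "\<And>y \<omega>. \<omega> \<in> A y \<Longrightarrow> 0 \<le> \<tau> * (X \<omega> - (1 + \<tau>) * y)" for \<tau> A
  proof -
    obtain \<theta> where \<theta>: "\<bar>\<theta>\<bar> < 1" "0 < \<theta> * \<tau>" "0 < a * \<theta> * (1 + \<tau>) + (1 - \<theta>) powr a - 1"
      using tilt_exponent_pos[OF a(1) \<open>\<tau> \<noteq> 0\<close>] by blast
    \<comment> \<open>The decay exponent of that tail in units of \<open>ll y powr a\<close>, with l
      y expressed by the first-order condition.\<close>
    define b where "b y = \<theta> * (1 + \<tau>) * (C * a) + \<psi> ((1 - \<theta>) * ll y) / ((1 - \<theta>) * ll y) powr a * (1 - \<theta>) powr a
        - \<psi> (ll y) / ll y powr a" for y
    have "filterlim (\<lambda>y. (1 - \<theta>) * ll y) at_top (at_right 0)"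
      using \<theta>(1) by (intro filterlim_tendsto_pos_mult_at_top[OF tendsto_const _ ll_top]) auto
    then have "((\<lambda>y. \<psi> ((1 - \<theta>) * ll y) / ((1 - \<theta>) * ll y) powr a) \<longlongrightarrow> C) (at_right 0)"
      by (rule filterlim_compose[OF limpsi])
    then have "(b \<longlongrightarrow> \<theta> * (1 + \<tau>) * (C * a) + C * (1 - \<theta>) powr a - C) (at_right 0)"
      unfolding b_def by (intro tendsto_intros limll)
    moreover have "\<theta> * (1 + \<tau>) * (C * a) + C * (1 - \<theta>) powr a - C = C * (a * \<theta> * (1 + \<tau>) + (1 - \<theta>) powr a - 1)"
      by (simp add: algebra_simps)
    ultimately have blim: "(b \<longlongrightarrow> C * (a * \<theta> * (1 + \<tau>) + (1 - \<theta>) powr a - 1)) (at_right 0)" by simp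
    have "filterlim (\<lambda>x::real. x powr a) at_top at_top" using a by real_asymp
    from filterlim_compose[OF this ll_top]
    have "filterlim (\<lambda>y. b y * ll y powr a) at_top (at_right 0)"
      using \<theta>(3) C by (intro filterlim_tendsto_pos_mult_at_top[OF blim]) (auto intro!: mult_pos_pos)
    then have lim0: "((\<lambda>y. exp (- (b y * ll y powr a))) \<longlongrightarrow> 0) (at_right 0)"
      by (intro filterlim_compose[OF exp_at_bot] filterlim_compose[OF filterlim_uminus_at_bot_at_top])
    show ?thesis
    proof (rule tendsto_sandwich[OF _ _ tendsto_const lim0])
      show "\<forall>\<^sub>F y in at_right 0. 0 \<le> (\<integral>\<omega>. indicator (A y) \<omega> * exp (- ll y * X \<omega>) \<partial>M) / L (ll y)"
        using pos_ev
        by eventually_elim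
           (auto intro!: divide_nonneg_pos Lpos integral_nonneg_AE less_imp_le[OF ll_pos])
      show "\<forall>\<^sub>F y in at_right 0. (\<integral>\<omega>. indicator (A y) \<omega> * exp (- ll y * X \<omega>) \<partial>M) / L (ll y)
          \<le> exp (- (b y * ll y powr a))"
        using pos_ev
      proof eventually_elim
        fix y :: real assume y: "0 < y"
        define l where "l = ll y"
        have l: "0 < l" using ll_pos[OF y] by (simp add: l_def)
        have m: "0 < (1 - \<theta>) * l" using l \<theta>(1) by auto
        have "(\<integral>\<omega>. indicator (A y) \<omega> * exp (- l * X \<omega>) \<partial>M)
            \<le> (\<integral>\<omega>. exp (- (\<theta> * l * ((1 + \<tau>) * y))) * exp (- ((1 - \<theta>) * l) * X \<omega>) \<partial>M)"
        proof (intro integral_mono intA A integrable_mult_right int)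
          fix \<omega> assume \<omega>: "\<omega> \<in> space M"
          show "indicator (A y) \<omega> * exp (- l * X \<omega>)
              \<le> exp (- (\<theta> * l * ((1 + \<tau>) * y))) * exp (- ((1 - \<theta>) * l) * X \<omega>)"
          proof (cases "\<omega> \<in> A y")
            case True
            have "0 \<le> \<theta> * (X \<omega> - (1 + \<tau>) * y)"
              using Ay[OF True] \<theta>(2) by (auto simp: zero_le_mult_iff zero_less_mult_iff)
            then have "0 \<le> l * (\<theta> * (X \<omega> - (1 + \<tau>) * y))" using l by simp
            then show ?thesis using True by (simp add: exp_add[symmetric] algebra_simps)
          qed simp
        qed (use l m in auto)
        also have "\<dots> = exp (- (\<theta> * l * ((1 + \<tau>) * y))) * exp (- \<psi> ((1 - \<theta>) * l))"
          using L_exp[of "(1 - \<theta>) * l"] m by (simp add: L_def)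
        also have "\<dots> = exp (- (b y * l powr a)) * L l"
        proof -
          have "b y * l powr a = \<theta> * (1 + \<tau>) * (C * a * l powr a) + \<psi> ((1 - \<theta>) * l) - \<psi> l"
          proof -
            have "((1 - \<theta>) * l) powr a = (1 - \<theta>) powr a * l powr a"
              by (rule powr_mult)
            then show ?thesis
              using l \<theta>(1) unfolding b_def l_def[symmetric] by (simp add: field_simps)
          qed
          also have "C * a * l powr a = l * y" using ll_x[OF y] by (simp add: l_def)
          finally show ?thesis using L_exp[of l] l
            by (simp add: exp_add[symmetric] algebra_simps)
        qed
        finally show "(\<integral>\<omega>. indicator (A y) \<omega> * exp (- ll y * X \<omega>) \<partial>M) / L (ll y)
            \<le> exp (- (b y * ll y powr a))"
          using Lpos[of l] l by (simp add: l_def divide_le_eq)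
      qed
    qed
  qed
  \<comment> \<open>Each tail takes less than a quarter of the tilted mass, so at least half of it
    remains where X is between (1 - \<delta>) y and (1 + \<delta>) y. There exp (- l X) is at most
    exp (- l (1 - \<delta>) y), which undoes the tilt.\<close>
  have lower: "\<forall>\<^sub>F y in at_right 0. exp (ll y * ((1 - \<delta>) * y)) * L (ll y) / 2 \<le> P ((1 + \<delta>) * y)"
    if \<delta>: "0 < \<delta>" for \<delta>
  proof -
    let ?A = "\<lambda>y. {\<omega>\<in>space M. (1 + \<delta>) * y \<le> X \<omega>}"
    let ?B = "\<lambda>y. {\<omega>\<in>space M. X \<omega> \<le> (1 - \<delta>) * y}"
    have "((\<lambda>y. (\<integral>\<omega>. indicator (?A y) \<omega> * exp (- ll y * X \<omega>) \<partial>M) / L (ll y)) \<longlongrightarrow> 0) (at_right 0)"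
      by (rule tail[of \<delta>]) (use \<delta> in auto)
    then have A: "\<forall>\<^sub>F y in at_right 0. (\<integral>\<omega>. indicator (?A y) \<omega> * exp (- ll y * X \<omega>) \<partial>M) / L (ll y) < 1/4"
      by (rule order_tendstoD) simp
    have "((\<lambda>y. (\<integral>\<omega>. indicator (?B y) \<omega> * exp (- ll y * X \<omega>) \<partial>M) / L (ll y)) \<longlongrightarrow> 0) (at_right 0)"
      by (rule tail[of "- \<delta>"]) (use \<delta> in \<open>auto simp: mult_le_0_iff\<close>)
    then have B: "\<forall>\<^sub>F y in at_right 0. (\<integral>\<omega>. indicator (?B y) \<omega> * exp (- ll y * X \<omega>) \<partial>M) / L (ll y) < 1/4"
      by (rule order_tendstoD) simp
    show ?thesis using A B pos_ev
    proof eventually_elim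
      fix y :: real
      assume A: "(\<integral>\<omega>. indicator (?A y) \<omega> * exp (- ll y * X \<omega>) \<partial>M) / L (ll y) < 1/4"
        and B: "(\<integral>\<omega>. indicator (?B y) \<omega> * exp (- ll y * X \<omega>) \<partial>M) / L (ll y) < 1/4" and y: "0 < y"
      define l where "l = ll y"
      have l: "0 < l" using ll_pos[OF y] by (simp add: l_def)
      let ?D = "{\<omega>\<in>space M. (1 - \<delta>) * y < X \<omega> \<and> X \<omega> < (1 + \<delta>) * y}"
      have "L l \<le> (\<integral>\<omega>. indicator (?A y) \<omega> * exp (- l * X \<omega>) + indicator (?B y) \<omega> * exp (- l * X \<omega>)
          + exp (- l * ((1 - \<delta>) * y)) * indicator ?D \<omega> \<partial>M)"
        unfolding L_def
      proof (intro integral_mono Bochner_Integration.integrable_add intA int integrable_mult_right)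
        fix \<omega> assume \<omega>: "\<omega> \<in> space M"
        have "\<not> X \<omega> \<le> (1 - \<delta>) * y \<Longrightarrow> exp (- l * X \<omega>) \<le> exp (- l * ((1 - \<delta>) * y))"
          using l by simp
        then show "exp (- l * X \<omega>) \<le> indicator (?A y) \<omega> * exp (- l * X \<omega>)
            + indicator (?B y) \<omega> * exp (- l * X \<omega>) + exp (- l * ((1 - \<delta>) * y)) * indicator ?D \<omega>"
          using \<omega> by (auto simp: indicator_def)
      qed (use l in \<open>auto intro: intI\<close>)
      also have "\<dots> = (\<integral>\<omega>. indicator (?A y) \<omega> * exp (- l * X \<omega>) \<partial>M) + (\<integral>\<omega>. indicator (?B y) \<omega> * exp (- l * X \<omega>) \<partial>M)
          + exp (- l * ((1 - \<delta>) * y)) * measure M ?D"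
        using l intA[of l "?A y"] intA[of l "?B y"] intI[of ?D] by simp
      also have "measure M ?D \<le> P ((1 + \<delta>) * y)"
        unfolding P_def by (intro finite_measure_mono) auto
      also have "(\<integral>\<omega>. indicator (?A y) \<omega> * exp (- l * X \<omega>) \<partial>M) \<le> L l / 4"
        using A Lpos[of l] l by (simp add: l_def divide_less_eq)
      also have "(\<integral>\<omega>. indicator (?B y) \<omega> * exp (- l * X \<omega>) \<partial>M) \<le> L l / 4"
        using B Lpos[of l] l by (simp add: l_def divide_less_eq)
      finally have "L l / 2 \<le> exp (- l * ((1 - \<delta>) * y)) * P ((1 + \<delta>) * y)" by simp
      then have "exp (l * ((1 - \<delta>) * y)) * (L l / 2)
          \<le> exp (l * ((1 - \<delta>) * y)) * (exp (- l * ((1 - \<delta>) * y)) * P ((1 + \<delta>) * y))"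
        by (rule mult_left_mono) simp
      also have "\<dots> = P ((1 + \<delta>) * y)" by (simp add: mult.assoc[symmetric] exp_add[symmetric])
      finally show "exp (ll y * ((1 - \<delta>) * y)) * L (ll y) / 2 \<le> P ((1 + \<delta>) * y)"
        by (simp add: l_def)
    qed
  qed
  have scale: "\<forall>\<^sub>F x in at_right 0. Q (x / (1 + \<delta>))"
    if "0 < \<delta>" "\<forall>\<^sub>F y in at_right 0. Q y" for \<delta> :: real and Q
  proof -
    have "filterlim (\<lambda>x. x / (1 + \<delta>)) (at_right 0) (at_right 0)"
      using that(1) by real_asymp
    then show ?thesis using that(2) by (simp add: filterlim_iff)
  qed
  \<comment> \<open>Needed before taking logarithms, since \<open>ln 0\<close> is only a default
    value; the lower estimate with \<delta> = 1 provides it.\<close>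
  have Ppos: "\<forall>\<^sub>F x in at_right 0. 0 < P x"
    using scale[OF zero_less_one lower[OF zero_less_one]] pos_ev
  proof eventually_elim
    case (elim x)
    have "0 < exp (ll (x / (1 + 1)) * ((1 - 1) * (x / (1 + 1)))) * L (ll (x / (1 + 1))) / 2"
      using Lpos[of "ll (x / 2)"] ll_pos[of "x / 2"] elim by simp
    also note elim(1)
    finally show ?case by simp
  qed
  have "((\<lambda>x. x powr \<beta> * ln (P x)) \<longlongrightarrow> - K) (at_right 0)"
  proof (rule order_tendstoI)
    fix u assume u: "- K < u"
    have "((\<lambda>x. (C * a) powr \<beta> * (C * a - \<psi> (ll x) / ll x powr a)) \<longlongrightarrow> (C * a) powr \<beta> * (C * a - C)) (at_right 0)"
      by (intro tendsto_intros limll)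
    moreover have "(C * a) powr \<beta> * (C * a - C) = - K" by (simp add: K_def algebra_simps)
    ultimately have "\<forall>\<^sub>F x in at_right 0. (C * a) powr \<beta> * (C * a - \<psi> (ll x) / ll x powr a) < u"
      using u by (auto dest: order_tendstoD)
    then show "\<forall>\<^sub>F x in at_right 0. x powr \<beta> * ln (P x) < u"
      using Ppos pos_ev
    proof eventually_elim
      fix x assume u: "(C * a) powr \<beta> * (C * a - \<psi> (ll x) / ll x powr a) < u" and P: "0 < P x" and x: "0 < x"
      note l = ll_pos[OF x]
      have "ln (P x) \<le> ln (exp (ll x * x) * L (ll x))"
        using P upper[of "ll x" x] l by (intro ln_mono) auto
      also have "\<dots> = ll x * x - \<psi> (ll x)"
        using L_exp[of "ll x"] l by (simp add: exp_add[symmetric])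
      finally have "x powr \<beta> * ln (P x) \<le> x powr \<beta> * (ll x * x - \<psi> (ll x))"
        by (intro mult_left_mono) auto
      also have "\<dots> = x powr \<beta> * ll x powr a * (C * a - \<psi> (ll x) / ll x powr a)"
        unfolding ll_x[OF x] using l by (simp add: field_simps)
      also have "\<dots> < u" using u xb[OF x] by simp
      finally show "x powr \<beta> * ln (P x) < u" .
    qed
  next
    fix u assume u: "u < - K"
    \<comment> \<open>The loss in the exponent per unit of \<delta>, caused by the width of the
      window. The further \<delta> subtracted below is slack for the limit in y, and the factor (1 +
      \<delta>)^\<beta> comes from substituting x = (1 + \<delta>) y.\<close>
    define \<kappa> where "\<kappa> = (C * a) powr \<beta> * (C * a)"
    have "((\<lambda>\<delta>. (1 + \<delta>) powr \<beta> * (- K - \<kappa> * \<delta> - \<delta>)) \<longlongrightarrow> (1 + 0) powr \<beta> * (- K - \<kappa> * 0 - 0)) (at_right 0)"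
      by (intro tendsto_intros) auto
    then have "\<forall>\<^sub>F \<delta> in at_right 0. u < (1 + \<delta>) powr \<beta> * (- K - \<kappa> * \<delta> - \<delta>)"
      using u by (auto dest: order_tendstoD)
    then have "\<forall>\<^sub>F \<delta> in at_right 0. u < (1 + \<delta>) powr \<beta> * (- K - \<kappa> * \<delta> - \<delta>) \<and> 0 < \<delta>"
      using pos_ev by eventually_elim auto
    then obtain \<delta> where \<delta>: "0 < \<delta>" "u < (1 + \<delta>) powr \<beta> * (- K - \<kappa> * \<delta> - \<delta>)"
      by (auto dest!: eventually_happens)
    have zero: "((\<lambda>y::real. y powr \<beta> * ln 2) \<longlongrightarrow> 0) (at_right 0)" using \<beta> by real_asymp
    have "((\<lambda>y. (C * a) powr \<beta> * (C * a * (1 - \<delta>) - \<psi> (ll y) / ll y powr a) - y powr \<beta> * ln 2)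
        \<longlongrightarrow> (C * a) powr \<beta> * (C * a * (1 - \<delta>) - C) - 0) (at_right 0)"
      by (intro tendsto_intros limll zero)
    moreover have "(C * a) powr \<beta> * (C * a * (1 - \<delta>) - C) - 0 = - K - \<kappa> * \<delta>"
      by (simp add: K_def \<kappa>_def algebra_simps)
    ultimately have "((\<lambda>y. (C * a) powr \<beta> * (C * a * (1 - \<delta>) - \<psi> (ll y) / ll y powr a) - y powr \<beta> * ln 2)
        \<longlongrightarrow> - K - \<kappa> * \<delta>) (at_right 0)" by simp
    then have "\<forall>\<^sub>F y in at_right 0. - K - \<kappa> * \<delta> - \<delta> <
        (C * a) powr \<beta> * (C * a * (1 - \<delta>) - \<psi> (ll y) / ll y powr a) - y powr \<beta> * ln 2"
      by (rule order_tendstoD) (use \<delta>(1) in simp)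
    then have "\<forall>\<^sub>F y in at_right 0. - K - \<kappa> * \<delta> - \<delta> < y powr \<beta> * ln (P ((1 + \<delta>) * y))"
      using lower[OF \<delta>(1)] pos_ev
    proof eventually_elim
      fix y assume 1: "- K - \<kappa> * \<delta> - \<delta> <
          (C * a) powr \<beta> * (C * a * (1 - \<delta>) - \<psi> (ll y) / ll y powr a) - y powr \<beta> * ln 2"
        and 2: "exp (ll y * ((1 - \<delta>) * y)) * L (ll y) / 2 \<le> P ((1 + \<delta>) * y)" and y: "0 < y"
      note l = ll_pos[OF y]
      have "exp (ll y * y * (1 - \<delta>) - \<psi> (ll y) - ln 2) = exp (ll y * ((1 - \<delta>) * y)) * L (ll y) / 2"
      proof -
        have "exp (z - w - ln 2) = exp z * exp (- w) / 2" for z w :: real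
          by (simp only: exp_diff exp_minus divide_inverse) simp
        moreover have "ll y * y * (1 - \<delta>) = ll y * ((1 - \<delta>) * y)" by (simp only: ac_simps)
        moreover have "exp (- \<psi> (ll y)) = L (ll y)" using L_exp[of "ll y"] l by simp
        ultimately show ?thesis by (simp only:)
      qed
      with 2 have "exp (ll y * y * (1 - \<delta>) - \<psi> (ll y) - ln 2) \<le> P ((1 + \<delta>) * y)" by simp
      then have "ll y * y * (1 - \<delta>) - \<psi> (ll y) - ln 2 \<le> ln (P ((1 + \<delta>) * y))"
        by (subst ln_ge_iff) (auto intro: less_le_trans[OF exp_gt_zero])
      then have "y powr \<beta> * (ll y * y * (1 - \<delta>) - \<psi> (ll y) - ln 2) \<le> y powr \<beta> * ln (P ((1 + \<delta>) * y))"
        by (intro mult_left_mono) auto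
      moreover have "y powr \<beta> * (ll y * y * (1 - \<delta>) - \<psi> (ll y) - ln 2) =
          y powr \<beta> * ll y powr a * (C * a * (1 - \<delta>) - \<psi> (ll y) / ll y powr a) - y powr \<beta> * ln 2"
        unfolding ll_x[OF y] using l by (simp add: field_simps)
      ultimately show "- K - \<kappa> * \<delta> - \<delta> < y powr \<beta> * ln (P ((1 + \<delta>) * y))"
        using 1 xb[OF y] by simp
    qed
    from scale[OF \<delta>(1) this] show "\<forall>\<^sub>F x in at_right 0. u < x powr \<beta> * ln (P x)"
      using pos_ev
    proof eventually_elim
      fix x assume 1: "- K - \<kappa> * \<delta> - \<delta> < (x / (1 + \<delta>)) powr \<beta> * ln (P ((1 + \<delta>) * (x / (1 + \<delta>))))"
        and x: "0 < x"
      have "u < (1 + \<delta>) powr \<beta> * (- K - \<kappa> * \<delta> - \<delta>)" by fact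
      also have "\<dots> < (1 + \<delta>) powr \<beta> * ((x / (1 + \<delta>)) powr \<beta> * ln (P x))"
        using 1 \<delta>(1) by (intro mult_strict_left_mono) auto
      also have "\<dots> = x powr \<beta> * ln (P x)"
        using \<delta>(1) x by (simp add: powr_divide)
      finally show "u < x powr \<beta> * ln (P x)" .
    qed
  qed
  then show ?thesis by (simp add: K_def \<beta>_def P_def)
qed

section \<open>Laplace transform of the variation\<close>

text \<open>The Laplace kernel with value 0 at infinity, even for l = 0, so that it turns sums into
  products without any finiteness assumption.\<close>

definition exp_neg :: "real \<Rightarrow> ennreal \<Rightarrow> ennreal" where
  "exp_neg l v = (if v = \<infinity> then 0 else ennreal (exp (- l * enn2real v)))"

lemma measurable_exp_neg [measurable]: "exp_neg l \<in> borel_measurable borel"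
  unfolding exp_neg_def[abs_def] by measurable

lemma exp_neg_le_1: "0 \<le> l \<Longrightarrow> exp_neg l v \<le> 1"
  by (auto simp: exp_neg_def)

lemma exp_neg_ennreal: "0 \<le> x \<Longrightarrow> exp_neg l (ennreal x) = ennreal (exp (- l * x))"
  by (simp add: exp_neg_def)

lemma exp_neg_antimono:
  assumes "0 \<le> l" "v \<le> w" shows "exp_neg l w \<le> exp_neg l v"
proof (cases "w = \<infinity>")
  case False
  then have "v \<noteq> \<infinity>" using assms(2) by (auto simp: top_unique)
  moreover have "enn2real v \<le> enn2real w" using False assms(2) by (intro enn2real_mono) (auto simp: less_top)
  ultimately show ?thesis using False assms(1) by (auto simp: exp_neg_def intro!: ennreal_leI mult_left_mono)
qed (simp add: exp_neg_def)

lemma exp_neg_add: "exp_neg l (v + w) = exp_neg l v * exp_neg l w"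
  by (auto simp: exp_neg_def enn2real_plus less_top[symmetric] ennreal_mult'[symmetric]
      exp_add[symmetric] algebra_simps)

lemma exp_neg_cmult:
  assumes "0 < c" shows "exp_neg l (ennreal c * v) = exp_neg (l * c) v"
  using assms by (auto simp: exp_neg_def enn2real_mult ennreal_mult_eq_top_iff mult_ac)

context stable
begin

definition laplace :: "real \<Rightarrow> real" where
  "laplace l = (\<integral>\<omega>. exp (- l * enn2real (V unit_rats \<omega>)) \<partial>M)"

lemma measurable_V_unit [measurable]: "V unit_rats \<in> borel_measurable M"
  by (rule measurable_V[OF unit_rats])

lemma integrable_laplace: "0 \<le> l \<Longrightarrow> integrable M (\<lambda>\<omega>. exp (- l * enn2real (V unit_rats \<omega>)))"
  by (rule integrable_const_bound[of _ 1]) auto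

text \<open>At infinite variation the two integrands disagree, with values 0 and 1, because
  \<open>enn2real\<close> sends infinity to 0; this happens on a null set only.\<close>

lemma nn_integral_exp_neg:
  assumes "0 \<le> l"
  shows "(\<integral>\<^sup>+\<omega>. exp_neg l (V unit_rats \<omega>) \<partial>M) = ennreal (laplace l)"
proof -
  have "(\<integral>\<^sup>+\<omega>. exp_neg l (V unit_rats \<omega>) \<partial>M) =
      (\<integral>\<^sup>+\<omega>. ennreal (exp (- l * enn2real (V unit_rats \<omega>))) \<partial>M)"
    by (rule nn_integral_cong_AE) (use AE_V_finite in eventually_elim, auto simp: exp_neg_def)
  also have "\<dots> = ennreal (laplace l)"
    unfolding laplace_def by (rule nn_integral_eq_integral[OF integrable_laplace[OF assms]]) simp
  finally show ?thesis .
qed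

lemma laplace_pos: "0 \<le> l \<Longrightarrow> 0 < laplace l"
proof -
  assume l: "0 \<le> l"
  have "0 \<le> laplace l" unfolding laplace_def by (rule integral_nonneg_AE) auto
  moreover have "laplace l \<noteq> 0"
    unfolding laplace_def using integrable_laplace[OF l] by (subst integral_nonneg_eq_0_iff_AE) auto
  ultimately show ?thesis by simp
qed

lemma laplace_antimono: "0 \<le> l \<Longrightarrow> l \<le> m \<Longrightarrow> laplace m \<le> laplace l"
  unfolding laplace_def
  by (intro integral_mono integrable_laplace) (auto intro!: mult_right_mono)

lemma laplace_0: "laplace 0 = 1"
  by (simp add: laplace_def prob_space)

text \<open>Equality would make the variation vanish almost surely, contrary to
  \<open>V_pos\<close>. This gives the positive starting value that the superadditive limit
  requires.\<close>

lemma laplace_1_less: "laplace 1 < 1"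
proof -
  let ?X = "\<lambda>\<omega>. enn2real (V unit_rats \<omega>)"
  have int: "integrable M (\<lambda>\<omega>. 1 - exp (- 1 * ?X \<omega>))"
    using integrable_laplace[of 1] by (intro Bochner_Integration.integrable_diff) auto
  have eq: "(\<integral>\<omega>. 1 - exp (- 1 * ?X \<omega>) \<partial>M) = 1 - laplace 1"
    using integrable_laplace[of 1] by (simp add: laplace_def prob_space)
  have "0 \<le> (\<integral>\<omega>. 1 - exp (- 1 * ?X \<omega>) \<partial>M)" by (rule integral_nonneg_AE) auto
  moreover have "(\<integral>\<omega>. 1 - exp (- 1 * ?X \<omega>) \<partial>M) \<noteq> 0"
  proof
    assume "(\<integral>\<omega>. 1 - exp (- 1 * ?X \<omega>) \<partial>M) = 0"
    then have "AE \<omega> in M. 1 - exp (- 1 * ?X \<omega>) = 0"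
      using int by (subst (asm) integral_nonneg_eq_0_iff_AE) auto
    then have "AE \<omega> in M. V unit_rats \<omega> = 0"
      using AE_V_finite by eventually_elim (auto simp: enn2real_eq_0_iff)
    then show False using V_pos by contradiction
  qed
  ultimately show ?thesis unfolding eq by simp
qed

lemma nn_integral_exp_neg_le_power:
  assumes l: "0 \<le> l"
  shows "(\<integral>\<^sup>+\<omega>. exp_neg l (V (\<rat> \<inter> {0..real n}) \<omega>) \<partial>M) \<le> ennreal (laplace l) ^ n"
proof (induction n)
  case 0
  have "(\<integral>\<^sup>+\<omega>. exp_neg l (V (\<rat> \<inter> {0..real 0}) \<omega>) \<partial>M) \<le> (\<integral>\<^sup>+\<omega>. 1 \<partial>M)"
    by (intro nn_integral_mono exp_neg_le_1 l)
  then show ?case by (simp add: emeasure_space_1)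
next
  case (Suc n)
  let ?s = "real n"
  let ?g = "\<lambda>A f. exp_neg l (gvar (\<lambda>d. \<bar>d\<bar> powr p) A f)"
  have mg: "?g A \<in> borel_measurable paths" if "countable A" "A \<subseteq> {0..}" for A
    by (rule measurable_compose[OF measurable_gvar[OF that measurable_powr_abs] measurable_exp_neg])
  have "(\<integral>\<^sup>+\<omega>. exp_neg l (V (\<rat> \<inter> {0..real (Suc n)}) \<omega>) \<partial>M) \<le>
      (\<integral>\<^sup>+\<omega>. ?g (\<rat> \<inter> {0..?s}) (past ?s \<omega>) * ?g unit_rats (future ?s \<omega>) \<partial>M)"
  proof (rule nn_integral_mono)
    fix \<omega>
    have "?g (\<rat> \<inter> {0..?s}) (past ?s \<omega>) * ?g unit_rats (future ?s \<omega>) =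
        exp_neg l (V (\<rat> \<inter> {0..?s}) \<omega> + V (\<rat> \<inter> {?s..?s + 1}) \<omega>)"
      by (simp add: exp_neg_add gvar_past gvar_future[OF unit_rats(2)] translate_unit_rats V_def)
    moreover have "V (\<rat> \<inter> {0..?s}) \<omega> + V (\<rat> \<inter> {?s..?s + 1}) \<omega> \<le> V (\<rat> \<inter> {0..real (Suc n)}) \<omega>"
      unfolding V_def rat_Icc_Suc by (rule gvar_superadd) auto
    ultimately show "exp_neg l (V (\<rat> \<inter> {0..real (Suc n)}) \<omega>) \<le>
        ?g (\<rat> \<inter> {0..?s}) (past ?s \<omega>) * ?g unit_rats (future ?s \<omega>)"
      using exp_neg_antimono[OF l] by simp
  qed
  also have "\<dots> = (\<integral>\<^sup>+\<omega>. ?g (\<rat> \<inter> {0..?s}) (past ?s \<omega>) \<partial>M) * (\<integral>\<^sup>+\<omega>. ?g unit_rats (future 0 \<omega>) \<partial>M)"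
    by (intro markov mg countable_rat_Int unit_rats) auto
  also have "\<dots> = (\<integral>\<^sup>+\<omega>. exp_neg l (V (\<rat> \<inter> {0..?s}) \<omega>) \<partial>M) * ennreal (laplace l)"
    using nn_integral_exp_neg[OF l] by (simp add: gvar_past gvar_future_0[OF unit_rats(2)] V_def)
  also have "\<dots> \<le> ennreal (laplace l) ^ n * ennreal (laplace l)"
    by (intro mult_right_mono Suc.IH) simp
  finally show ?case by (simp add: mult.commute)
qed

text \<open>Dilating time by n multiplies increments by n^(1/\<alpha>), hence their p-th powers by
  n^(p/\<alpha>), a factor absorbed into l.\<close>

lemma nn_integral_exp_neg_scaling:
  assumes l: "0 \<le> l" and n: "0 < n"
  shows "(\<integral>\<^sup>+\<omega>. exp_neg l (V (\<rat> \<inter> {0..real n}) \<omega>) \<partial>M) = ennreal (laplace (l * real n powr (p / \<alpha>)))"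
proof -
  let ?k = "real n powr (p / \<alpha>)"
  have k: "0 < ?k" using n by simp
  have "(*) (real n) ` unit_rats = \<rat> \<inter> {0..real n}" using n by (intro rat_Icc_dilate) auto
  then have "(\<integral>\<^sup>+\<omega>. exp_neg l (V (\<rat> \<inter> {0..real n}) \<omega>) \<partial>M) =
      (\<integral>\<^sup>+\<omega>. exp_neg l (gvar (\<lambda>d. \<bar>real n powr (1 / \<alpha>) * d\<bar> powr p) unit_rats (\<lambda>t. Z t \<omega>)) \<partial>M)"
    using nn_integral_gvar_scaling[OF unit_rats measurable_powr_abs measurable_exp_neg, of "real n"] n
    by (simp add: V_def)
  also have "(\<lambda>d. \<bar>real n powr (1 / \<alpha>) * d\<bar> powr p) = (\<lambda>d. ?k * \<bar>d\<bar> powr p)"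
    by (simp add: abs_mult powr_mult powr_powr)
  also have "(\<integral>\<^sup>+\<omega>. exp_neg l (gvar (\<lambda>d. ?k * \<bar>d\<bar> powr p) unit_rats (\<lambda>t. Z t \<omega>)) \<partial>M) =
      (\<integral>\<^sup>+\<omega>. exp_neg (l * ?k) (V unit_rats \<omega>) \<partial>M)"
    using k by (simp add: gvar_scale exp_neg_cmult V_def)
  also have "\<dots> = ennreal (laplace (l * ?k))"
    using l k by (intro nn_integral_exp_neg) simp
  finally show ?thesis .
qed

lemma laplace_limit:
  assumes nosub: "\<not> (subordinator M Z \<or> subordinator M (\<lambda>t \<omega>. - Z t \<omega>))"
  shows "\<exists>C>0. ((\<lambda>l. - ln (laplace l) / l powr (\<alpha> / p)) \<longlongrightarrow> C) at_top"
proof -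
  obtain c q where c: "0 \<le> c" and q: "0 < q"
    and cq: "\<And>n. q ^ n \<le> prob {\<omega>\<in>space M. V (\<rat> \<inter> {0..real n}) \<omega> \<le> ennreal (real n * c)}"
    using prob_V_le[OF nosub] by blast
  have inv: "1 / (\<alpha> / p) = p / \<alpha>" by simp
  show ?thesis
  \<comment> \<open>The constant is the price of steering: on [0, n] the variation is at most n c
    with probability at least q^n, so its Laplace transform at 1 is at least exp (- n c)
    q^n.\<close>
  proof (rule superadditive_regular_limit[where c = "c - ln q"], unfold inv)
    show "0 < \<alpha> / p" using \<alpha>_pos p_pos by simp
    show "- ln (laplace x) \<le> - ln (laplace y)" if "0 \<le> x" "x \<le> y" for x y
      using laplace_antimono[OF that] laplace_pos[of y] that by (intro le_imp_neg_le ln_mono) auto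
    show "0 < - ln (laplace 1)"
      using laplace_1_less laplace_pos[of 1] by simp
    show "real n * - ln (laplace l) \<le> - ln (laplace (real n powr (p / \<alpha>) * l))" if l: "0 \<le> l" for n l
    \<comment> \<open>The scaling identity is for positive n; for n = 0 the power is 0 and
      \<open>laplace 0 = 1\<close>.\<close>
    proof (cases "n = 0")
      case True
      then show ?thesis by (simp add: laplace_0)
    next
      case False
      have "ennreal (laplace (l * real n powr (p / \<alpha>))) \<le> ennreal (laplace l) ^ n"
        using nn_integral_exp_neg_le_power[OF l, of n] nn_integral_exp_neg_scaling[OF l, of n] False by simp
      then have "laplace (l * real n powr (p / \<alpha>)) \<le> laplace l ^ n"
        using laplace_pos[OF l] by (simp add: ennreal_power ennreal_le_iff)
      moreover have "0 < laplace (l * real n powr (p / \<alpha>))" using l by (intro laplace_pos) simp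
      ultimately have "ln (laplace (l * real n powr (p / \<alpha>))) \<le> ln (laplace l ^ n)"
        by (intro ln_mono) auto
      then show ?thesis using laplace_pos[OF l] by (simp add: ln_realpow mult.commute)
    qed
    show "- ln (laplace (real n powr (p / \<alpha>))) \<le> (c - ln q) * real n" for n
    proof (cases "n = 0")
      case True
      then show ?thesis by (simp add: laplace_0)
    next
      case False
      let ?E = "{\<omega>\<in>space M. V (\<rat> \<inter> {0..real n}) \<omega> \<le> ennreal (real n * c)}"
      have [measurable]: "V (\<rat> \<inter> {0..real n}) \<in> borel_measurable M"
        by (intro measurable_V countable_rat_Int) auto
      have "ennreal (exp (- (real n * c)) * q ^ n) \<le> ennreal (exp (- (real n * c))) * emeasure M ?E"
        using cq[of n] by (simp add: ennreal_mult' emeasure_eq_measure ennreal_leI mult_left_mono)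
      also have "\<dots> = (\<integral>\<^sup>+\<omega>. ennreal (exp (- (real n * c))) * indicator ?E \<omega> \<partial>M)"
        by (rule nn_integral_cmult_indicator[symmetric]) measurable
      also have "\<dots> \<le> (\<integral>\<^sup>+\<omega>. exp_neg 1 (V (\<rat> \<inter> {0..real n}) \<omega>) \<partial>M)"
      proof (rule nn_integral_mono)
        fix \<omega>
        show "ennreal (exp (- (real n * c))) * indicator ?E \<omega> \<le> exp_neg 1 (V (\<rat> \<inter> {0..real n}) \<omega>)"
          using exp_neg_antimono[of 1 "V (\<rat> \<inter> {0..real n}) \<omega>" "ennreal (real n * c)"] c
          by (auto simp: exp_neg_ennreal split: split_indicator)
      qed
      also have "\<dots> = ennreal (laplace (real n powr (p / \<alpha>)))"
        using nn_integral_exp_neg_scaling[of 1 n] False by simp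
      finally have "exp (- (real n * c)) * q ^ n \<le> laplace (real n powr (p / \<alpha>))"
        using laplace_pos[of "real n powr (p / \<alpha>)"] by (simp add: ennreal_le_iff)
      then have "ln (exp (- (real n * c)) * q ^ n) \<le> ln (laplace (real n powr (p / \<alpha>)))"
        using q by (intro ln_mono) auto
      then show ?thesis using q by (simp add: ln_mult ln_realpow algebra_simps)
    qed
  qed
qed

text \<open>Right continuity reduces all times to rational ones. \<open>enn2real\<close> sends
  infinity to 0 and thereby places paths of infinite variation in the event on the right; they form
  a null set.\<close>

lemma measure_strong_variation:
  assumes \<epsilon>: "0 < \<epsilon>"
  shows "measure M {\<omega>\<in>space M. strong_variation p (\<lambda>t. Z t \<omega>) \<le> ennreal \<epsilon>} =
    measure M {\<omega>\<in>space M. enn2real (V unit_rats \<omega>) \<le> \<epsilon> powr p}"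
proof -
  have V: "variation_sum p (\<lambda>t. Z t \<omega>) = V unit_rats \<omega>" if "\<omega> \<in> space M" for \<omega>
  proof -
    have "continuous_on UNIV (\<lambda>d::real. \<bar>d\<bar> powr p)"
      using p_pos by (intro continuous_on_powr' continuous_intros) auto
    then show ?thesis
      unfolding variation_sum_eq_gvar V_def using Z_right[OF that] by (rule gvar_rational)
  qed
  have iff: "strong_variation p (\<lambda>t. Z t \<omega>) \<le> ennreal \<epsilon> \<longleftrightarrow> V unit_rats \<omega> < \<infinity> \<and> enn2real (V unit_rats \<omega>) \<le> \<epsilon> powr p"
    if "\<omega> \<in> space M" for \<omega>
  proof (cases "V unit_rats \<omega> = \<infinity>")
    case True
    then show ?thesis using V[OF that] by (simp add: strong_variation_def top_unique)
  next
    case False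
    let ?x = "enn2real (V unit_rats \<omega>)"
    have "?x powr (1 / p) \<le> \<epsilon> \<longleftrightarrow> ?x \<le> \<epsilon> powr p"
    proof
      assume "?x powr (1 / p) \<le> \<epsilon>"
      then have "(?x powr (1 / p)) powr p \<le> \<epsilon> powr p" using p_pos by (intro powr_mono2) auto
      then show "?x \<le> \<epsilon> powr p" using p_pos by (simp add: powr_powr)
    next
      assume "?x \<le> \<epsilon> powr p"
      then have "?x powr (1 / p) \<le> (\<epsilon> powr p) powr (1 / p)" using p_pos by (intro powr_mono2) auto
      then show "?x powr (1 / p) \<le> \<epsilon>" using p_pos \<epsilon> by (simp add: powr_powr)
    qed
    moreover have "strong_variation p (\<lambda>t. Z t \<omega>) = ennreal (?x powr (1 / p))"
      using False V[OF that] by (simp add: strong_variation_def)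
    moreover have "V unit_rats \<omega> < \<infinity>" using False by (simp add: less_top)
    ultimately show ?thesis by (simp only: ennreal_le_iff[OF less_imp_le[OF \<epsilon>]] simp_thms)
  qed
  have "{\<omega>\<in>space M. strong_variation p (\<lambda>t. Z t \<omega>) \<le> ennreal \<epsilon>} =
      {\<omega>\<in>space M. V unit_rats \<omega> < \<infinity> \<and> enn2real (V unit_rats \<omega>) \<le> \<epsilon> powr p}"
    using iff by blast
  also have "measure M \<dots> = measure M {\<omega>\<in>space M. enn2real (V unit_rats \<omega>) \<le> \<epsilon> powr p}"
  proof (rule measure_eq_AE)
    show "AE \<omega> in M. \<omega> \<in> {\<omega>\<in>space M. V unit_rats \<omega> < \<infinity> \<and> enn2real (V unit_rats \<omega>) \<le> \<epsilon> powr p} \<longleftrightarrow>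
        \<omega> \<in> {\<omega>\<in>space M. enn2real (V unit_rats \<omega>) \<le> \<epsilon> powr p}"
      using AE_V_finite by eventually_elim auto
  qed measurable
  finally show ?thesis .
qed

end

theorem theorem3:
  fixes M :: "'a measure" and Z :: "real \<Rightarrow> 'a \<Rightarrow> real" and \<alpha> p :: real
  assumes "strictly_stable M \<alpha> Z"
    and "\<not> (subordinator M Z \<or> subordinator M (\<lambda>t \<omega>. - Z t \<omega>))"
    and "p > max 1 \<alpha>"
  shows "\<exists>K::real. K > 0 \<and>
    ((\<lambda>\<epsilon>. \<epsilon> powr (p * \<alpha> / (p - \<alpha>)) *
        ln (measure M {\<omega> \<in> space M. strong_variation p (\<lambda>t. Z t \<omega>) \<le> ennreal \<epsilon>}))
      \<longlongrightarrow> - K) (at_right 0)"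
proof -
  interpret stable M Z \<alpha> p
    using assms(1,3)
    by (simp add: stable_def stable_axioms_def levy_def levy_axioms_def strictly_stable_def levy_process_def)
  let ?a = "\<alpha> / p" and ?P = "\<lambda>x. measure M {\<omega>\<in>space M. enn2real (V unit_rats \<omega>) \<le> x}"
  have a: "0 < ?a" "?a < 1" using \<alpha>_pos p_pos p by auto
  obtain C where C: "0 < C" "((\<lambda>l. - ln (laplace l) / l powr ?a) \<longlongrightarrow> C) at_top"
    using laplace_limit[OF assms(2)] by blast
  define K where "K = (1 - ?a) * C * (C * ?a) powr (?a / (1 - ?a))"
  have "((\<lambda>x. x powr (?a / (1 - ?a)) * ln (?P x)) \<longlongrightarrow> - K) (at_right 0)"
    unfolding K_def
    by (rule exponential_tauberian[OF prob_space_axioms _ _ a C(1) C(2)[unfolded laplace_def]]) auto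
  \<comment> \<open>The Tauberian theorem concerns the p-th power of the norm; substituting x =
    \<epsilon>^p multiplies the exponent by p.\<close>
  moreover have "filterlim (\<lambda>\<epsilon>::real. \<epsilon> powr p) (at_right 0) (at_right 0)"
    using p_pos by real_asymp
  ultimately have "((\<lambda>\<epsilon>. (\<epsilon> powr p) powr (?a / (1 - ?a)) * ln (?P (\<epsilon> powr p))) \<longlongrightarrow> - K) (at_right 0)"
    by (rule filterlim_compose)
  moreover have "p * (?a / (1 - ?a)) = p * \<alpha> / (p - \<alpha>)"
    using p_pos p by (simp add: field_simps)
  ultimately have lim: "((\<lambda>\<epsilon>. \<epsilon> powr (p * \<alpha> / (p - \<alpha>)) * ln (?P (\<epsilon> powr p))) \<longlongrightarrow> - K) (at_right 0)"
    by (simp only: powr_powr)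
  have "((\<lambda>\<epsilon>. \<epsilon> powr (p * \<alpha> / (p - \<alpha>)) *
        ln (measure M {\<omega> \<in> space M. strong_variation p (\<lambda>t. Z t \<omega>) \<le> ennreal \<epsilon>}))
      \<longlongrightarrow> - K) (at_right 0)"
  proof (rule Lim_transform_eventually[OF lim])
    show "\<forall>\<^sub>F \<epsilon> in at_right 0. \<epsilon> powr (p * \<alpha> / (p - \<alpha>)) * ln (?P (\<epsilon> powr p)) =
        \<epsilon> powr (p * \<alpha> / (p - \<alpha>)) *
        ln (measure M {\<omega> \<in> space M. strong_variation p (\<lambda>t. Z t \<omega>) \<le> ennreal \<epsilon>})"
      using eventually_at_right_less[of 0] by eventually_elim (simp add: measure_strong_variation)
  qed
  moreover have "0 < K"
    unfolding K_def using a C(1) mult_pos_pos[OF C(1) a(1)] by (intro mult_pos_pos) auto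
  ultimately show ?thesis by blast
qed

end
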